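(* Let $b_1,b_2>0$. For any $\varphi\in l^2(\mathbb{Z}\setminus\{0\})$ there exists a unique solution $(u,v)\in C(\mathbb{R},l^2(\mathbb{Z}\setminus\{0\}))$ of the system $$ \left\{ \begin{array}{ll} i u_t(t,j) + b_1^{-2}(\Delta_d u)(t,j) = 0, & j\leq -1,\ t\neq 0,\\ i v_t(t,j) + b_2^{-2}(\Delta_d v)(t,j) = 0, & j\geq 1,\ t\neq 0,\\ u(t,0)=v(t,0), & t\neq 0,\\ b_1^{-2}(u(t,-1)-u(t,0))=b_2^{-2}(v(t,0)-v(t,1)), & t\neq 0,\\ u(0,j)=\varphi(j), & j\leq -1,\\ v(0,j)=\varphi(j), & j\geq 1. \end{array} \right. $$ Moreover, there exists a positive constant $C(b_1,b_2)$ (depending only on $b_1,b_2$) such that $$\|(u,v)(t)\|_{l^\infty(\mathbb{Z}\setminus\{0\})}\leq C(b_1,b_2)(|t|+1)^{-1/3}\|\varphi\|_{l^1(\mathbb{Z}\setminus\{0\})},\quad \forall\, t\in\mathbb{R},$$ holds for all $\varphi\in l^1(\mathbb{Z}\setminus\{0\})$.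
   Context: $\Delta_d$ is the discrete Laplacian, $(\Delta_d w)(j)=w(j+1)-2w(j)+w(j-1)$. Functions are complex valued. The unknowns are $u(t,j)$ for $j\le -1$ and $v(t,j)$ for $j\ge 1$; the pair $(u,v)(t)$ is identified with the sequence on $\mathbb{Z}\setminus\{0\}$ equal to $u(t,j)$ for $j\le -1$ and $v(t,j)$ for $j\ge 1$. The values $u(t,0)$ and $v(t,0)$ are auxiliary quantities introduced only to couple the two equations; they are determined by the third and fourth lines of the system. *)

theory Defs
  imports "HOL-Analysis.Analysis"
begin

text \<open>
  A sequence on the nonzero integers is represented by a function on all of \<^typ>\<open>int\<close>; every
  notion below ignores its value at \<open>0\<close>.
\<close>

abbreviation nonzero_ints :: "int set" where
  "nonzero_ints \<equiv> UNIV - {0}"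

definition l1 :: "(int \<Rightarrow> complex) set" where
  "l1 = {w. (\<lambda>j. cmod (w j)) summable_on nonzero_ints}"

definition l1_norm :: "(int \<Rightarrow> complex) \<Rightarrow> real" where
  "l1_norm w = (\<Sum>\<^sub>\<infinity>j\<in>nonzero_ints. cmod (w j))"

definition l2 :: "(int \<Rightarrow> complex) set" where
  "l2 = {w. (\<lambda>j. (cmod (w j))\<^sup>2) summable_on nonzero_ints}"

definition l2_norm :: "(int \<Rightarrow> complex) \<Rightarrow> real" where
  "l2_norm w = sqrt (\<Sum>\<^sub>\<infinity>j\<in>nonzero_ints. (cmod (w j))\<^sup>2)"

text \<open>The supremum is only meaningful for bounded sequences, in particular for those in \<^const>\<open>l2\<close>.\<close>

definition linf_norm :: "(int \<Rightarrow> complex) \<Rightarrow> real" where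
  "linf_norm w = (SUP j\<in>nonzero_ints. cmod (w j))"

text \<open>The space of norm-continuous curves from the reals to \<^const>\<open>l2\<close>.\<close>

definition C_l2 :: "(real \<Rightarrow> int \<Rightarrow> complex) set" where
  "C_l2 = {w. (\<forall>t. w t \<in> l2) \<and>
              (\<forall>t. ((\<lambda>s. l2_norm (\<lambda>j. w s j - w t j)) \<longlongrightarrow> 0) (at t))}"

definition discrete_laplacian :: "(int \<Rightarrow> complex) \<Rightarrow> int \<Rightarrow> complex" where
  "discrete_laplacian w j = w (j + 1) - 2 * w j + w (j - 1)"

text \<open>
  The sequence on the nonzero integers that a pair \<open>(u, v)\<close> is identified with. It does not
  involve the auxiliary coupling values \<open>u 0\<close> and \<open>v 0\<close>.
\<close>

definition pair_seq :: "(int \<Rightarrow> complex) \<Rightarrow> (int \<Rightarrow> complex) \<Rightarrow> int \<Rightarrow> complex" where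
  "pair_seq u v j = (if j \<le> -1 then u j else if j \<ge> 1 then v j else 0)"

text \<open>
  Only the values \<open>u t j\<close> for \<open>j \<le> 0\<close> and \<open>v t j\<close> for \<open>j \<ge> 0\<close> matter; the time derivatives are
  classical derivatives of the individual components.
\<close>

definition is_solution ::
  "real \<Rightarrow> real \<Rightarrow> (int \<Rightarrow> complex) \<Rightarrow> (real \<Rightarrow> int \<Rightarrow> complex) \<Rightarrow> (real \<Rightarrow> int \<Rightarrow> complex) \<Rightarrow> bool"
where
  "is_solution b1 b2 \<phi> u v \<longleftrightarrow>
     (\<lambda>t. pair_seq (u t) (v t)) \<in> C_l2 \<and>
     (\<forall>t j. t \<noteq> 0 \<and> j \<le> -1 \<longrightarrow>
        (\<exists>u'. ((\<lambda>s. u s j) has_vector_derivative u') (at t) \<and>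
              \<i> * u' + of_real (1 / b1\<^sup>2) * discrete_laplacian (u t) j = 0)) \<and>
     (\<forall>t j. t \<noteq> 0 \<and> j \<ge> 1 \<longrightarrow>
        (\<exists>v'. ((\<lambda>s. v s j) has_vector_derivative v') (at t) \<and>
              \<i> * v' + of_real (1 / b2\<^sup>2) * discrete_laplacian (v t) j = 0)) \<and>
     (\<forall>t. t \<noteq> 0 \<longrightarrow> u t 0 = v t 0) \<and>
     (\<forall>t. t \<noteq> 0 \<longrightarrow>
        of_real (1 / b1\<^sup>2) * (u t (-1) - u t 0) = of_real (1 / b2\<^sup>2) * (v t 0 - v t 1)) \<and>
     (\<forall>j. j \<le> -1 \<longrightarrow> u 0 j = \<phi> j) \<and>
     (\<forall>j. j \<ge> 1 \<longrightarrow> v 0 j = \<phi> j)"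

end

theory Submission
  imports Defs "HOL-Complex_Analysis.Complex_Analysis"
begin

text \<open>
  Write \<open>\<alpha> = 1 / b1\<^sup>2\<close>, \<open>\<beta> = 1 / b2\<^sup>2\<close> and, after a reflection, \<open>c\<^sup>2 = \<beta> / \<alpha> \<le> 1\<close>. With the spectral parameter
  \<open>\<omega> = 4 s\<^sup>2\<close> the decaying solutions of the two resolvent equations are powers of
  \<open>r1 = rho1\<^sup>2\<close> and \<open>r2 = (rho2 / c)\<^sup>2\<close>, where \<open>rho - 1 / rho\<close> is \<open>2 \<i> s\<close> and \<open>2 \<i> s / c\<close>
  respectively. The kernel of the coupled system is the Dirichlet kernel of one half line plus
  integrals of \<open>exp (-4 \<i> t s\<^sup>2) Re (r1 ^ p r2 ^ q / (rho1 + rho2))\<close> over \<open>s \<in> [0, 1]\<close>; the substitution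
  \<open>\<omega> = 4 s\<^sup>2\<close> cancels the edge singularities of the density. At time \<open>0\<close> these integrals vanish
  by Cauchy's theorem in the variable \<open>r1\<close>.

  For the decay, the phase is \<open>-4 t s\<^sup>2 + 2 p arcsin s + 2 q arcsin (s / c)\<close>, and all derivatives of
  \<open>arcsin\<close> are nonnegative. Hence the second derivative of the phase is \<open>-8 t + s m(s)\<close> with \<open>m\<close>
  nondecreasing, so it is at least \<open>8 \<bar>t\<bar> \<bar>s - \<sigma>\<bar>\<close> in absolute value for a suitable \<open>\<sigma>\<close>, uniformly in
  \<open>p\<close> and \<open>q\<close>; this yields \<open>\<bar>t\<bar> powr (-1/3)\<close>. The amplitude is built from bounded monotone functions,
  which the second mean value theorem allows to be inserted. Existence for square-summable data is
  the exponential series; uniqueness and the passage to summable data use Gronwall's inequality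
  in the supremum norm.
\<close>

section \<open>Van der Corput estimates\<close>

text \<open>The formula for the kernel comes from Stone's formula. Take the left speed as 1. A unit
  source at k > 0, solved with value 0 at the interface, sends the flux r2^k there; decaying
  solutions with common value A must balance it by A ((r1 - 1) + c^2 (r2 - 1)). Since r1 - 1 = 2 i s
  rho1 and c^2 (r2 - 1) = 2 i s rho2, this gives A = i r2^k / (2 s (rho1 + rho2)). The imaginary
  part of A times d\<omega> / pi = 8 s ds / pi is 4 / pi times the real part of r2^k / (rho1 +
  rho2), which explains both the real part and the factor 4 / pi. With this candidate at hand, only
  the evolution equations, the flux balance and the initial values have to be verified. The obstacle
  to decay is uniformity: both exponents are unbounded, and derivatives of phase and amplitude blow
  up at the band edges s = c and s = 1. Hence the estimates rest on monotonicity and on the position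
  of sign changes.\<close>

definition osc_bounded :: "(real \<Rightarrow> complex) \<Rightarrow> real \<Rightarrow> real \<Rightarrow> real \<Rightarrow> bool" where
  "osc_bounded f a b M \<longleftrightarrow> f integrable_on {a..b} \<and>
     (\<forall>x y. a \<le> x \<and> x \<le> y \<and> y \<le> b \<longrightarrow> cmod (integral {x..y} f) \<le> M)"

lemma has_integral_complexI:
  assumes "((\<lambda>x. Re (f x)) has_integral p) S" "((\<lambda>x. Im (f x)) has_integral q) S"
  shows "(f has_integral Complex p q) S"
proof -
  have "((\<lambda>x. of_real (Re (f x)) + \<i> * of_real (Im (f x))) has_integral (of_real p + \<i> * of_real q)) S"
    by (intro has_integral_add has_integral_mult_right has_integral_of_real assms)
  then show ?thesis by (simp add: complex_eq[symmetric] Complex_eq)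
qed

lemma osc_bounded_nonneg: "osc_bounded f a b M \<Longrightarrow> a \<le> b \<Longrightarrow> 0 \<le> M"
  unfolding osc_bounded_def by (meson norm_ge_zero order_refl order_trans)

text \<open>The second mean value theorem takes a monotone factor out of the integral at the price
  of an unknown cut point, which is why \<open>osc_bounded\<close> controls all subintervals at
  once. The conclusion has the same form, so several factors can be inserted one after another. The
  theorem concerns real integrands: real and imaginary part contribute 2 K M each.\<close>

lemma osc_bounded_mult_mono:
  assumes f: "osc_bounded f a b M" and ab: "a \<le> b"
    and g: "\<And>x y. \<lbrakk>a \<le> x; x \<le> y; y \<le> b\<rbrakk> \<Longrightarrow> g x \<le> g y"
    and K: "\<And>x. \<lbrakk>a \<le> x; x \<le> b\<rbrakk> \<Longrightarrow> \<bar>g x\<bar> \<le> K"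
  shows "osc_bounded (\<lambda>x. of_real (g x) * f x) a b (4 * K * M)"
proof -
  let ?h = "\<lambda>x. of_real (g x) * f x"
  have M0: "0 \<le> M" using osc_bounded_nonneg[OF f ab] .
  have K0: "0 \<le> K" using K[of a] ab by auto
  have main: "?h integrable_on {x..y} \<and> cmod (integral {x..y} ?h) \<le> 4 * K * M"
    if xy: "a \<le> x" "x \<le> y" "y \<le> b" for x y
  proof -
    have fi: "f integrable_on {u..v}" if "a \<le> u" "v \<le> b" for u v
      using f that unfolding osc_bounded_def
      by (meson atLeastatMost_subset_iff integrable_on_subinterval)
    have fM: "cmod (integral {u..v} f) \<le> M" if "x \<le> u" "v \<le> y" "u \<le> v" for u v
      using f that xy unfolding osc_bounded_def by auto
    have Re: "integral {u..v} (\<lambda>x. Re (f x)) = Re (integral {u..v} f)"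
      and Rei: "(\<lambda>x. Re (f x)) integrable_on {u..v}"
      and Im: "integral {u..v} (\<lambda>x. Im (f x)) = Im (integral {u..v} f)"
      and Imi: "(\<lambda>x. Im (f x)) integrable_on {u..v}" if "a \<le> u" "v \<le> b" for u v
      using has_integral_Re[OF integrable_integral[OF fi[OF that]]]
        has_integral_Im[OF integrable_integral[OF fi[OF that]]]
      by (auto simp: integral_unique has_integral_integrable)
    have gm: "g u \<le> g v" if "x \<le> u" "u \<le> v" "v \<le> y" for u v
      using g[of u v] that xy by auto
    obtain c where c: "c \<in> {x..y}" and
      hc: "((\<lambda>s. g s * Re (f s)) has_integral (g x * integral {x..c} (\<lambda>s. Re (f s)) + g y * integral {c..y} (\<lambda>s. Re (f s)))) {x..y}"
      using second_mean_value_theorem_full[OF Rei[OF xy(1,3)] xy(2), of g] gm by blast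
    obtain d where d: "d \<in> {x..y}" and
      hd: "((\<lambda>s. g s * Im (f s)) has_integral (g x * integral {x..d} (\<lambda>s. Im (f s)) + g y * integral {d..y} (\<lambda>s. Im (f s)))) {x..y}"
      using second_mean_value_theorem_full[OF Imi[OF xy(1,3)] xy(2), of g] gm by blast
    let ?p = "g x * integral {x..c} (\<lambda>s. Re (f s)) + g y * integral {c..y} (\<lambda>s. Re (f s))"
    let ?q = "g x * integral {x..d} (\<lambda>s. Im (f s)) + g y * integral {d..y} (\<lambda>s. Im (f s))"
    have hh: "(?h has_integral Complex ?p ?q) {x..y}"
      by (rule has_integral_complexI) (use hc hd in auto)
    have gK: "\<bar>g x\<bar> \<le> K" "\<bar>g y\<bar> \<le> K" using K xy by auto
    have ReM: "\<bar>integral {u..v} (\<lambda>x. Re (f x))\<bar> \<le> M" if "x \<le> u" "v \<le> y" "u \<le> v" for u v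
      using fM[OF that] abs_Re_le_cmod[of "integral {u..v} f"] Re[of u v] that xy by auto
    have ImM: "\<bar>integral {u..v} (\<lambda>x. Im (f x))\<bar> \<le> M" if "x \<le> u" "v \<le> y" "u \<le> v" for u v
      using fM[OF that] abs_Im_le_cmod[of "integral {u..v} f"] Im[of u v] that xy by auto
    have m: "\<bar>r * s\<bar> \<le> K * M" if "\<bar>r\<bar> \<le> K" "\<bar>s\<bar> \<le> M" for r s
      using that by (simp add: abs_mult mult_mono K0)
    have "\<bar>?p\<bar> \<le> K * M + K * M"
      by (rule order_trans[OF abs_triangle_ineq add_mono]) (use m gK ReM c in auto)
    moreover have "\<bar>?q\<bar> \<le> K * M + K * M"
      by (rule order_trans[OF abs_triangle_ineq add_mono]) (use m gK ImM d in auto)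
    ultimately have "cmod (Complex ?p ?q) \<le> 4 * K * M"
      using cmod_le[of "Complex ?p ?q"] by simp
    with hh show ?thesis
      by (auto simp: integral_unique has_integral_integrable)
  qed
  show ?thesis
    unfolding osc_bounded_def using main ab by auto
qed

lemma osc_bounded_uminus: "osc_bounded f a b M \<Longrightarrow> osc_bounded (\<lambda>x. - f x) a b M"
  unfolding osc_bounded_def by (auto intro: integrable_neg)

lemma osc_bounded_mult_antimono:
  assumes f: "osc_bounded f a b M" and ab: "a \<le> b"
    and g: "\<And>x y. \<lbrakk>a \<le> x; x \<le> y; y \<le> b\<rbrakk> \<Longrightarrow> g y \<le> g x"
    and K: "\<And>x. \<lbrakk>a \<le> x; x \<le> b\<rbrakk> \<Longrightarrow> \<bar>g x\<bar> \<le> K"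
  shows "osc_bounded (\<lambda>x. of_real (g x) * f x) a b (4 * K * M)"
  using osc_bounded_uminus[OF osc_bounded_mult_mono[OF f ab, of "\<lambda>x. - g x" K]] g K by simp

lemma osc_bounded_add:
  assumes f: "osc_bounded f a b M" and g: "osc_bounded g a b N"
  shows "osc_bounded (\<lambda>x. f x + g x) a b (M + N)"
  unfolding osc_bounded_def
proof (intro conjI allI impI)
  show "(\<lambda>x. f x + g x) integrable_on {a..b}"
    using f g unfolding osc_bounded_def by (auto intro: integrable_add)
  fix x y assume xy: "a \<le> x \<and> x \<le> y \<and> y \<le> b"
  have "f integrable_on {x..y}" "g integrable_on {x..y}"
    using f g xy unfolding osc_bounded_def
    by (meson atLeastatMost_subset_iff integrable_on_subinterval)+
  then have "integral {x..y} (\<lambda>x. f x + g x) = integral {x..y} f + integral {x..y} g"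
    by (rule integral_add)
  then show "cmod (integral {x..y} (\<lambda>x. f x + g x)) \<le> M + N"
    using f g xy unfolding osc_bounded_def by (auto intro!: norm_triangle_le add_mono)
qed

lemma osc_bounded_cmult:
  assumes "osc_bounded f a b M"
  shows "osc_bounded (\<lambda>x. c * f x) a b (cmod c * M)"
  using assms unfolding osc_bounded_def
  by (auto simp: norm_mult intro!: mult_left_mono integrable_on_mult_right)

text \<open>If the phase has monotone derivative \<open>\<psi>\<close> bounded away from zero, \<open>cis \<phi>\<close> is the
  product of the monotone function \<open>1 / \<psi>\<close> and the exact derivative of \<open>- \<i> cis \<phi>\<close>.\<close>

lemma van_der_corput_first:
  assumes ab: "a \<le> b" and mu: "\<mu> > 0"
    and d: "\<And>x. a \<le> x \<Longrightarrow> x \<le> b \<Longrightarrow> (\<phi> has_real_derivative \<psi> x) (at x)"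
    and mono: "\<And>x y. \<lbrakk>a \<le> x; x \<le> y; y \<le> b\<rbrakk> \<Longrightarrow> \<psi> x \<le> \<psi> y"
    and sgn: "(\<forall>x\<in>{a..b}. \<mu> \<le> \<psi> x) \<or> (\<forall>x\<in>{a..b}. \<psi> x \<le> - \<mu>)"
  shows "cmod (integral {a..b} (\<lambda>x. cis (\<phi> x))) \<le> 8 / \<mu>"
proof -
  let ?f = "\<lambda>x. of_real (\<psi> x) * cis (\<phi> x)"
  have F: "(?f has_integral (- \<i> * cis (\<phi> y) - (- \<i> * cis (\<phi> x)))) {x..y}"
    if "a \<le> x" "x \<le> y" "y \<le> b" for x y
  proof (rule fundamental_theorem_of_calculus[OF \<open>x \<le> y\<close>])
    fix s assume "s \<in> {x..y}"
    then have "(\<phi> has_real_derivative \<psi> s) (at s)" using that d by auto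
    then have "(\<phi> has_vector_derivative \<psi> s) (at s)"
      by (simp add: has_real_derivative_iff_has_vector_derivative)
    then have "((\<lambda>s. cis (\<phi> s)) has_vector_derivative (\<psi> s *\<^sub>R (\<i> * cis (\<phi> s)))) (at s)"
      unfolding has_vector_derivative_def by (auto intro!: derivative_eq_intros)
    then have "((\<lambda>s. - \<i> * cis (\<phi> s)) has_vector_derivative - \<i> * (\<psi> s *\<^sub>R (\<i> * cis (\<phi> s)))) (at s)"
      by (intro has_vector_derivative_mult_right)
    moreover have "- \<i> * (\<psi> s *\<^sub>R (\<i> * cis (\<phi> s))) = ?f s"
      by (simp add: complex_eq_iff)
    ultimately have "((\<lambda>s. - \<i> * cis (\<phi> s)) has_vector_derivative ?f s) (at s)" by metis
    then show "((\<lambda>s. - \<i> * cis (\<phi> s)) has_vector_derivative ?f s) (at s within {x..y})"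
      by (rule has_vector_derivative_at_within)
  qed
  have "osc_bounded ?f a b 2"
    unfolding osc_bounded_def
  proof (intro conjI allI impI)
    show "?f integrable_on {a..b}" using F[of a b] ab by (auto simp: has_integral_integrable)
    fix x y assume "a \<le> x \<and> x \<le> y \<and> y \<le> b"
    then have "integral {x..y} ?f = (- \<i> * cis (\<phi> y) - (- \<i> * cis (\<phi> x)))"
      using F by (auto intro: integral_unique)
    also have "cmod \<dots> \<le> cmod (- \<i> * cis (\<phi> y)) + cmod (- \<i> * cis (\<phi> x))"
      by (rule norm_triangle_ineq4)
    also have "\<dots> = 2" by (simp add: norm_mult)
    finally show "cmod (integral {x..y} ?f) \<le> 2" .
  qed
  moreover have "1 / \<psi> y \<le> 1 / \<psi> x" if "a \<le> x" "x \<le> y" "y \<le> b" for x y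
  proof -
    have "\<psi> x * \<psi> y > 0"
      using sgn
    proof
      assume *: "\<forall>x\<in>{a..b}. \<mu> \<le> \<psi> x"
      have "\<mu> \<le> \<psi> x" "\<mu> \<le> \<psi> y" using * that by auto
      then show ?thesis using mu by simp
    next
      assume *: "\<forall>x\<in>{a..b}. \<psi> x \<le> - \<mu>"
      have "\<psi> x \<le> - \<mu>" "\<psi> y \<le> - \<mu>" using * that by auto
      then show ?thesis using mu by (intro mult_neg_neg) auto
    qed
    then show ?thesis using mono[OF that] by (intro divide_left_mono) (auto simp: mult.commute)
  qed
  moreover have "\<bar>1 / \<psi> x\<bar> \<le> 1 / \<mu>" if "a \<le> x" "x \<le> b" for x
  proof -
    have "\<bar>\<psi> x\<bar> \<ge> \<mu>" using sgn that mu by force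
    then show ?thesis using mu by (simp add: divide_simps)
  qed
  ultimately have "osc_bounded (\<lambda>x. of_real (1 / \<psi> x) * ?f x) a b (4 * (1 / \<mu>) * 2)"
    using ab by (intro osc_bounded_mult_antimono) auto
  then have "cmod (integral {a..b} (\<lambda>x. of_real (1 / \<psi> x) * ?f x)) \<le> 8 / \<mu>"
    using ab unfolding osc_bounded_def by auto
  moreover have "integral {a..b} (\<lambda>x. of_real (1 / \<psi> x) * ?f x) = integral {a..b} (\<lambda>x. cis (\<phi> x))"
  proof (rule integral_cong)
    fix x assume "x \<in> {a..b}"
    then have "\<psi> x \<noteq> 0" using sgn mu by force
    then show "of_real (1 / \<psi> x) * ?f x = cis (\<phi> x)" by simp
  qed
  ultimately show ?thesis by simp
qed

text \<open>Linear growth away from one possible zero, with a known sign on either side. Outside a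
  window of radius \<delta> around \<sigma> the absolute value is at least \<nu> \<delta>, the
  hypothesis of the van der Corput bound one derivative lower. Imposed on a second derivative, it
  takes the place of a lower bound for the third.\<close>

definition crosses :: "(real \<Rightarrow> real) \<Rightarrow> real \<Rightarrow> real \<Rightarrow> real set \<Rightarrow> bool" where
  "crosses h \<nu> \<sigma> S \<longleftrightarrow>
     (\<forall>s\<in>S. (\<sigma> < s \<longrightarrow> \<nu> * (s - \<sigma>) \<le> h s) \<and> (s < \<sigma> \<longrightarrow> h s \<le> - (\<nu> * (\<sigma> - s))))"

lemma cis_integrable:
  assumes "\<And>x. a \<le> x \<Longrightarrow> x \<le> b \<Longrightarrow> (\<phi> has_real_derivative \<psi> x) (at x)"
  shows "(\<lambda>x. cis (\<phi> x)) integrable_on {a..b}"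
proof -
  have "continuous_on {a..b} \<phi>"
    using assms by (intro continuous_at_imp_continuous_on ballI DERIV_isCont) auto
  then show ?thesis by (intro integrable_continuous_interval continuous_on_cis)
qed

lemma cmod_integral_cis_le:
  assumes "a \<le> b"
  shows "cmod (integral {a..b} (\<lambda>x. cis (\<phi> x))) \<le> b - a"
proof (cases "(\<lambda>x. cis (\<phi> x)) integrable_on {a..b}")
  case True
  then show ?thesis
    using integral_norm_bound_integral[of "\<lambda>x. cis (\<phi> x)" "{a..b}" "\<lambda>_. 1"] assms
    by (simp add: integrable_const_ivl integral_const_real)
next
  case False
  then show ?thesis using assms by (simp add: not_integrable_integral)
qed

text \<open>The window around \<sigma> is estimated by its length, the two remaining pieces by the
  hypotheses. Clamping the window to the interval covers every position of \<sigma>, also outside: a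
  piece that collapses contributes 0.\<close>

lemma cmod_integral_cis_split:
  assumes ab: "a \<le> b" and del: "\<delta> \<ge> 0"
    and int: "(\<lambda>x. cis (\<phi> x)) integrable_on {a..b}"
    and l: "\<And>y. a \<le> y \<Longrightarrow> y \<le> b \<Longrightarrow> y \<le> \<sigma> - \<delta> \<Longrightarrow> cmod (integral {a..y} (\<lambda>x. cis (\<phi> x))) \<le> B"
    and r: "\<And>x. a \<le> x \<Longrightarrow> x \<le> b \<Longrightarrow> \<sigma> + \<delta> \<le> x \<Longrightarrow> cmod (integral {x..b} (\<lambda>x. cis (\<phi> x))) \<le> B"
    and B: "B \<ge> 0"
  shows "cmod (integral {a..b} (\<lambda>x. cis (\<phi> x))) \<le> 2 * \<delta> + 2 * B"
proof -
  let ?I = "\<lambda>x y. integral {x..y} (\<lambda>x. cis (\<phi> x))"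
  define p where "p = max a (min b (\<sigma> - \<delta>))"
  define q where "q = max a (min b (\<sigma> + \<delta>))"
  have pq: "a \<le> p" "p \<le> q" "q \<le> b" "q - p \<le> 2 * \<delta>"
    using ab del by (auto simp: p_def q_def)
  have int': "(\<lambda>x. cis (\<phi> x)) integrable_on {p..b}"
    using int pq by (meson atLeastatMost_subset_iff integrable_on_subinterval order_refl order_trans)
  have E: "?I a b = ?I a p + (?I p q + ?I q b)"
    using Henstock_Kurzweil_Integration.integral_combine[OF pq(1) _ int] Henstock_Kurzweil_Integration.integral_combine[OF pq(2,3) int'] pq by simp
  have "cmod (?I a p) \<le> B"
  proof (cases "p \<le> \<sigma> - \<delta>")
    case True
    then show ?thesis using l pq by auto
  next
    case False
    then have "p = a" using ab by (auto simp: p_def)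
    then show ?thesis using B by simp
  qed
  moreover have "cmod (?I q b) \<le> B"
  proof (cases "\<sigma> + \<delta> \<le> q")
    case True
    then show ?thesis using r pq by auto
  next
    case False
    then have "q = b" using ab by (auto simp: q_def)
    then show ?thesis using B by simp
  qed
  moreover have "cmod (?I p q) \<le> 2 * \<delta>"
    using cmod_integral_cis_le[OF pq(2)] pq(4) by (rule order_trans)
  ultimately show ?thesis
    unfolding E using norm_triangle_ineq[of "?I a p" "?I p q + ?I q b"] norm_triangle_ineq[of "?I p q" "?I q b"]
    by linarith
qed

text \<open>\<psi> grows with slope at least \<nu>, so it crosses zero at that rate, with an
  endpoint as \<sigma> when it keeps its sign. Off the window the first-derivative bound costs 8 /
  (\<nu> \<delta>) per side, and \<delta> = 1 / sqrt \<nu> balances this against the window: 2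
  \<delta> + 16 \<delta>.\<close>

lemma van_der_corput_second:
  assumes ab: "a \<le> b" and nu: "\<nu> > 0"
    and d: "\<And>x. a \<le> x \<Longrightarrow> x \<le> b \<Longrightarrow> (\<phi> has_real_derivative \<psi> x) (at x)"
    and d2: "\<And>x. a \<le> x \<Longrightarrow> x \<le> b \<Longrightarrow> (\<psi> has_real_derivative \<kappa> x) (at x)"
    and nu_le: "\<And>x. a \<le> x \<Longrightarrow> x \<le> b \<Longrightarrow> \<nu> \<le> \<kappa> x"
  shows "cmod (integral {a..b} (\<lambda>x. cis (\<phi> x))) \<le> 18 / sqrt \<nu>"
proof -
  have inc: "\<nu> * (y - x) \<le> \<psi> y - \<psi> x" if "a \<le> x" "x \<le> y" "y \<le> b" for x y
  proof (cases "x = y")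
    case False
    then have "x < y" using that by simp
    moreover have "(\<psi> has_real_derivative \<kappa> z) (at z)" if "x \<le> z" "z \<le> y" for z
      using d2 that \<open>a \<le> x\<close> \<open>y \<le> b\<close> by simp
    ultimately obtain z where "z > x" "z < y" "\<psi> y - \<psi> x = (y - x) * \<kappa> z"
      using MVT2[of x y \<psi> \<kappa>] by blast
    then show ?thesis using nu_le[of z] that False by (simp add: mult.commute)
  qed simp
  have mono: "\<psi> x \<le> \<psi> y" if "a \<le> x" "x \<le> y" "y \<le> b" for x y
    using inc[OF that] that nu by (smt (verit) mult_nonneg_nonneg)
  have cont: "continuous_on {a..b} \<psi>"
    using d2 by (intro continuous_at_imp_continuous_on ballI DERIV_isCont) auto
  obtain \<sigma> where cr: "crosses \<psi> \<nu> \<sigma> {a..b}"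
  proof -
    have crI: "crosses \<psi> \<nu> x {a..b}"
      if x: "a \<le> x" "x \<le> b" "x = b \<or> 0 \<le> \<psi> x" "x = a \<or> \<psi> x \<le> 0" for x
      unfolding crosses_def
    proof (intro ballI conjI impI)
      fix s assume "s \<in> {a..b}" "x < s"
      then show "\<nu> * (s - x) \<le> \<psi> s" using inc[of x s] x by auto
    next
      fix s assume "s \<in> {a..b}" "s < x"
      then show "\<psi> s \<le> - (\<nu> * (x - s))" using inc[of s x] x by auto
    qed
    consider "\<psi> a \<ge> 0" | "\<psi> b \<le> 0" | "\<psi> a \<le> 0" "\<psi> b \<ge> 0" by linarith
    then show thesis
    proof cases
      case 1
      then show ?thesis using crI[of a] that ab by blast
    next
      case 2
      then show ?thesis using crI[of b] that ab by blast
    next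
      case 3
      obtain x where "a \<le> x" "x \<le> b" "\<psi> x = 0"
        using IVT'[of \<psi> a 0 b] 3 ab cont by auto
      then show ?thesis using crI[of x] that by auto
    qed
  qed
  define \<delta> where "\<delta> = 1 / sqrt \<nu>"
  have del: "\<delta> > 0" using nu by (simp add: \<delta>_def)
  have nd: "\<nu> * \<delta> = sqrt \<nu>" using nu by (simp add: \<delta>_def real_div_sqrt)
  have "cmod (integral {a..b} (\<lambda>x. cis (\<phi> x))) \<le> 2 * \<delta> + 2 * (8 / (\<nu> * \<delta>))"
  proof (rule cmod_integral_cis_split[where \<sigma> = \<sigma>])
    fix y assume y: "a \<le> y" "y \<le> b" "y \<le> \<sigma> - \<delta>"
    have "\<psi> s \<le> - (\<nu> * \<delta>)" if "s \<in> {a..y}" for s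
    proof -
      have "\<psi> s \<le> - (\<nu> * (\<sigma> - s))" using cr that y del unfolding crosses_def by auto
      also have "\<dots> \<le> - (\<nu> * \<delta>)" using that y nu by auto
      finally show ?thesis .
    qed
    then show "cmod (integral {a..y} (\<lambda>x. cis (\<phi> x))) \<le> 8 / (\<nu> * \<delta>)"
      using y nu del d mono by (intro van_der_corput_first[where \<psi> = \<psi>]) auto
  next
    fix y assume y: "a \<le> y" "y \<le> b" "\<sigma> + \<delta> \<le> y"
    have "\<nu> * \<delta> \<le> \<psi> s" if "s \<in> {y..b}" for s
    proof -
      have "\<nu> * \<delta> \<le> \<nu> * (s - \<sigma>)" using that y nu by auto
      also have "\<dots> \<le> \<psi> s" using cr that y del unfolding crosses_def by auto
      finally show ?thesis .
    qed
    then show "cmod (integral {y..b} (\<lambda>x. cis (\<phi> x))) \<le> 8 / (\<nu> * \<delta>)"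
      using y nu del d mono by (intro van_der_corput_first[where \<psi> = \<psi>]) auto
  qed (use ab del nu cis_integrable[OF d] in auto)
  also have "\<dots> = 18 / sqrt \<nu>" using nu by (simp add: nd) (simp add: \<delta>_def)
  finally show ?thesis .
qed

lemma cmod_integral_cis_uminus:
  "cmod (integral S (\<lambda>x. cis (- \<phi> x))) = cmod (integral S (\<lambda>x. cis (\<phi> x)))"
  by (simp add: Henstock_Kurzweil_Integration.integral_cnj[symmetric] flip: cis_cnj)

text \<open>The same balance one derivative higher: off the window the second-derivative bound costs
  18 / sqrt (\<nu> \<delta>) per side, which is 18 \<delta> for \<delta> = \<nu>^(-1/3), and 2 + 36
  = 38. To the left of \<sigma> the second derivative is negative, so there the phase is replaced by
  its negative.\<close>

lemma van_der_corput_third: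
  assumes ab: "a \<le> b" and lam: "\<nu> > 0"
    and d: "\<And>x. a \<le> x \<Longrightarrow> x \<le> b \<Longrightarrow> (\<phi> has_real_derivative \<psi> x) (at x)"
    and d2: "\<And>x. a \<le> x \<Longrightarrow> x \<le> b \<Longrightarrow> (\<psi> has_real_derivative \<kappa> x) (at x)"
    and cr: "crosses \<kappa> \<nu> \<sigma> {a..b}"
  shows "cmod (integral {a..b} (\<lambda>x. cis (\<phi> x))) \<le> 38 * \<nu> powr (-1/3)"
proof -
  define \<delta> where "\<delta> = \<nu> powr (-1/3)"
  have del: "\<delta> > 0" using lam by (simp add: \<delta>_def)
  have sq: "1 / sqrt (\<nu> * \<delta>) = \<delta>"
  proof -
    have "\<nu> * \<delta> = \<nu> powr (2/3)"
      using lam powr_add[of \<nu> 1 "-1/3"] by (simp add: \<delta>_def)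
    then have "sqrt (\<nu> * \<delta>) = \<nu> powr (1/3)"
      using lam by (simp add: powr_powr flip: powr_half_sqrt)
    then show ?thesis by (simp add: \<delta>_def powr_minus_divide)
  qed
  have "cmod (integral {a..b} (\<lambda>x. cis (\<phi> x))) \<le> 2 * \<delta> + 2 * (18 / sqrt (\<nu> * \<delta>))"
  proof (rule cmod_integral_cis_split[where \<sigma> = \<sigma>])
    fix y assume y: "a \<le> y" "y \<le> b" "y \<le> \<sigma> - \<delta>"
    have ch: "\<nu> * \<delta> \<le> - \<kappa> s" if "a \<le> s" "s \<le> y" for s
    proof -
      have "\<kappa> s \<le> - (\<nu> * (\<sigma> - s))" using cr that y del unfolding crosses_def by auto
      also have "\<dots> \<le> - (\<nu> * \<delta>)" using that y lam by auto
      finally show ?thesis by simp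
    qed
    have "cmod (integral {a..y} (\<lambda>x. cis (- \<phi> x))) \<le> 18 / sqrt (\<nu> * \<delta>)"
      using y lam del d d2 ch
      by (intro van_der_corput_second[where \<psi> = "\<lambda>x. - \<psi> x" and \<kappa> = "\<lambda>x. - \<kappa> x"])
        (auto intro!: derivative_eq_intros)
    then show "cmod (integral {a..y} (\<lambda>x. cis (\<phi> x))) \<le> 18 / sqrt (\<nu> * \<delta>)"
      by (simp add: cmod_integral_cis_uminus)
  next
    fix y assume y: "a \<le> y" "y \<le> b" "\<sigma> + \<delta> \<le> y"
    have "\<nu> * \<delta> \<le> \<kappa> s" if "y \<le> s" "s \<le> b" for s
    proof -
      have "\<nu> * \<delta> \<le> \<nu> * (s - \<sigma>)" using that y lam by auto
      also have "\<dots> \<le> \<kappa> s" using cr that y del unfolding crosses_def by auto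
      finally show ?thesis .
    qed
    then show "cmod (integral {y..b} (\<lambda>x. cis (\<phi> x))) \<le> 18 / sqrt (\<nu> * \<delta>)"
      using y lam del d d2 by (intro van_der_corput_second[where \<psi> = \<psi> and \<kappa> = \<kappa>]) auto
  qed (use ab del lam cis_integrable[OF d] in auto)
  also have "\<dots> = 38 * \<delta>" using sq by simp
  finally show ?thesis by (simp add: \<delta>_def)
qed

section \<open>Decay of the transmission integrals\<close>

lemma DERIV_inverse_sqrt_one_minus_square:
  fixes x :: real
  assumes "\<bar>x\<bar> < 1"
  shows "((\<lambda>x. inverse (sqrt (1 - x^2))) has_real_derivative x / sqrt (1 - x^2) ^ 3) (at x)"
proof -
  have "1 - x^2 > 0" using assms by (simp add: abs_square_less_1)
  then show ?thesis
    by (auto intro!: derivative_eq_intros simp: field_simps power3_eq_cube power2_eq_square)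
qed

text \<open>Since m is nondecreasing, \<open>s * m s\<close> lies below the line through 0 and (z, z
  m(z)) before z and above it afterwards. Where z m(z) = 8 \<tau>, the second derivative is
  therefore at least 8 \<tau> \<bar>s - z\<bar> / z in absolute value, and z \<le> 1 removes the
  division; neither p nor q enters. The strict inequality y < c keeps all derivatives of the two
  arcsines finite.\<close>

lemma cis_phase_bound_lt:
  fixes p q :: nat and c \<tau> x y :: real
  assumes c: "0 < c" "c \<le> 1" and tau: "\<tau> \<noteq> 0" and xy: "0 \<le> x" "x \<le> y" "y < c"
  shows "cmod (integral {x..y} (\<lambda>s. cis (- 4 * \<tau> * s^2 + 2 * real p * arcsin s + 2 * real q * arcsin (s / c))))
           \<le> 38 * (8 * \<bar>\<tau>\<bar>) powr (-1/3)"
proof -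
  define \<phi> where "\<phi> s = - 4 * \<tau> * s^2 + 2 * real p * arcsin s + 2 * real q * arcsin (s / c)" for s
  define \<psi> where "\<psi> s = - 8 * \<tau> * s + 2 * real p * inverse (sqrt (1 - s^2)) + 2 * real q * (inverse (sqrt (1 - (s / c)^2)) / c)" for s
  define m where "m s = 2 * real p / sqrt (1 - s^2) ^ 3 + 2 * real q / (c^2 * (c * sqrt (1 - (s / c)^2) ^ 3))" for s
  define \<kappa> where "\<kappa> s = - 8 * \<tau> + s * m s" for s
  have rng: "\<bar>s\<bar> < 1" "\<bar>s / c\<bar> < 1" if "x \<le> s" "s \<le> y" for s
    using that xy c by auto
  have sq: "s^2 < 1" "(s / c)^2 < 1" if "x \<le> s" "s \<le> y" for s
    using rng[OF that] by (simp_all only: abs_square_less_1)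
  have d: "(\<phi> has_real_derivative \<psi> s) (at s)" if "x \<le> s" "s \<le> y" for s
  proof -
    have "c \<noteq> 0" "- 1 < s" "s < 1" "- 1 < s / c" "s / c < 1"
      using c rng[OF that] unfolding abs_less_iff by linarith+
    then show ?thesis
      unfolding \<phi>_def \<psi>_def by (auto intro!: derivative_eq_intros )
  qed
  have d2: "(\<psi> has_real_derivative \<kappa> s) (at s)" if s: "x \<le> s" "s \<le> y" for s
  proof -
    have e: "((\<lambda>s. inverse (sqrt (1 - (s / c)^2))) has_real_derivative ((s / c) / sqrt (1 - (s / c)^2) ^ 3) * (1 / c)) (at s)"
      by (rule DERIV_chain2[OF DERIV_inverse_sqrt_one_minus_square DERIV_cdivide[OF DERIV_ident]])
        (use rng[OF s] in auto)
    have "(\<psi> has_real_derivative (- 8 * \<tau> * 1 + 2 * real p * (s / sqrt (1 - s^2) ^ 3)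
        + 2 * real q * ((s / c) / sqrt (1 - (s / c)^2) ^ 3 * (1 / c) / c))) (at s)"
      unfolding \<psi>_def
      by (intro DERIV_add DERIV_cmult DERIV_cdivide DERIV_ident e DERIV_inverse_sqrt_one_minus_square rng s)
    moreover have "(s / c) / r * (1 / c) / c = s * (1 / (c^2 * (c * r)))" for r
      by (simp add: power2_eq_square)
    ultimately show ?thesis
      by (simp add: \<kappa>_def m_def power2_eq_square[of c] algebra_simps)
  qed
  have m_mono: "m s \<le> m t" if "x \<le> s" "s \<le> t" "t \<le> y" for s t
  proof -
    have le: "s^2 \<le> t^2" "(s / c)^2 \<le> (t / c)^2"
      using that xy c by (auto intro!: power_mono divide_right_mono)
    have pos: "sqrt (1 - t^2) > 0" "sqrt (1 - (t / c)^2) > 0" using sq[of t] that by auto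
    have "2 * real p / sqrt (1 - s^2) ^ 3 \<le> 2 * real p / sqrt (1 - t^2) ^ 3"
      using pos sq[of s] le that by (intro divide_left_mono power_mono mult_pos_pos zero_less_power) auto
    moreover have "2 * real q / (c^2 * (c * sqrt (1 - (s / c)^2) ^ 3)) \<le> 2 * real q / (c^2 * (c * sqrt (1 - (t / c)^2) ^ 3))"
      using pos sq[of s] le that c
      by (intro divide_left_mono mult_left_mono power_mono mult_pos_pos zero_less_power) auto
    ultimately show ?thesis unfolding m_def by linarith
  qed
  have m0: "m s \<ge> 0" if "x \<le> s" "s \<le> y" for s
    unfolding m_def using sq[OF that] c by (auto intro!: add_nonneg_nonneg divide_nonneg_nonneg mult_nonneg_nonneg)
  have contm: "continuous_on {x..y} (\<lambda>s. s * m s)"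
  proof -
    have n1: "\<forall>s\<in>{x..y}. sqrt (1 - s^2) ^ 3 \<noteq> 0" using sq by fastforce
    have n2: "\<forall>s\<in>{x..y}. c^2 * (c * sqrt (1 - (s / c)^2) ^ 3) \<noteq> 0" using sq c by fastforce
    show ?thesis
      unfolding m_def by (intro continuous_intros n1 n2) (use c in auto)
  qed
  obtain \<sigma> where "crosses \<kappa> (8 * \<bar>\<tau>\<bar>) \<sigma> {x..y}"
  proof (cases "\<tau> < 0")
    case True
    \<comment> \<open>For negative \<tau> both terms of \<kappa> are nonnegative, so \<kappa> is at
      least 8 \<bar>\<tau>\<bar>, and s \<le> 1 allows the crossing to be placed at 0.\<close>
    have "crosses \<kappa> (8 * \<bar>\<tau>\<bar>) 0 {x..y}"
      unfolding crosses_def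
    proof (intro ballI conjI impI)
      fix s assume s: "s \<in> {x..y}"
      have "8 * \<bar>\<tau>\<bar> * (s - 0) \<le> 8 * \<bar>\<tau>\<bar> * 1" using s xy c by (intro mult_left_mono) auto
      also have "\<dots> \<le> \<kappa> s" unfolding \<kappa>_def using True m0[of s] s xy by auto
      finally show "8 * \<bar>\<tau>\<bar> * (s - 0) \<le> \<kappa> s" .
    qed (use xy in auto)
    then show ?thesis using that by blast
  next
    case False
    then have t: "\<tau> > 0" using tau by simp
    \<comment> \<open>The alternatives \<open>z = y\<close> and \<open>z = x\<close> admit an
      endpoint as crossing when \<open>s * m s\<close> stays on one side of 8 \<tau>.\<close>
    have crI: "crosses \<kappa> (8 * \<bar>\<tau>\<bar>) z {x..y}"
      if z: "x \<le> z" "z \<le> y" "0 < z" "z = y \<or> 8 * \<tau> \<le> z * m z" "z = x \<or> z * m z \<le> 8 * \<tau>" for z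
      unfolding crosses_def
    proof (intro ballI conjI impI)
      have z1: "z \<le> 1" using z xy c by simp
      have zz: "8 * \<tau> * \<bar>s - z\<bar> \<le> 8 * \<tau> * \<bar>s - z\<bar> / z" for s
        using z1 z t mult_left_mono[of z 1 "\<bar>s - z\<bar>"] by (simp add: pos_le_divide_eq)
      {
        fix s assume s: "s \<in> {x..y}" "z < s"
        have "8 * \<tau> * s / z \<le> z * m z * s / z"
          using z s by (intro divide_right_mono mult_right_mono) auto
        also have "\<dots> = s * m z" using z by simp
        also have "\<dots> \<le> s * m s" using m_mono[of z s] s z by (intro mult_left_mono) auto
        finally have "8 * \<tau> * s / z - 8 * \<tau> \<le> \<kappa> s" by (simp add: \<kappa>_def)
        moreover have "8 * \<tau> * s / z - 8 * \<tau> = 8 * \<tau> * \<bar>s - z\<bar> / z" using s z by (simp add: field_simps)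
        ultimately show "8 * \<bar>\<tau>\<bar> * (s - z) \<le> \<kappa> s" using zz[of s] t s by auto
      }
      {
        fix s assume s: "s \<in> {x..y}" "s < z"
        have "s * m s \<le> s * m z" using m_mono[of s z] s z xy by (intro mult_left_mono) auto
        also have "\<dots> = z * m z * s / z" using z by simp
        also have "\<dots> \<le> 8 * \<tau> * s / z"
          using z s xy by (intro divide_right_mono mult_right_mono) auto
        finally have "\<kappa> s \<le> 8 * \<tau> * s / z - 8 * \<tau>" by (simp add: \<kappa>_def)
        moreover have "8 * \<tau> * s / z - 8 * \<tau> = - (8 * \<tau> * \<bar>s - z\<bar> / z)" using s z by (simp add: field_simps)
        ultimately show "\<kappa> s \<le> - (8 * \<bar>\<tau>\<bar> * (z - s))" using zz[of s] t s by auto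
      }
    qed
    show ?thesis
    \<comment> \<open>Here the interval is the single point 0, which offers no positive z to divide
      by.\<close>
    proof (cases "y = 0")
      case True
      then have "{x..y} = {0}" using xy by auto
      then have "crosses \<kappa> (8 * \<bar>\<tau>\<bar>) 0 {x..y}" by (simp add: crosses_def)
      then show ?thesis using that by blast
    next
      case False
      then have y: "y > 0" using xy by simp
      consider "8 * \<tau> \<le> x * m x" | "y * m y \<le> 8 * \<tau>" | "x * m x \<le> 8 * \<tau>" "8 * \<tau> \<le> y * m y" by linarith
      then show ?thesis
      proof cases
        case 1
        moreover from 1 have "x > 0" using xy t by (cases "x = 0") auto
        ultimately show ?thesis using crI[of x] that xy by blast
      next
        case 2
        then show ?thesis using crI[of y] that xy y by blast
      next
        case 3
        obtain z where z: "x \<le> z" "z \<le> y" "z * m z = 8 * \<tau>"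
          using IVT'[OF 3 xy(2) contm] by blast
        then have "z > 0" using xy t by (cases "z = 0") auto
        then show ?thesis using crI[of z] that z by simp
      qed
    qed
  qed
  then have "cmod (integral {x..y} (\<lambda>s. cis (\<phi> s))) \<le> 38 * (8 * \<bar>\<tau>\<bar>) powr (-1/3)"
    using d d2 tau xy by (intro van_der_corput_third) auto
  then show ?thesis by (simp add: \<phi>_def)
qed

text \<open>The bound reaches the band edge s = c, where the derivative of arcsin (s / c) is
  infinite, by cutting off a piece of arbitrarily small length e and estimating it by e.\<close>

lemma cis_phase_bound:
  fixes p q :: nat and c \<tau> :: real
  assumes c: "0 < c" "c \<le> 1" and tau: "\<tau> \<noteq> 0"
  shows "osc_bounded (\<lambda>s. cis (- 4 * \<tau> * s^2 + 2 * real p * arcsin s + 2 * real q * arcsin (s / c))) 0 c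
           (38 * (8 * \<bar>\<tau>\<bar>) powr (-1/3))"
  (is "osc_bounded ?f 0 c ?B")
proof -
  have cont: "continuous_on {0..c} ?f"
  proof -
    have "- 1 \<le> s / c \<and> s / c \<le> 1" if "s \<in> {0..c}" for s
      using that c by (auto intro: order_trans[of _ 0])
    then show ?thesis using c by (intro continuous_intros) auto
  qed
  have int: "?f integrable_on {u..v}" if "0 \<le> u" "v \<le> c" for u v
    by (rule integrable_continuous_interval[OF continuous_on_subset[OF cont]]) (use that in auto)
  have "cmod (integral {x..y} ?f) \<le> ?B" if xy: "0 \<le> x" "x \<le> y" "y \<le> c" for x y
  proof (cases "x = y")
    case False
    show ?thesis
    proof (rule field_le_epsilon)
      fix e :: real assume e: "e > 0"
      define z where "z = max x (y - e)"
      have z: "x \<le> z" "z < y" "y - z \<le> e" using xy False e by (auto simp: z_def)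
      have "integral {x..y} ?f = integral {x..z} ?f + integral {z..y} ?f"
        by (rule Henstock_Kurzweil_Integration.integral_combine[symmetric]) (use z int xy in auto)
      moreover have "cmod (integral {x..z} ?f) \<le> ?B"
        using cis_phase_bound_lt[OF c tau, of x z p q] xy z by auto
      moreover have "cmod (integral {z..y} ?f) \<le> y - z"
        using cmod_integral_cis_le[of z y] z by simp
      ultimately show "cmod (integral {x..y} ?f) \<le> ?B + e"
        using norm_triangle_ineq[of "integral {x..z} ?f" "integral {z..y} ?f"] z by (simp del: integral_combine)
    qed
  qed auto
  then show ?thesis unfolding osc_bounded_def using int[of 0 c] by auto
qed

section \<open>Boundary values of the two roots and the spectral density\<close>

definition rho1 :: "real \<Rightarrow> complex" where
  "rho1 s = Complex (sqrt (1 - s^2)) s"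

text \<open>For \<open>s > c\<close> this is the boundary value from the upper half plane, which has modulus at most \<open>c\<close>.\<close>

definition rho2 :: "real \<Rightarrow> real \<Rightarrow> complex" where
  "rho2 c s = (if s \<le> c then Complex (sqrt (c^2 - s^2)) s else Complex 0 (s - sqrt (s^2 - c^2)))"

definition spectral :: "real \<Rightarrow> nat \<Rightarrow> nat \<Rightarrow> real \<Rightarrow> complex" where
  "spectral c p q s = rho1 s ^ (2 * p) * (rho2 c s / of_real c) ^ (2 * q) / (rho1 s + rho2 c s)"

lemma cis_arcsin: "\<bar>s\<bar> \<le> 1 \<Longrightarrow> cis (arcsin s) = Complex (sqrt (1 - s^2)) s"
  by (simp add: complex_eq_iff cos_arcsin)

lemma rho1_eq_cis: "\<bar>s\<bar> \<le> 1 \<Longrightarrow> rho1 s = cis (arcsin s)"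
  by (simp add: rho1_def cis_arcsin)

lemma rho2_eq_cis:
  assumes "0 < c" "0 \<le> s" "s \<le> c"
  shows "rho2 c s = of_real c * cis (arcsin (s / c))"
proof -
  have "\<bar>s / c\<bar> \<le> 1" using assms by simp
  moreover have "c * sqrt (1 - (s / c)^2) = sqrt (c^2 - s^2)"
  proof -
    have "c^2 - s^2 = c^2 * (1 - (s / c)^2)" using assms by (simp add: power_divide algebra_simps)
    then show ?thesis using assms by (simp add: real_sqrt_mult)
  qed
  ultimately show ?thesis
    using assms by (simp add: rho2_def cis_arcsin complex_eq_iff)
qed

lemma density_denominator_lower:
  fixes c s :: real
  assumes c: "0 < c" "c \<le> 1" and s: "0 \<le> s" "s \<le> c"
  shows "1 \<le> (sqrt (1 - s^2) + sqrt (c^2 - s^2))^2 + (2 * s)^2"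
proof -
  have "s^2 \<le> c^2" "c^2 \<le> 1" using c s by (auto simp: power_le_one)
  then have "(sqrt (1 - s^2) + sqrt (c^2 - s^2))^2 + (2 * s)^2 = 1 + c^2 + 2 * s^2 + 2 * (sqrt (1 - s^2) * sqrt (c^2 - s^2))"
    by (simp add: power2_sum algebra_simps)
  moreover have "sqrt (1 - s^2) * sqrt (c^2 - s^2) \<ge> 0"
    using \<open>s^2 \<le> c^2\<close> \<open>c^2 \<le> 1\<close> by simp
  ultimately show ?thesis by (smt (verit) zero_le_power2)
qed

text \<open>The squared modulus of rho1 + rho2 is 1 + c^2 + 2 (s^2 + sqrt ((1 - s^2) (c^2 - s^2))).
  Lowering t^2 by h raises both factors under the root by h; by the inequality of arithmetic and
  geometric means the root gains at least h, which makes up for the loss in the square.\<close>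

lemma density_denominator_antimono:
  fixes c s t :: real
  assumes c: "0 < c" "c \<le> 1" and s: "0 \<le> s" "s \<le> t" "t \<le> c"
  shows "(sqrt (1 - t^2) + sqrt (c^2 - t^2))^2 + (2 * t)^2 \<le> (sqrt (1 - s^2) + sqrt (c^2 - s^2))^2 + (2 * s)^2"
proof -
  have N: "(sqrt (1 - s^2) + sqrt (c^2 - s^2))^2 + (2 * s)^2 = 1 + c^2 + 2 * (s^2 + sqrt ((1 - s^2) * (c^2 - s^2)))"
    if "0 \<le> s" "s \<le> c" for s
  proof -
    have "s^2 \<le> c^2" "c^2 \<le> 1" using c that by (auto simp: power_le_one)
    then show ?thesis
      by (simp add: power2_sum algebra_simps flip: real_sqrt_mult)
  qed
  define P Q h where "P = 1 - t^2" and "Q = c^2 - t^2" and "h = t^2 - s^2"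
  have "t^2 \<le> c^2" "c^2 \<le> 1" "s^2 \<le> t^2" using c s by (auto simp: power_le_one)
  then have PQ: "P \<ge> 0" "Q \<ge> 0" "h \<ge> 0" by (auto simp: P_def Q_def h_def)
  have "sqrt (P * Q) + h \<le> sqrt ((P + h) * (Q + h))"
  proof (rule real_le_rsqrt)
    have "2 * sqrt (P * Q) \<le> P + Q" using arith_geo_mean_sqrt[of P Q] PQ by simp
    then have "h * (2 * sqrt (P * Q)) \<le> h * (P + Q)" using PQ by (intro mult_left_mono)
    then show "(sqrt (P * Q) + h)^2 \<le> (P + h) * (Q + h)"
      using PQ by (simp add: power2_sum power2_eq_square[of h] algebra_simps)
  qed
  then have "t^2 + sqrt ((1 - t^2) * (c^2 - t^2)) \<le> s^2 + sqrt ((1 - s^2) * (c^2 - s^2))"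
    by (simp add: P_def Q_def h_def)
  then show ?thesis using N[of s] N[of t] s by simp
qed

text \<open>With r = sqrt (1 - (c / s)^2) one has sqrt (s^2 - c^2) = s r and c^2 = s^2 (1 - r) (1 +
  r). The terms in s^2 then combine so that s enters only through r, which increases with s: the
  monotonicity becomes visible, and r \<le> 1 gives the lower bound 1 + c^2.\<close>

lemma density_denominator_tail:
  fixes c s :: real
  assumes c: "0 < c" and s: "c \<le> s" "s \<le> 1"
  shows "(sqrt (1 - s^2))^2 + (2 * s - sqrt (s^2 - c^2))^2 = 1 - c^2 + 4 * (c^2 / (1 + sqrt (1 - (c / s)^2)))"
    and "1 \<le> (sqrt (1 - s^2))^2 + (2 * s - sqrt (s^2 - c^2))^2"
proof -
  have sq: "c^2 \<le> s^2" "s^2 \<le> 1" "s > 0" using c s by (auto simp: power_le_one)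
  define r where "r = sqrt (1 - (c / s)^2)"
  have cs: "(c / s)^2 \<le> 1" using sq by (simp add: power_divide)
  then have r: "0 \<le> r" "r \<le> 1" "r^2 = 1 - (c / s)^2" by (auto simp: r_def)
  have "s^2 - c^2 = s^2 * (1 - (c / s)^2)" using sq by (simp add: power_divide algebra_simps)
  then have "sqrt (s^2 - c^2) = s * r" using sq by (simp add: r_def real_sqrt_mult)
  moreover have c2: "c^2 = s^2 * (1 - r) * (1 + r)"
  proof -
    have "s^2 * (1 - r) * (1 + r) = s^2 * (1 - r^2)" by (simp add: power2_eq_square algebra_simps)
    also have "\<dots> = c^2" unfolding r(3) using sq by (simp add: power_divide)
    finally show ?thesis by simp
  qed
  moreover have "c^2 / (1 + r) = s^2 * (1 - r)" unfolding c2 using r by simp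
  moreover have "1 - s^2 + (2 * s - s * r)^2 = 1 - s^2 * (1 - r) * (1 + r) + 4 * (s^2 * (1 - r))"
    by (simp add: power2_eq_square algebra_simps)
  ultimately show *: "(sqrt (1 - s^2))^2 + (2 * s - sqrt (s^2 - c^2))^2 = 1 - c^2 + 4 * (c^2 / (1 + sqrt (1 - (c / s)^2)))"
    unfolding r_def[symmetric] using sq by simp
  have "c^2 / 2 \<le> c^2 / (1 + r)" using r by (intro divide_left_mono) auto
  then show "1 \<le> (sqrt (1 - s^2))^2 + (2 * s - sqrt (s^2 - c^2))^2"
    unfolding * r_def[symmetric] by (smt (verit) zero_le_power2 field_sum_of_halves)
qed

lemma one_le_cmod_density_denominator:
  assumes c: "0 < c" "c \<le> 1" and s: "0 \<le> s" "s \<le> 1"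
  shows "1 \<le> (cmod (rho1 s + rho2 c s))^2"
proof (cases "s \<le> c")
  case True
  then show ?thesis
    using density_denominator_lower[OF c s(1) True]
    by (simp add: cmod_power2 rho1_def rho2_def)
next
  case False
  then show ?thesis
    using density_denominator_tail(2)[OF c(1) _ s(2)]
    by (simp add: cmod_power2 rho1_def rho2_def)
qed

lemma density_denominator_nonzero:
  assumes "0 < c" "c \<le> 1" "0 \<le> s" "s \<le> 1"
  shows "rho1 s + rho2 c s \<noteq> 0"
  using one_le_cmod_density_denominator[OF assms] by auto

lemma cmod_rho1: "0 \<le> s \<Longrightarrow> s \<le> 1 \<Longrightarrow> cmod (rho1 s) = 1"
  by (simp add: rho1_eq_cis)

lemma rho2_tail_bounds:
  fixes c s :: real
  assumes "0 < c" "c \<le> s"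
  shows "0 \<le> (s - sqrt (s^2 - c^2)) / c" "(s - sqrt (s^2 - c^2)) / c \<le> 1"
proof -
  have "sqrt (s^2 - c^2) \<le> s" using assms by (intro real_le_lsqrt) auto
  then show "0 \<le> (s - sqrt (s^2 - c^2)) / c" using assms by simp
  have "(s - c)^2 \<le> s^2 - c^2"
    using assms mult_nonneg_nonneg[of c "s - c"] by (simp add: power2_eq_square algebra_simps)
  then have "s - c \<le> sqrt (s^2 - c^2)" by (intro real_le_rsqrt)
  then show "(s - sqrt (s^2 - c^2)) / c \<le> 1" using assms by simp
qed

lemma cmod_rho2_le:
  assumes "0 < c" "0 \<le> s"
  shows "cmod (rho2 c s / of_real c) \<le> 1"
proof (cases "s \<le> c")
  case True
  then show ?thesis using assms by (simp add: rho2_eq_cis norm_mult)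
next
  case False
  then have "cmod (rho2 c s) = \<bar>s - sqrt (s^2 - c^2)\<bar>"
    by (simp add: rho2_def cmod_def)
  then have "cmod (rho2 c s / of_real c) = \<bar>(s - sqrt (s^2 - c^2)) / c\<bar>"
    using assms by (simp add: norm_divide)
  with rho2_tail_bounds[of c s] assms False show ?thesis by linarith
qed

lemma cmod_spectral_le:
  assumes c: "0 < c" "c \<le> 1" and s: "0 \<le> s" "s \<le> 1"
  shows "cmod (spectral c p q s) \<le> 1"
proof -
  have "1 \<le> cmod (rho1 s + rho2 c s)"
    using one_le_cmod_density_denominator[OF assms] by (simp add: power2_nonneg_ge_1_iff)
  moreover have "cmod (rho1 s ^ (2 * p) * (rho2 c s / of_real c) ^ (2 * q)) \<le> 1"
    using cmod_rho1[OF s] cmod_rho2_le[OF c(1) s(1)]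
    by (simp add: norm_mult norm_power power_le_one flip: norm_divide)
  ultimately show ?thesis
    unfolding spectral_def norm_divide by (simp add: divide_le_eq)
qed

lemma one_div_Complex:
  "1 / Complex a b = of_real (1 / (a^2 + b^2)) * (of_real a + (- \<i>) * of_real b)"
proof -
  have "1 / Complex a b = inverse (Complex a b)" by (simp only: inverse_eq_divide)
  then show ?thesis by (simp add: complex_inverse complex_eq_iff)
qed

text \<open>The reciprocal of the denominator is split so that the oscillation is multiplied only by
  real factors that are each monotone on [0, c]: a decreasing sum of roots, the increasing 2 s, and
  the increasing reciprocal of the squared modulus.\<close>

lemma spectral_propagating:
  assumes c: "0 < c" "c \<le> 1" and s: "0 \<le> s" "s \<le> c"
  shows "spectral c p q s =
    of_real (1 / ((sqrt (1 - s^2) + sqrt (c^2 - s^2))^2 + (2 * s)^2)) *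
      (of_real (sqrt (1 - s^2) + sqrt (c^2 - s^2)) * cis (2 * real p * arcsin s + 2 * real q * arcsin (s / c))
        + (- \<i>) * (of_real (2 * s) * cis (2 * real p * arcsin s + 2 * real q * arcsin (s / c))))"
proof -
  define a where "a = sqrt (1 - s^2) + sqrt (c^2 - s^2)"
  have "rho1 s + rho2 c s = Complex a (2 * s)"
    using s by (simp add: rho1_def rho2_def a_def complex_eq_iff)
  moreover have "rho1 s ^ (2 * p) * (rho2 c s / of_real c) ^ (2 * q) = cis (2 * real p * arcsin s + 2 * real q * arcsin (s / c))"
    using c s by (simp add: rho1_eq_cis rho2_eq_cis Complex.DeMoivre cis_mult)
  moreover have "1 / Complex a (2 * s) = of_real (1 / (a^2 + (2 * s)^2)) * (of_real a + (- \<i>) * of_real (2 * s))"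
    by (rule one_div_Complex)
  ultimately have "spectral c p q s = cis (2 * real p * arcsin s + 2 * real q * arcsin (s / c)) *
      (of_real (1 / (a^2 + (2 * s)^2)) * (of_real a + (- \<i>) * of_real (2 * s)))"
    unfolding spectral_def by (metis divide_inverse mult_1 inverse_eq_divide)
  moreover have "K * (N * (A + B * C)) = N * (A * K + B * (C * K))" for A B C K N :: complex
    by (simp add: algebra_simps)
  ultimately show ?thesis unfolding a_def[symmetric] by metis
qed

text \<open>Beyond s = c the second root is purely imaginary, so its even powers are a sign times
  powers of a decreasing function with values in [0, 1], and only p stays in the phase. The
  imaginary part 2 s - sqrt (s^2 - c^2) of the denominator is not monotone in general and is
  therefore split into its two monotone terms.\<close>

lemma spectral_evanescent:
  assumes c: "0 < c" "c \<le> 1" and s: "c \<le> s" "s \<le> 1"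
  shows "spectral c p q s =
    of_real (1 / ((sqrt (1 - s^2))^2 + (2 * s - sqrt (s^2 - c^2))^2)) * (- 1) ^ q *
      (of_real (sqrt (1 - s^2)) * (of_real (((s - sqrt (s^2 - c^2)) / c) ^ (2 * q)) * cis (2 * real p * arcsin s))
        + ((- \<i>) * (of_real (2 * s) * (of_real (((s - sqrt (s^2 - c^2)) / c) ^ (2 * q)) * cis (2 * real p * arcsin s)))
        + \<i> * (of_real (sqrt (s^2 - c^2)) * (of_real (((s - sqrt (s^2 - c^2)) / c) ^ (2 * q)) * cis (2 * real p * arcsin s)))))"
proof -
  define a where "a = sqrt (1 - s^2)"
  define b where "b = sqrt (s^2 - c^2)"
  have r2: "rho2 c s = \<i> * of_real (s - b)"
    using s by (auto simp: rho2_def complex_eq_iff b_def)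
  then have X: "rho1 s + rho2 c s = Complex a (2 * s - b)"
    by (simp add: rho1_def a_def complex_eq_iff)
  have "(rho2 c s / of_real c) ^ (2 * q) = (- 1) ^ q * of_real (((s - b) / c) ^ (2 * q))"
  proof -
    have "(rho2 c s / of_real c)^2 = (- 1) * of_real (((s - b) / c)^2)"
      unfolding r2 by (simp add: power_mult_distrib power_divide)
    then show ?thesis by (simp only: power_mult power_mult_distrib of_real_power)
  qed
  moreover have "rho1 s ^ (2 * p) = cis (2 * real p * arcsin s)"
    using c s by (simp add: rho1_eq_cis Complex.DeMoivre)
  moreover have "1 / Complex a (2 * s - b) = of_real (1 / (a^2 + (2 * s - b)^2)) * (of_real a + ((- \<i>) * of_real (2 * s) + \<i> * of_real b))"
    unfolding one_div_Complex by (simp add: algebra_simps)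
  ultimately have "spectral c p q s = cis (2 * real p * arcsin s) * ((- 1) ^ q * of_real (((s - b) / c) ^ (2 * q))) *
      (of_real (1 / (a^2 + (2 * s - b)^2)) * (of_real a + ((- \<i>) * of_real (2 * s) + \<i> * of_real b)))"
    unfolding spectral_def X by (metis divide_inverse mult_1 inverse_eq_divide)
  moreover have "K * (S * E) * (N * (A + (B * C + D * F))) = N * S * (A * (E * K) + (B * (C * (E * K)) + D * (F * (E * K))))"
    for A B C D E F K N S :: complex
    by (simp add: algebra_simps)
  ultimately show ?thesis unfolding a_def[symmetric] b_def[symmetric] by metis
qed

section \<open>Inserting the monotone amplitude factors\<close>

lemma osc_bounded_cong:
  assumes "\<And>x. a \<le> x \<Longrightarrow> x \<le> b \<Longrightarrow> f x = g x" and "osc_bounded f a b M"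
  shows "osc_bounded g a b M"
proof -
  have "integral {x..y} f = integral {x..y} g" if "a \<le> x" "y \<le> b" for x y
    by (rule integral_cong) (use assms(1) that in auto)
  moreover have "g integrable_on {a..b}"
    using assms(2) integrable_cong[of "{a..b}" f g] assms(1) by (auto simp: osc_bounded_def)
  ultimately show ?thesis using assms(2) unfolding osc_bounded_def by auto
qed

text \<open>A monotone factor bounded by K costs 4 K. The two amplitudes are bounded by 2 and the
  reciprocal by 1, which gives 4 (8 + 8) = 64, and 64 * 38 = 2432.\<close>

lemma osc_bounded_propagating:
  fixes p q :: nat and c \<tau> :: real
  assumes c: "0 < c" "c \<le> 1" and tau: "\<tau> \<noteq> 0"
  shows "osc_bounded (\<lambda>s. cis (- 4 * \<tau> * s^2) * spectral c p q s) 0 c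
    (2432 * (8 * \<bar>\<tau>\<bar>) powr (-1/3))"
proof -
  let ?B = "38 * (8 * \<bar>\<tau>\<bar>) powr (-1/3)"
  let ?f = "\<lambda>s. cis (- 4 * \<tau> * s^2 + 2 * real p * arcsin s + 2 * real q * arcsin (s / c))"
  let ?N = "\<lambda>s. (sqrt (1 - s^2) + sqrt (c^2 - s^2))^2 + (2 * s)^2"
  have c0: "0 \<le> c" using c by simp
  have f: "osc_bounded ?f 0 c ?B" by (rule cis_phase_bound[OF c tau])
  have P: "osc_bounded (\<lambda>s. of_real (sqrt (1 - s^2) + sqrt (c^2 - s^2)) * ?f s) 0 c (4 * 2 * ?B)"
  proof (rule osc_bounded_mult_antimono[OF f c0])
    fix x y :: real assume xy: "0 \<le> x" "x \<le> y" "y \<le> c"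
    then have "x^2 \<le> y^2" by (intro power_mono)
    then show "sqrt (1 - y^2) + sqrt (c^2 - y^2) \<le> sqrt (1 - x^2) + sqrt (c^2 - x^2)"
      by (intro add_mono) auto
  next
    fix x :: real assume x: "0 \<le> x" "x \<le> c"
    have "c^2 \<le> 1" "x^2 \<le> c^2" using c x by (auto simp: power_le_one intro: power_mono)
    then have "sqrt (1 - x^2) \<le> 1" "sqrt (c^2 - x^2) \<le> 1" "0 \<le> sqrt (1 - x^2)" "0 \<le> sqrt (c^2 - x^2)"
      using zero_le_power2[of x] unfolding real_sqrt_le_1_iff real_sqrt_ge_0_iff by linarith+
    then show "\<bar>sqrt (1 - x^2) + sqrt (c^2 - x^2)\<bar> \<le> 2" by linarith
  qed
  have Q: "osc_bounded (\<lambda>s. of_real (2 * s) * ?f s) 0 c (4 * 2 * ?B)"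
    by (rule osc_bounded_mult_mono[OF f c0]) (use c in auto)
  have PQ: "osc_bounded (\<lambda>s. of_real (sqrt (1 - s^2) + sqrt (c^2 - s^2)) * ?f s + (- \<i>) * (of_real (2 * s) * ?f s)) 0 c
      (4 * 2 * ?B + cmod (- \<i>) * (4 * 2 * ?B))"
    by (intro osc_bounded_add P osc_bounded_cmult Q)
  have "osc_bounded (\<lambda>s. of_real (1 / ?N s) *
      (of_real (sqrt (1 - s^2) + sqrt (c^2 - s^2)) * ?f s + (- \<i>) * (of_real (2 * s) * ?f s))) 0 c
      (4 * 1 * (4 * 2 * ?B + cmod (- \<i>) * (4 * 2 * ?B)))"
  proof (rule osc_bounded_mult_mono[OF PQ c0])
    fix x y :: real assume xy: "0 \<le> x" "x \<le> y" "y \<le> c"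
    have "1 \<le> ?N y" using density_denominator_lower[OF c, of y] xy by simp
    moreover have "?N y \<le> ?N x" by (rule density_denominator_antimono[OF c xy])
    ultimately show "1 / ?N x \<le> 1 / ?N y" by (intro divide_left_mono mult_pos_pos) linarith+
  next
    fix x :: real assume x: "0 \<le> x" "x \<le> c"
    have "1 \<le> ?N x" using density_denominator_lower[OF c x] .
    then show "\<bar>1 / ?N x\<bar> \<le> 1" by (simp add: abs_le_iff divide_le_eq)
  qed
  then have "osc_bounded (\<lambda>s. cis (- 4 * \<tau> * s^2) * spectral c p q s) 0 c
    (4 * 1 * (4 * 2 * ?B + cmod (- \<i>) * (4 * 2 * ?B)))"
  proof (rule osc_bounded_cong[rotated])
    fix s :: real assume s: "0 \<le> s" "s \<le> c"
    have "?f s = cis (- 4 * \<tau> * s^2) * cis (2 * real p * arcsin s + 2 * real q * arcsin (s / c))"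
      by (simp add: cis_mult algebra_simps)
    then show "of_real (1 / ?N s) *
      (of_real (sqrt (1 - s^2) + sqrt (c^2 - s^2)) * ?f s + (- \<i>) * (of_real (2 * s) * ?f s)) =
       cis (- 4 * \<tau> * s^2) * spectral c p q s"
      unfolding spectral_propagating[OF c s] by (simp only: distrib_left mult_ac)
  qed
  then show ?thesis by simp
qed

text \<open>The decaying power costs 4, the three amplitudes on top of it 4, 8 and 4, and the
  reciprocal 4 again: 4 (4 + 8 + 4) 4 = 256, and 256 * 38 = 9728.\<close>

lemma osc_bounded_evanescent:
  fixes p q :: nat and c \<tau> :: real
  assumes c: "0 < c" "c \<le> 1" and tau: "\<tau> \<noteq> 0"
  shows "osc_bounded (\<lambda>s. cis (- 4 * \<tau> * s^2) * spectral c p q s) c 1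
    (9728 * (8 * \<bar>\<tau>\<bar>) powr (-1/3))"
proof -
  let ?B = "38 * (8 * \<bar>\<tau>\<bar>) powr (-1/3)"
  let ?f = "\<lambda>s. cis (- 4 * \<tau> * s^2 + 2 * real p * arcsin s)"
  let ?N = "\<lambda>s. (sqrt (1 - s^2))^2 + (2 * s - sqrt (s^2 - c^2))^2"
  let ?e = "\<lambda>s. ((s - sqrt (s^2 - c^2)) / c) ^ (2 * q)"
  have f: "osc_bounded ?f c 1 ?B"
  proof -
    \<comment> \<open>With q = 0 the phase is free of c, so the phase bound is taken with 1 in its
      place and then restricted to [c, 1].\<close>
    have *: "osc_bounded ?f 0 1 ?B"
      using cis_phase_bound[of 1 \<tau> p 0] tau by simp
    then have "?f integrable_on {c..1}"
      unfolding osc_bounded_def using c by (auto intro: integrable_subinterval_real)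
    with * show ?thesis unfolding osc_bounded_def using c by simp
  qed
  have anti: "y - sqrt (y^2 - c^2) \<le> x - sqrt (x^2 - c^2)" if "c \<le> x" "x \<le> y" for x y
  proof -
    have "x^2 \<le> y^2" "c^2 \<le> x^2" using that c by (auto intro: power_mono)
    define r where "r = sqrt (x^2 - c^2)"
    have r: "0 \<le> r" "r^2 = x^2 - c^2" "r \<le> x"
      using \<open>c^2 \<le> x^2\<close> that c by (auto simp: r_def intro: real_le_lsqrt)
    have "2 * (y - x) * r \<le> 2 * (y - x) * x" using r that by (intro mult_left_mono) auto
    then have "(y - x + r)^2 \<le> y^2 - c^2" using r(2) by (simp add: power2_eq_square algebra_simps)
    then have "y - x + r \<le> sqrt (y^2 - c^2)" by (rule real_le_rsqrt)
    then show ?thesis by (simp add: r_def)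
  qed
  have e: "osc_bounded (\<lambda>s. of_real (?e s) * ?f s) c 1 (4 * 1 * ?B)"
  proof (rule osc_bounded_mult_antimono[OF f c(2)])
    fix x y :: real assume xy: "c \<le> x" "x \<le> y" "y \<le> 1"
    show "?e y \<le> ?e x"
      using anti[OF xy(1,2)] rho2_tail_bounds[of c y] xy c by (intro power_mono divide_right_mono) auto
  next
    fix x :: real assume "c \<le> x" "x \<le> 1"
    then show "\<bar>?e x\<bar> \<le> 1" using rho2_tail_bounds[of c x] c by (simp only: abs_of_nonneg zero_le_power power_le_one)
  qed
  have P: "osc_bounded (\<lambda>s. of_real (sqrt (1 - s^2)) * (of_real (?e s) * ?f s)) c 1 (4 * 1 * (4 * 1 * ?B))"
  proof (rule osc_bounded_mult_antimono[OF e c(2)])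
    fix x y :: real assume "c \<le> x" "x \<le> y" "y \<le> 1"
    then show "sqrt (1 - y^2) \<le> sqrt (1 - x^2)" using c by (auto intro: power_mono)
  next
    fix x :: real assume "c \<le> x" "x \<le> 1"
    then show "\<bar>sqrt (1 - x^2)\<bar> \<le> 1" using c by (simp add: power_le_one)
  qed
  have Q: "osc_bounded (\<lambda>s. of_real (2 * s) * (of_real (?e s) * ?f s)) c 1 (4 * 2 * (4 * 1 * ?B))"
    by (rule osc_bounded_mult_mono[OF e c(2)]) (use c in auto)
  have R: "osc_bounded (\<lambda>s. of_real (sqrt (s^2 - c^2)) * (of_real (?e s) * ?f s)) c 1 (4 * 1 * (4 * 1 * ?B))"
  proof (rule osc_bounded_mult_mono[OF e c(2)])
    fix x y :: real assume "c \<le> x" "x \<le> y" "y \<le> 1"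
    then show "sqrt (x^2 - c^2) \<le> sqrt (y^2 - c^2)" using c by (auto intro: power_mono)
  next
    fix x :: real assume x: "c \<le> x" "x \<le> 1"
    have "c^2 \<le> x^2" "x^2 \<le> 1" using x c by (auto simp: power_le_one intro: power_mono)
    moreover have "0 \<le> c^2" by simp
    ultimately have "0 \<le> sqrt (x^2 - c^2)" "sqrt (x^2 - c^2) \<le> 1"
      unfolding real_sqrt_le_1_iff real_sqrt_ge_0_iff by linarith+
    then show "\<bar>sqrt (x^2 - c^2)\<bar> \<le> 1" by simp
  qed
  let ?S = "\<lambda>s. of_real (sqrt (1 - s^2)) * (of_real (?e s) * ?f s)
      + ((- \<i>) * (of_real (2 * s) * (of_real (?e s) * ?f s)) + \<i> * (of_real (sqrt (s^2 - c^2)) * (of_real (?e s) * ?f s)))"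
  let ?K = "4 * 1 * (4 * 1 * ?B) + (cmod (- \<i>) * (4 * 2 * (4 * 1 * ?B)) + cmod \<i> * (4 * 1 * (4 * 1 * ?B)))"
  have S: "osc_bounded ?S c 1
      ?K"
    by (intro osc_bounded_add P osc_bounded_cmult Q R)
  have "osc_bounded (\<lambda>s. (- 1) ^ q * (of_real (1 / ?N s) * ?S s)) c 1 (cmod ((- 1) ^ q) * (4 * 1 *
      ?K))"
  proof (rule osc_bounded_cmult, rule osc_bounded_mult_mono[OF S c(2)])
    fix x y :: real assume xy: "c \<le> x" "x \<le> y" "y \<le> 1"
    have "1 \<le> ?N y" using density_denominator_tail(2)[OF c(1), of y] xy by simp
    moreover have "?N y \<le> ?N x"
    proof -
      have r: "(c / y)^2 \<le> (c / x)^2" "(c / x)^2 \<le> 1" "(c / y)^2 \<le> 1"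
        using xy c by (auto intro!: power_mono divide_left_mono simp: power_le_one)
      then have "sqrt (1 - (c / x)^2) \<le> sqrt (1 - (c / y)^2)" "0 \<le> sqrt (1 - (c / x)^2)" by auto
      then have "c^2 / (1 + sqrt (1 - (c / y)^2)) \<le> c^2 / (1 + sqrt (1 - (c / x)^2))"
        by (intro divide_left_mono mult_pos_pos zero_le_power2) linarith+
      then show ?thesis
        using density_denominator_tail(1)[OF c(1), of x] density_denominator_tail(1)[OF c(1), of y] xy by auto
    qed
    ultimately show "1 / ?N x \<le> 1 / ?N y" by (intro divide_left_mono mult_pos_pos) linarith+
  next
    fix x :: real assume x: "c \<le> x" "x \<le> 1"
    have "1 \<le> ?N x" using density_denominator_tail(2)[OF c(1) x] .
    then have "0 < ?N x" by linarith
    then show "\<bar>1 / ?N x\<bar> \<le> 1" using \<open>1 \<le> ?N x\<close> by (simp only: abs_of_pos zero_less_divide_1_iff divide_le_eq_1_pos)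
  qed
  then have "osc_bounded (\<lambda>s. cis (- 4 * \<tau> * s^2) * spectral c p q s) c 1 (cmod ((- 1) ^ q) * (4 * 1 *
      ?K))"
  proof (rule osc_bounded_cong[rotated])
    fix s :: real assume s: "c \<le> s" "s \<le> 1"
    have "?f s = cis (- 4 * \<tau> * s^2) * cis (2 * real p * arcsin s)"
      by (simp add: cis_mult)
    then show "(- 1) ^ q * (of_real (1 / ?N s) * ?S s) = cis (- 4 * \<tau> * s^2) * spectral c p q s"
      unfolding spectral_evanescent[OF c s] by (simp only: distrib_left mult_ac)
  qed
  then show ?thesis by (simp add: norm_power)
qed

definition transmission :: "real \<Rightarrow> nat \<Rightarrow> nat \<Rightarrow> real \<Rightarrow> complex" where
  "transmission c p q \<tau> = integral {0..1}
     (\<lambda>s. cis (- 4 * \<tau> * s^2) * of_real (4 / pi * Re (spectral c p q s)))"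

lemma continuous_on_rho1: "continuous_on {0..1} rho1"
proof -
  have "continuous_on {0..1} (\<lambda>s. of_real (sqrt (1 - s^2)) + \<i> * of_real s)"
    by (intro continuous_intros)
  then show ?thesis by (simp add: rho1_def[abs_def] Complex_eq)
qed

lemma continuous_on_rho2: "continuous_on {0..1} (rho2 c)"
proof -
  have "continuous_on ({0..1} \<inter> {..c} \<union> {0..1} \<inter> {c..}) (rho2 c)"
  proof (rule continuous_on_cases[where P = "\<lambda>s. s \<le> c" and f = "\<lambda>s. of_real (sqrt (c^2 - s^2)) + \<i> * of_real s"
        and g = "\<lambda>s. \<i> * of_real (s - sqrt (s^2 - c^2))", THEN continuous_on_eq])
  qed (auto intro!: continuous_intros closed_Int simp: rho2_def complex_eq_iff)
  moreover have "{0..1} \<inter> {..c} \<union> {0..1} \<inter> {c..} = {0..1}" by auto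
  ultimately show ?thesis by simp
qed

lemma continuous_on_spectral:
  assumes "0 < c" "c \<le> 1"
  shows "continuous_on {0..1} (spectral c p q)"
  unfolding spectral_def
  by (intro continuous_intros continuous_on_rho1 continuous_on_rho2)
    (use assms density_denominator_nonzero in auto)

lemma transmission_integrable:
  assumes "0 < c" "c \<le> 1"
  shows "(\<lambda>s. cis (- 4 * \<tau> * s^2) * spectral c p q s) integrable_on {0..1}"
  by (intro integrable_continuous_interval continuous_intros continuous_on_spectral assms)

text \<open>The real part is half the sum with the conjugate, and conjugation turns the second half
  into the integral at time - \<tau>. It thus suffices to estimate the complex density for both
  signs of time.\<close>

lemma transmission_split:
  assumes c: "0 < c" "c \<le> 1"
  shows "transmission c p q \<tau> = of_real (2 / pi) *
    (integral {0..1} (\<lambda>s. cis (- 4 * \<tau> * s^2) * spectral c p q s) +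
     cnj (integral {0..1} (\<lambda>s. cis (- 4 * (- \<tau>) * s^2) * spectral c p q s)))"
proof -
  let ?Y = "spectral c p q"
  have 1: "(\<lambda>s. cis (- 4 * \<tau> * s^2) * ?Y s) integrable_on {0..1}"
    and 2: "(\<lambda>s. cis (- 4 * \<tau> * s^2) * cnj (?Y s)) integrable_on {0..1}"
    by (intro integrable_continuous_interval continuous_intros continuous_on_spectral c)+
  have e: "cis (- 4 * \<tau> * s^2) * of_real (4 / pi * Re (?Y s)) =
      of_real (2 / pi) * (cis (- 4 * \<tau> * s^2) * ?Y s + cis (- 4 * \<tau> * s^2) * cnj (?Y s))" for s
  proof -
    have "of_real (4 / pi * Re (?Y s)) = of_real (2 / pi) * (?Y s + cnj (?Y s))"
      by (simp add: complex_add_cnj)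
    then show ?thesis by (simp add: algebra_simps)
  qed
  have "cnj (integral {0..1} (\<lambda>s. cis (- 4 * (- \<tau>) * s^2) * ?Y s)) = integral {0..1} (\<lambda>s. cis (- 4 * \<tau> * s^2) * cnj (?Y s))"
    by (simp add: Henstock_Kurzweil_Integration.integral_cnj cis_cnj)
  then show ?thesis
    unfolding transmission_def e integral_mult_right integral_add[OF 1 2] by (simp only:)
qed

text \<open>Both bands together give 12160 (8 \<bar>\<tau>\<bar>)^(-1/3), and 8^(-1/3) = 1/2 turns
  this into 6080 \<bar>\<tau>\<bar>^(-1/3); multiplied by 4 / pi the constant stays below
  8000.\<close>

lemma cmod_transmission_le:
  assumes c: "0 < c" "c \<le> 1"
  shows "cmod (transmission c p q \<tau>) \<le> 2" and "\<tau> \<noteq> 0 \<Longrightarrow> cmod (transmission c p q \<tau>) \<le> 8000 * \<bar>\<tau>\<bar> powr (-1/3)"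
proof -
  let ?I = "\<lambda>\<tau>. integral {0..1} (\<lambda>s. cis (- 4 * \<tau> * s^2) * spectral c p q s)"
  have red: "cmod (transmission c p q \<tau>) \<le> 4 / pi * B" if "cmod (?I \<tau>) \<le> B" "cmod (?I (- \<tau>)) \<le> B" for B
  proof -
    have "cmod (transmission c p q \<tau>) \<le> 2 / pi * (cmod (?I \<tau>) + cmod (?I (- \<tau>)))"
      unfolding transmission_split[OF c] norm_mult
      using norm_triangle_ineq[of "?I \<tau>" "cnj (?I (- \<tau>))"] by (intro mult_mono) (auto simp: norm_divide)
    also have "\<dots> \<le> 2 / pi * (B + B)" using that by (intro mult_left_mono add_mono) auto
    finally show ?thesis by simp
  qed
  have "cmod (?I \<tau>) \<le> 1" for \<tau>
  proof -
    have "cmod (?I \<tau>) \<le> integral {0..1::real} (\<lambda>_. 1::real)"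
      using cmod_spectral_le[OF c]
      by (intro Henstock_Kurzweil_Integration.integral_norm_bound_integral transmission_integrable c) (auto simp: norm_mult)
    then show ?thesis by simp
  qed
  from red[OF this this] have "cmod (transmission c p q \<tau>) \<le> 4 / pi" by simp
  also have "4 / pi \<le> 2" using pi_ge_two by (simp add: divide_le_eq)
  finally show "cmod (transmission c p q \<tau>) \<le> 2" .
  assume tau: "\<tau> \<noteq> 0"
  have I: "cmod (?I \<tau>) \<le> 6080 * \<bar>\<tau>\<bar> powr (-1/3)" if "\<tau> \<noteq> 0" for \<tau>
  proof -
    have "(8 * \<bar>\<tau>\<bar>) powr (-1/3) = 8 powr (-1/3) * \<bar>\<tau>\<bar> powr (-1/3)" by (simp add: powr_mult)
    also have "(8::real) powr (-1/3) = 1 / 2"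
      using powr_powr[of 2 3 "-1/3::real"] by (simp add: powr_minus_divide)
    finally have h: "(8 * \<bar>\<tau>\<bar>) powr (-1/3) = 1 / 2 * \<bar>\<tau>\<bar> powr (-1/3)" .
    have "?I \<tau> = integral {0..c} (\<lambda>s. cis (- 4 * \<tau> * s^2) * spectral c p q s)
        + integral {c..1} (\<lambda>s. cis (- 4 * \<tau> * s^2) * spectral c p q s)"
      by (rule Henstock_Kurzweil_Integration.integral_combine[symmetric]) (use c transmission_integrable in auto)
    also have "cmod \<dots> \<le> 2432 * (8 * \<bar>\<tau>\<bar>) powr (-1/3) + 9728 * (8 * \<bar>\<tau>\<bar>) powr (-1/3)"
      using osc_bounded_propagating[OF c that, of p q] osc_bounded_evanescent[OF c that, of p q] c
      by (intro order_trans[OF norm_triangle_ineq add_mono]) (auto simp: osc_bounded_def)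
    finally show ?thesis unfolding h by simp
  qed
  have "cmod (transmission c p q \<tau>) \<le> 4 / pi * (6080 * \<bar>\<tau>\<bar> powr (-1/3))"
    using red[of "6080 * \<bar>\<tau>\<bar> powr (-1/3)"] I[of \<tau>] I[of "- \<tau>"] tau by simp
  also have "\<dots> \<le> 8000 * \<bar>\<tau>\<bar> powr (-1/3)"
  proof -
    have "4 / pi \<le> 4 / 3.1" using pi_approx by (intro divide_left_mono) auto
    then have "4 / pi * 6080 \<le> 8000" by simp
    then have "4 / pi * 6080 * \<bar>\<tau>\<bar> powr (-1/3) \<le> 8000 * \<bar>\<tau>\<bar> powr (-1/3)" by (intro mult_right_mono) auto
    then show ?thesis by simp
  qed
  finally show "cmod (transmission c p q \<tau>) \<le> 8000 * \<bar>\<tau>\<bar> powr (-1/3)" .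
qed

section \<open>The free kernel and the evolution equations\<close>

text \<open>The fundamental solution on the whole lattice with unit speed, that is, i^n exp (- 2 i
  \<tau>) J_n (2 \<tau>) with the Bessel function J_n.\<close>

definition free_kernel :: "int \<Rightarrow> real \<Rightarrow> complex" where
  "free_kernel n \<tau> = integral {0..pi} (\<lambda>x. cis (- (\<tau> * (2 - 2 * cos x))) * of_real (cos (of_int n * x) / pi))"

section \<open>Decay of the free kernel, uniformly in the site\<close>

lemma half_le_sin:
  fixes y :: real
  assumes "0 \<le> y" "y \<le> pi / 2"
  shows "y / 2 \<le> sin y"
proof (cases "y \<le> pi / 3")
  case True
  have "sin 0 - 0 / 2 \<le> sin y - y / 2"
  proof (rule DERIV_nonneg_imp_nondecreasing[OF assms(1)])
    fix x assume x: "0 \<le> x" "x \<le> y"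
    have "cos (pi / 3) \<le> cos x" using x True by (intro cos_monotone_0_pi_le) auto
    then have "0 \<le> cos x - 1 / 2" by (simp add: cos_60)
    moreover have "((\<lambda>x. sin x - x / 2) has_real_derivative cos x - 1 / 2) (at x)"
      by (auto intro!: derivative_eq_intros)
    ultimately show "\<exists>d. ((\<lambda>x. sin x - x / 2) has_real_derivative d) (at x) \<and> 0 \<le> d" by blast
  qed
  then show ?thesis by simp
next
  case False
  have "sin (pi / 3) \<le> sin y" using False assms by (intro sin_monotone_2pi_le) auto
  moreover have "17 / 10 \<le> sqrt (3::real)" by (intro real_le_rsqrt) (simp add: power2_eq_square)
  moreover have "y \<le> 1.6" using assms pi_approx by simp
  ultimately show ?thesis by (simp add: sin_60)
qed

text \<open>The linear term drops out of the second derivative - 2 \<tau> cos x, which crosses zero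
  at pi / 2 at rate \<tau> by \<open>half_le_sin\<close>; hence the bound does not depend on r.
  Conjugation reduces negative \<tau> to positive \<tau>.\<close>

lemma free_phase_bound:
  fixes \<tau> r :: real
  assumes "\<tau> \<noteq> 0"
  shows "cmod (integral {0..pi} (\<lambda>x. cis (- (\<tau> * (2 - 2 * cos x)) + r * x))) \<le> 38 * \<bar>\<tau>\<bar> powr (-1/3)"
proof -
  have pos: "cmod (integral {0..pi} (\<lambda>x. cis (- (\<tau> * (2 - 2 * cos x)) + r * x))) \<le> 38 * \<tau> powr (-1/3)"
    if t: "\<tau> > 0" for \<tau> r :: real
  proof (rule van_der_corput_third)
    show "((\<lambda>x. - (\<tau> * (2 - 2 * cos x)) + r * x) has_real_derivative - (2 * \<tau> * sin x) + r) (at x)" for x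
      by (auto intro!: derivative_eq_intros)
    show "((\<lambda>x. - (2 * \<tau> * sin x) + r) has_real_derivative - (2 * \<tau> * cos x)) (at x)" for x
      by (auto intro!: derivative_eq_intros)
    show "crosses (\<lambda>x. - (2 * \<tau> * cos x)) \<tau> (pi / 2) {0..pi}"
      unfolding crosses_def
    proof (intro ballI conjI impI)
      fix x assume x: "x \<in> {0..pi}" "pi / 2 < x"
      have "(x - pi / 2) / 2 \<le> sin (x - pi / 2)" using x by (intro half_le_sin) auto
      also have "\<dots> = - cos x" by (simp add: sin_diff)
      finally have "2 * \<tau> * ((x - pi / 2) / 2) \<le> 2 * \<tau> * (- cos x)" using t by (intro mult_left_mono) auto
      then show "\<tau> * (x - pi / 2) \<le> - (2 * \<tau> * cos x)" by simp
    next
      fix x assume x: "x \<in> {0..pi}" "x < pi / 2"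
      have "(pi / 2 - x) / 2 \<le> sin (pi / 2 - x)" using x by (intro half_le_sin) auto
      also have "\<dots> = cos x" by (simp add: sin_diff)
      finally have "2 * \<tau> * ((pi / 2 - x) / 2) \<le> 2 * \<tau> * cos x" using t by (intro mult_left_mono) auto
      then show "- (2 * \<tau> * cos x) \<le> - (\<tau> * (pi / 2 - x))" by simp
    qed
  qed (use t in auto)
  show ?thesis
  proof (cases "\<tau> > 0")
    case True
    then show ?thesis using pos[of \<tau> r] by simp
  next
    case False
    then have "\<tau> < 0" using assms by simp
    have e: "- (\<tau> * (2 - 2 * cos x)) + r * x = - (- (- \<tau> * (2 - 2 * cos x)) + (- r) * x)" for x
      by (simp add: algebra_simps)
    show ?thesis
      unfolding e cmod_integral_cis_uminus using pos[of "- \<tau>" "- r"] \<open>\<tau> < 0\<close> by simp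
  qed
qed

lemma cmod_free_kernel_le:
  shows "cmod (free_kernel n \<tau>) \<le> 1" and "\<tau> \<noteq> 0 \<Longrightarrow> cmod (free_kernel n \<tau>) \<le> 38 * \<bar>\<tau>\<bar> powr (-1/3)"
proof -
  have "cmod (free_kernel n \<tau>) \<le> integral {0..pi} (\<lambda>x. 1 / pi)"
    unfolding free_kernel_def
    by (intro Henstock_Kurzweil_Integration.integral_norm_bound_integral integrable_continuous_interval continuous_intros)
      (auto simp: norm_mult norm_divide divide_right_mono)
  then show "cmod (free_kernel n \<tau>) \<le> 1" by simp
  assume tau: "\<tau> \<noteq> 0"
  let ?J = "\<lambda>r::real. integral {0..pi} (\<lambda>x. cis (- (\<tau> * (2 - 2 * cos x)) + r * x))"
  have i: "(\<lambda>x. cis (- (\<tau> * (2 - 2 * cos x)) + r * x)) integrable_on {0..pi}" for r :: real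
    by (intro integrable_continuous_interval continuous_intros)
  have "of_real (cos y / pi) = of_real (1 / (2 * pi)) * (cis y + cis (- y))" for y
    by (simp add: complex_eq_iff)
  then have "cis a * of_real (cos y / pi) = of_real (1 / (2 * pi)) * (cis a * cis y + cis a * cis (- y))" for a y
    by (simp only: distrib_left distrib_right mult_ac)
  then have phase: "cis a * of_real (cos y / pi) = of_real (1 / (2 * pi)) * (cis (a + y) + cis (a + - y))" for a y
    by (simp only: cis_mult)
  have e: "cis (- (\<tau> * (2 - 2 * cos x))) * of_real (cos (of_int n * x) / pi) = of_real (1 / (2 * pi)) *
     (cis (- (\<tau> * (2 - 2 * cos x)) + of_int n * x) + cis (- (\<tau> * (2 - 2 * cos x)) + of_int (- n) * x))" for x :: real
    unfolding phase by (simp add: algebra_simps)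
  have "free_kernel n \<tau> = of_real (1 / (2 * pi)) * (?J (of_int n) + ?J (of_int (- n)))"
    unfolding free_kernel_def e integral_mult_right using integral_add[OF i[of "of_int n"] i[of "of_int (- n)"]] by simp
  also have "cmod \<dots> \<le> 1 / (2 * pi) * (38 * \<bar>\<tau>\<bar> powr (-1/3) + 38 * \<bar>\<tau>\<bar> powr (-1/3))"
    unfolding norm_mult
    by (intro mult_mono order_trans[OF norm_triangle_ineq add_mono] free_phase_bound tau) (auto simp: norm_divide)
  also have "\<dots> = 1 / pi * (38 * \<bar>\<tau>\<bar> powr (-1/3))" by simp
  also have "\<dots> \<le> 1 * (38 * \<bar>\<tau>\<bar> powr (-1/3))" using pi_ge_two by (intro mult_right_mono) auto
  finally show "cmod (free_kernel n \<tau>) \<le> 38 * \<bar>\<tau>\<bar> powr (-1/3)" by simp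
qed

section \<open>Evolution equations of the kernel integrals\<close>

lemma has_vector_derivative_integral_cis:
  fixes \<omega> :: "real \<Rightarrow> real" and h :: "real \<Rightarrow> complex"
  assumes w: "continuous_on {a..b} \<omega>" and h: "continuous_on {a..b} h"
  shows "((\<lambda>\<tau>. integral {a..b} (\<lambda>x. cis (- (\<tau> * \<omega> x)) * h x)) has_vector_derivative
    integral {a..b} (\<lambda>x. cis (- (\<tau> * \<omega> x)) * (- \<i> * of_real (\<omega> x) * h x))) (at \<tau>)"
proof -
  have w': "continuous_on (UNIV \<times> {a..b}) (\<lambda>p::real \<times> real. \<omega> (snd p))"
    by (rule continuous_on_compose2[OF w]) (auto intro!: continuous_intros)
  have h': "continuous_on (UNIV \<times> {a..b}) (\<lambda>p::real \<times> real. h (snd p))"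
    by (rule continuous_on_compose2[OF h]) (auto intro!: continuous_intros)
  have "((\<lambda>\<tau>. integral (cbox a b) (\<lambda>x. cis (- (\<tau> * \<omega> x)) * h x)) has_vector_derivative
    integral (cbox a b) (\<lambda>x. cis (- (\<tau> * \<omega> x)) * (- \<i> * of_real (\<omega> x) * h x))) (at \<tau> within UNIV)"
  proof (rule leibniz_rule_vector_derivative)
    fix \<tau> x :: real
    show "((\<lambda>\<tau>. cis (- (\<tau> * \<omega> x)) * h x) has_vector_derivative cis (- (\<tau> * \<omega> x)) * (- \<i> * of_real (\<omega> x) * h x)) (at \<tau> within UNIV)"
      unfolding has_vector_derivative_def
      by (auto intro!: derivative_eq_intros simp: scaleR_conv_of_real algebra_simps)
    show "(\<lambda>x. cis (- (\<tau> * \<omega> x)) * h x) integrable_on cbox a b"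
      using w h by (auto intro!: integrable_continuous_interval continuous_intros)
  next
    show "continuous_on (UNIV \<times> cbox a b) (\<lambda>(\<tau>, x). cis (- (\<tau> * \<omega> x)) * (- \<i> * of_real (\<omega> x) * h x))"
      using w' h' by (auto intro!: continuous_intros simp: split_beta)
  qed auto
  then show ?thesis by simp
qed

text \<open>The second difference of cos (n x) in n is - (2 - 2 cos x) cos (n x), the same factor
  that differentiation in time brings down.\<close>

lemma free_kernel_ode:
  "(free_kernel n has_vector_derivative
     \<i> * (free_kernel (n + 1) \<tau> - 2 * free_kernel n \<tau> + free_kernel (n - 1) \<tau>)) (at \<tau>)"
proof -
  let ?g = "\<lambda>n x. cis (- (\<tau> * (2 - 2 * cos x))) * of_real (cos (of_int n * x) / pi)"
  have i: "(?g n has_integral free_kernel n \<tau>) {0..pi}" for n :: int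
    unfolding free_kernel_def
    by (intro integrable_integral integrable_continuous_interval continuous_intros) auto
  have "((\<lambda>x. \<i> * (?g (n + 1) x - 2 * ?g n x + ?g (n - 1) x)) has_integral
      \<i> * (free_kernel (n + 1) \<tau> - 2 * free_kernel n \<tau> + free_kernel (n - 1) \<tau>)) {0..pi}"
    by (intro has_integral_mult_right has_integral_add has_integral_diff i)
  moreover have "\<i> * (?g (n + 1) x - 2 * ?g n x + ?g (n - 1) x) =
      cis (- (\<tau> * (2 - 2 * cos x))) * (- \<i> * of_real (2 - 2 * cos x) * of_real (cos (of_int n * x) / pi))" for x :: real
  proof -
    have "cos (of_int (n + 1) * x) + cos (of_int (n - 1) * x) = 2 * cos x * cos (of_int n * x)"
      by (simp add: algebra_simps cos_add cos_diff)
    then have "cos (of_int (n + 1) * x) - 2 * cos (of_int n * x) + cos (of_int (n - 1) * x) = - (2 - 2 * cos x) * cos (of_int n * x)"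
      by (simp add: algebra_simps)
    then have *: "cos (of_int (n + 1) * x) / pi - 2 * (cos (of_int n * x) / pi) + cos (of_int (n - 1) * x) / pi = - (2 - 2 * cos x) * (cos (of_int n * x) / pi)"
      by (simp add: field_simps)
    have "\<i> * (?g (n + 1) x - 2 * ?g n x + ?g (n - 1) x) =
      \<i> * (cis (- (\<tau> * (2 - 2 * cos x))) * of_real (cos (of_int (n + 1) * x) / pi - 2 * (cos (of_int n * x) / pi) + cos (of_int (n - 1) * x) / pi))"
      by (simp add: algebra_simps)
    also have "\<dots> = cis (- (\<tau> * (2 - 2 * cos x))) * (- \<i> * of_real (2 - 2 * cos x) * of_real (cos (of_int n * x) / pi))"
    proof -
      have "\<i> * (C * of_real (- a * b)) = C * (- \<i> * of_real a * of_real b)" for C :: complex and a b by simp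
      then show ?thesis unfolding * .
    qed
    finally show ?thesis .
  qed
  ultimately have "\<i> * (free_kernel (n + 1) \<tau> - 2 * free_kernel n \<tau> + free_kernel (n - 1) \<tau>) =
     integral {0..pi} (\<lambda>x. cis (- (\<tau> * (2 - 2 * cos x))) * (- \<i> * of_real (2 - 2 * cos x) * of_real (cos (of_int n * x) / pi)))"
    by (simp only: integral_unique)
  moreover have "(free_kernel n has_vector_derivative
     integral {0..pi} (\<lambda>x. cis (- (\<tau> * (2 - 2 * cos x))) * (- \<i> * of_real (2 - 2 * cos x) * of_real (cos (of_int n * x) / pi)))) (at \<tau>)"
    unfolding free_kernel_def[abs_def]
    by (rule has_vector_derivative_integral_cis) (auto intro!: continuous_intros)
  ultimately show ?thesis by simp
qed

lemma free_kernel_uminus: "free_kernel (- n) = free_kernel n"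
  by (simp add: free_kernel_def[abs_def])

lemma free_kernel_initial: "free_kernel n 0 = (if n = 0 then 1 else 0)"
proof (cases "n = 0")
  case False
  have "((\<lambda>x. cos (of_int n * x) / pi) has_integral (sin (of_int n * pi) / of_int n / pi - sin (of_int n * 0) / of_int n / pi)) {0..pi}"
    by (rule fundamental_theorem_of_calculus)
      (use False in \<open>auto intro!: derivative_eq_intros simp flip: has_real_derivative_iff_has_vector_derivative\<close>)
  moreover have "sin (of_int n * pi) = 0" unfolding sin_zero_iff_int2 by blast
  ultimately have "((\<lambda>x. cos (of_int n * x) / pi) has_integral 0) {0..pi}" by simp
  then have "((\<lambda>x. complex_of_real (cos (of_int n * x) / pi)) has_integral of_real 0) {0..pi}"
    by (rule has_integral_of_real)
  moreover have "free_kernel n 0 = integral {0..pi} (\<lambda>x. complex_of_real (cos (of_int n * x) / pi))"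
    unfolding free_kernel_def by (simp only: mult_zero_left minus_zero cis_zero mult_1_left)
  ultimately show ?thesis using False by (simp only: integral_unique of_real_0 if_False)
qed (simp add: free_kernel_def scaleR_conv_of_real)

lemma rho1_square:
  assumes "0 \<le> s" "s \<le> 1"
  shows "rho1 s ^ 2 - 1 = 2 * \<i> * of_real s * rho1 s"
proof -
  have "s * s \<le> 1" using assms by (simp add: mult_le_one)
  then show ?thesis using assms by (simp add: rho1_def complex_eq_iff power2_eq_square algebra_simps)
qed

lemma rho2_square:
  assumes "0 < c" "0 \<le> s"
  shows "(rho2 c s / of_real c) ^ 2 - 1 = 2 * \<i> * of_real (s / c) * (rho2 c s / of_real c)"
proof -
  have "rho2 c s ^ 2 - of_real c ^ 2 = 2 * \<i> * of_real s * rho2 c s"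
  proof (cases "s \<le> c")
    case True
    then have "s * s \<le> c * c" using assms by (intro mult_mono) auto
    then show ?thesis using True by (simp add: rho2_def complex_eq_iff power2_eq_square algebra_simps)
  next
    case False
    then have "c * c \<le> s * s" using assms by (intro mult_mono) auto
    then show ?thesis using False by (simp add: rho2_def complex_eq_iff power2_eq_square algebra_simps)
  qed
  moreover have "(R / C)^2 - 1 = (R^2 - C^2) / C^2" if "C \<noteq> 0" for R C :: complex
    using that by (simp add: power_divide diff_divide_distrib)
  ultimately show ?thesis using assms by (simp add: power2_eq_square)
qed

lemma spectral_add:
  "spectral c (p + m) (q + n) s = rho1 s ^ (2 * m) * (rho2 c s / of_real c) ^ (2 * n) * spectral c p q s"
  by (simp add: spectral_def power_add algebra_simps power_mult_distrib)

lemma transmission_has_integral: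
  assumes "0 < c" "c \<le> 1"
  shows "((\<lambda>s. cis (- (\<tau> * (4 * s^2))) * of_real (4 / pi * Re (spectral c p q s))) has_integral
     transmission c p q \<tau>) {0..1}"
proof -
  have "transmission c p q \<tau> = integral {0..1} (\<lambda>s. cis (- (\<tau> * (4 * s^2))) * of_real (4 / pi * Re (spectral c p q s)))"
    by (simp add: transmission_def algebra_simps)
  then show ?thesis
    by (simp only:) (intro integrable_integral integrable_continuous_interval continuous_intros continuous_on_spectral assms)
qed

lemma transmission_has_vector_derivative:
  assumes "0 < c" "c \<le> 1"
  shows "(transmission c p q has_vector_derivative integral {0..1}
     (\<lambda>s. cis (- (\<tau> * (4 * s^2))) * (- \<i> * of_real (4 * s^2) * of_real (4 / pi * Re (spectral c p q s))))) (at \<tau>)"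
proof -
  have "transmission c p q = (\<lambda>\<tau>. integral {0..1} (\<lambda>s. cis (- (\<tau> * (4 * s^2))) * of_real (4 / pi * Re (spectral c p q s))))"
    using integral_unique[OF transmission_has_integral[OF assms]] by (intro ext) (simp only:)
  then show ?thesis
    by (simp only:) (intro has_vector_derivative_integral_cis continuous_intros continuous_on_spectral assms)
qed

lemma second_difference_integral:
  fixes f0 f1 f2 :: "real \<Rightarrow> real" and g :: "real \<Rightarrow> complex"
  assumes "((\<lambda>s. g s * of_real (4 / pi * f0 s)) has_integral I0) S"
    and "((\<lambda>s. g s * of_real (4 / pi * f1 s)) has_integral I1) S"
    and "((\<lambda>s. g s * of_real (4 / pi * f2 s)) has_integral I2) S"
    and "\<And>s. s \<in> S \<Longrightarrow> k * (f2 s - 2 * f1 s + f0 s) = - (4 * s^2 * f1 s)"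
  shows "integral S (\<lambda>s. g s * (- \<i> * of_real (4 * s^2) * of_real (4 / pi * f1 s))) = \<i> * (of_real k * (I2 - 2 * I1 + I0))"
proof -
  have "((\<lambda>s. \<i> * (of_real k * (g s * of_real (4 / pi * f2 s) - 2 * (g s * of_real (4 / pi * f1 s)) + g s * of_real (4 / pi * f0 s))))
     has_integral (\<i> * (of_real k * (I2 - 2 * I1 + I0)))) S"
    by (intro has_integral_mult_right has_integral_add has_integral_diff assms)
  then have "integral S (\<lambda>s. \<i> * (of_real k * (g s * of_real (4 / pi * f2 s) - 2 * (g s * of_real (4 / pi * f1 s)) + g s * of_real (4 / pi * f0 s))))
     = \<i> * (of_real k * (I2 - 2 * I1 + I0))"
    by (rule integral_unique)
  moreover have "\<i> * (of_real k * (g s * of_real (4 / pi * f2 s) - 2 * (g s * of_real (4 / pi * f1 s)) + g s * of_real (4 / pi * f0 s)))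
     = g s * (- \<i> * of_real (4 * s^2) * of_real (4 / pi * f1 s))" if "s \<in> S" for s
  proof -
    have "\<i> * (of_real k * (g s * of_real (4 / pi * f2 s) - 2 * (g s * of_real (4 / pi * f1 s)) + g s * of_real (4 / pi * f0 s)))
      = \<i> * g s * of_real (4 / pi * (k * (f2 s - 2 * f1 s + f0 s)))"
      by (simp add: algebra_simps)
    then show ?thesis unfolding assms(4)[OF that] by (simp add: algebra_simps)
  qed
  ultimately show ?thesis using integral_cong by (metis (no_types, lifting))
qed

lemma Re_of_real_times: "Re (of_real r * z) = r * Re z"
  by simp

lemma Re_two_times: "Re (2 * z) = 2 * Re z"
  by simp

text \<open>Raising p by one multiplies the density by r1, and squaring \<open>rho1_square\<close>
  gives (r1 - 1)^2 = - 4 s^2 r1. The second difference in p is thus multiplication by - 4 s^2, the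
  factor that differentiation in time produces; being real, it commutes with taking the real
  part.\<close>

lemma transmission_ode1:
  assumes c: "0 < c" "c \<le> 1"
  shows "(transmission c (Suc p) q has_vector_derivative
     \<i> * (transmission c (Suc (Suc p)) q \<tau> - 2 * transmission c (Suc p) q \<tau> + transmission c p q \<tau>)) (at \<tau>)"
proof -
  have "1 * (Re (spectral c (Suc (Suc p)) q s) - 2 * Re (spectral c (Suc p) q s) + Re (spectral c p q s))
      = - (4 * s^2 * Re (spectral c (Suc p) q s))" if "s \<in> {0..1}" for s
  proof -
    let ?r = "rho1 s" and ?Y = "spectral c p q s"
    have "?r ^ 4 - 2 * ?r ^ 2 + 1 = (?r ^ 2 - 1) ^ 2" by (simp add: power2_eq_square algebra_simps eval_nat_numeral)
    also have "\<dots> = of_real (- (4 * s^2)) * ?r ^ 2"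
      using that by (simp add: rho1_square power_mult_distrib)
    finally have "(?r ^ 4 - 2 * ?r ^ 2 + 1) * ?Y = of_real (- (4 * s^2)) * (?r ^ 2 * ?Y)" by simp
    moreover have "spectral c (Suc (Suc p)) q s = ?r ^ 4 * ?Y" "spectral c (Suc p) q s = ?r ^ 2 * ?Y"
      using spectral_add[of c p 2 q 0 s] spectral_add[of c p 1 q 0 s] by auto
    ultimately have "spectral c (Suc (Suc p)) q s - 2 * spectral c (Suc p) q s + ?Y = of_real (- (4 * s^2)) * spectral c (Suc p) q s"
      by (simp add: algebra_simps)
    from arg_cong[OF this, of Re] show ?thesis
      by (simp only: Re_of_real_times Re_two_times plus_complex.sel minus_complex.sel mult_1_left mult_minus_left)
  qed
  from second_difference_integral[OF transmission_has_integral[OF c] transmission_has_integral[OF c] transmission_has_integral[OF c] this]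
    transmission_has_vector_derivative[OF c, of "Suc p" q \<tau>]
  show ?thesis by simp
qed

text \<open>Here the relation is c^2 (r2 - 1)^2 = - 4 s^2 r2; the weight c^2 is the ratio of the two
  speeds.\<close>

lemma transmission_ode2:
  assumes c: "0 < c" "c \<le> 1"
  shows "(transmission c p (Suc q) has_vector_derivative
     \<i> * (of_real (c^2) * (transmission c p (Suc (Suc q)) \<tau> - 2 * transmission c p (Suc q) \<tau> + transmission c p q \<tau>))) (at \<tau>)"
proof -
  have "c^2 * (Re (spectral c p (Suc (Suc q)) s) - 2 * Re (spectral c p (Suc q) s) + Re (spectral c p q s))
      = - (4 * s^2 * Re (spectral c p (Suc q) s))" if "s \<in> {0..1}" for s
  proof -
    let ?r = "rho2 c s / of_real c" and ?Y = "spectral c p q s"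
    have "?r ^ 4 - 2 * ?r ^ 2 + 1 = (?r ^ 2 - 1) ^ 2" by (simp add: power2_eq_square algebra_simps eval_nat_numeral)
    also have "\<dots> = of_real (- (4 * (s / c)^2)) * ?r ^ 2"
      unfolding rho2_square[OF c(1), of s, OF that[unfolded atLeastAtMost_iff, THEN conjunct1]] by (simp add: power_mult_distrib power_divide)
    finally have "of_real (c^2) * ((?r ^ 4 - 2 * ?r ^ 2 + 1) * ?Y) = of_real (c^2 * - (4 * (s / c)^2)) * (?r ^ 2 * ?Y)"
      by (simp only: of_real_mult mult.assoc)
    also have "c^2 * - (4 * (s / c)^2) = - (4 * s^2)" using c by (simp add: power_divide)
    finally have "of_real (c^2) * ((?r ^ 4 - 2 * ?r ^ 2 + 1) * ?Y) = of_real (- (4 * s^2)) * (?r ^ 2 * ?Y)" .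
    moreover have "spectral c p (Suc (Suc q)) s = ?r ^ 4 * ?Y" "spectral c p (Suc q) s = ?r ^ 2 * ?Y"
      using spectral_add[of c p 0 q 2 s] spectral_add[of c p 0 q 1 s] by auto
    ultimately have "of_real (c^2) * (spectral c p (Suc (Suc q)) s - 2 * spectral c p (Suc q) s + ?Y) = of_real (- (4 * s^2)) * spectral c p (Suc q) s"
      by (simp add: algebra_simps)
    from arg_cong[OF this, of Re] show ?thesis
      by (simp only: Re_of_real_times Re_two_times plus_complex.sel minus_complex.sel mult_1_left mult_minus_left)
  qed
  from second_difference_integral[OF transmission_has_integral[OF c] transmission_has_integral[OF c] transmission_has_integral[OF c] this]
    transmission_has_vector_derivative[OF c, of p "Suc q" \<tau>]
  show ?thesis by simp
qed

section \<open>The coupling condition\<close>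

text \<open>The substitution s = c sin (x / 2) turns 4 s^2 into c^2 (2 - 2 cos x) and 2 k arcsin (s
  / c) into k x. Together with the Jacobian a multiple of sin x sin (k x) remains, which is a
  difference of two cosines. For s > c even powers of the second root are real, so this part
  contributes nothing.\<close>

lemma flux_integral:
  assumes c: "0 < c" "c \<le> 1"
  shows "((\<lambda>s. cis (- (\<tau> * (4 * s^2))) * of_real (8 / pi * (s * Im ((rho2 c s / of_real c) ^ (2 * k))))) has_integral
    of_real (c^2) * (free_kernel (int k - 1) (c^2 * \<tau>) - free_kernel (int k + 1) (c^2 * \<tau>))) {0..1}"
  (is "(?F has_integral ?I) {0..1}")
proof -
  let ?f = "\<lambda>s. cis (- (\<tau> * (4 * s^2))) * of_real (8 / pi * (s * sin (2 * real k * arcsin (s / c))))"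
  let ?E = "\<lambda>n x. cis (- (c^2 * \<tau> * (2 - 2 * cos x))) * complex_of_real (cos (of_int n * x) / pi)"
  have cont: "continuous_on {0..c} ?f"
  proof -
    have "- 1 \<le> s / c \<and> s / c \<le> 1" if "s \<in> {0..c}" for s
      using that c by (auto intro: order_trans[of _ 0])
    then show ?thesis using c by (intro continuous_intros) auto
  qed
  have Ei: "(?E n has_integral free_kernel n (c^2 * \<tau>)) {0..pi}" for n
    unfolding free_kernel_def
    by (intro integrable_integral integrable_continuous_interval continuous_intros) auto
  have "((\<lambda>x. (c / 2 * cos (x / 2)) *\<^sub>R ?f (c * sin (x / 2))) has_integral
      integral {c * sin (0 / 2)..c * sin (pi / 2)} ?f) {0..pi}"
  proof (rule has_integral_substitution[OF _ _ _ cont])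
    show "(\<lambda>x. c * sin (x / 2)) ` {0..pi} \<subseteq> {0..c}"
    proof (rule image_subsetI)
      fix x assume "x \<in> {0..pi}"
      then have "0 \<le> sin (x / 2)" by (intro sin_ge_zero) auto
      then show "c * sin (x / 2) \<in> {0..c}" using c by (simp add: mult_le_cancel_left1)
    qed
    show "((\<lambda>x. c * sin (x / 2)) has_real_derivative c / 2 * cos (x / 2)) (at x within {0..pi})" for x
      by (auto intro!: derivative_eq_intros)
  qed (use c in auto)
  moreover have "(c / 2 * cos (x / 2)) *\<^sub>R ?f (c * sin (x / 2)) = of_real (c^2) * (?E (int k - 1) x - ?E (int k + 1) x)"
    if x: "x \<in> {0..pi}" for x
  proof -
    have a: "arcsin (c * sin (x / 2) / c) = x / 2" using x c by (simp add: arcsin_sin)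
    have cx: "cos x = 1 - 2 * (sin (x / 2))^2" using cos_double_sin[of "x / 2"] by simp
    have sx: "sin x = 2 * sin (x / 2) * cos (x / 2)" using sin_double[of "x / 2"] by simp
    have ph: "- (\<tau> * (4 * (c * sin (x / 2))^2)) = - (c^2 * \<tau> * (2 - 2 * cos x))"
      unfolding cx by (simp add: power_mult_distrib)
    have "cos ((real k - 1) * x) - cos ((real k + 1) * x) = 2 * sin x * sin (real k * x)"
      by (simp add: algebra_simps cos_add cos_diff)
    then have "(c / 2 * cos (x / 2)) * (8 / pi * (c * sin (x / 2) * sin (real k * x))) =
      c^2 * (cos (of_int (int k - 1) * x) / pi - cos (of_int (int k + 1) * x) / pi)"
      unfolding diff_divide_distrib[symmetric] using sx by (simp add: power2_eq_square)
    then have "complex_of_real ((c / 2 * cos (x / 2)) * (8 / pi * (c * sin (x / 2) * sin (real k * x)))) =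
      of_real (c^2) * (of_real (cos (of_int (int k - 1) * x) / pi) - of_real (cos (of_int (int k + 1) * x) / pi))"
      by (simp only: of_real_mult of_real_diff)
    then have "cis A * complex_of_real ((c / 2 * cos (x / 2)) * (8 / pi * (c * sin (x / 2) * sin (real k * x)))) =
      of_real (c^2) * (cis A * of_real (cos (of_int (int k - 1) * x) / pi) - cis A * of_real (cos (of_int (int k + 1) * x) / pi))" for A
      by (simp only: right_diff_distrib mult_ac)
    moreover have "2 * real k * (x / 2) = real k * x" by simp
    moreover have "complex_of_real r * (cis A * of_real m) = cis A * complex_of_real (r * m)" for r m A by simp
    ultimately show ?thesis
      unfolding a ph scaleR_conv_of_real by (simp only:)
  qed
  ultimately have "((\<lambda>x. of_real (c^2) * (?E (int k - 1) x - ?E (int k + 1) x)) has_integral integral {0..c} ?f) {0..pi}"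
    by (subst (asm) has_integral_cong) auto
  moreover have "((\<lambda>x. of_real (c^2) * (?E (int k - 1) x - ?E (int k + 1) x)) has_integral ?I) {0..pi}"
    by (intro has_integral_mult_right has_integral_diff Ei)
  ultimately have I: "integral {0..c} ?f = ?I" by (rule has_integral_unique)
  have "(?f has_integral ?I) {0..c}"
    unfolding I[symmetric] by (intro integrable_integral integrable_continuous_interval cont)
  moreover have "?f s = ?F s" if "s \<in> {0..c}" for s
  proof -
    have "rho2 c s / of_real c = cis (arcsin (s / c))" using that c by (simp add: rho2_eq_cis)
    then show ?thesis by (simp add: Complex.DeMoivre)
  qed
  ultimately have 1: "(?F has_integral ?I) {0..c}"
    by (rule has_integral_eq[rotated])
  have 2: "(?F has_integral 0) {c..1}"
  proof (rule has_integral_is_0)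
    fix s assume "s \<in> {c..1}"
    then have "rho2 c s = \<i> * of_real (s - sqrt (s^2 - c^2))"
      by (auto simp: rho2_def complex_eq_iff)
    then have "(rho2 c s / of_real c)^2 = of_real (- (((s - sqrt (s^2 - c^2)) / c)^2))"
      by (simp add: power_mult_distrib power_divide)
    then have "(rho2 c s / of_real c) ^ (2 * k) = of_real ((- (((s - sqrt (s^2 - c^2)) / c)^2)) ^ k)"
      by (simp only: power_mult of_real_power)
    then show "?F s = 0" by (simp only: Im_complex_of_real) simp
  qed
  show ?thesis using has_integral_combine[OF _ _ 1 2] c by simp
qed

text \<open>Since (r1 - 1) + c^2 (r2 - 1) = 2 i s (rho1 + rho2), the flux combination cancels the
  denominator of the density and leaves a pure product of powers; the factor 2 i s exchanges the
  real part for an imaginary part.\<close>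

lemma transmission_flux:
  assumes c: "0 < c" "c \<le> 1"
    and J: "((\<lambda>s. cis (- (\<tau> * (4 * s^2))) * of_real (8 / pi * (s * Im (rho1 s ^ (2 * p) * (rho2 c s / of_real c) ^ (2 * q))))) has_integral J) {0..1}"
  shows "(transmission c (Suc p) q \<tau> - transmission c p q \<tau>) + of_real (c^2) * (transmission c p (Suc q) \<tau> - transmission c p q \<tau>) = - J"
proof -
  let ?C = "\<lambda>s. cis (- (\<tau> * (4 * s^2)))"
  let ?Y = "\<lambda>p q s. Re (spectral c p q s)"
  let ?W = "\<lambda>s. rho1 s ^ (2 * p) * (rho2 c s / of_real c) ^ (2 * q)"
  have "((\<lambda>s. (?C s * of_real (4 / pi * ?Y (Suc p) q s) - ?C s * of_real (4 / pi * ?Y p q s))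
      + of_real (c^2) * (?C s * of_real (4 / pi * ?Y p (Suc q) s) - ?C s * of_real (4 / pi * ?Y p q s))) has_integral
      (transmission c (Suc p) q \<tau> - transmission c p q \<tau>) + of_real (c^2) * (transmission c p (Suc q) \<tau> - transmission c p q \<tau>)) {0..1}"
    by (intro has_integral_add has_integral_diff has_integral_mult_right transmission_has_integral c)
  moreover have "(?C s * of_real (4 / pi * ?Y (Suc p) q s) - ?C s * of_real (4 / pi * ?Y p q s))
      + of_real (c^2) * (?C s * of_real (4 / pi * ?Y p (Suc q) s) - ?C s * of_real (4 / pi * ?Y p q s))
      = - (?C s * of_real (8 / pi * (s * Im (?W s))))" if s: "s \<in> {0..1}" for s
  proof -
    let ?r1 = "rho1 s" and ?r2 = "rho2 c s / of_real c"
    have r12: "?r1^2 - 1 = 2 * \<i> * of_real s * ?r1" "?r2^2 - 1 = 2 * \<i> * of_real (s / c) * ?r2"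
      using rho1_square[of s] rho2_square[of c s] s c by auto
    have "(?r1^2 - 1) + of_real (c^2) * (?r2^2 - 1) = 2 * \<i> * of_real s * (rho1 s + rho2 c s)"
      unfolding r12 using c by (simp add: power2_eq_square algebra_simps)
    then have "((?r1^2 - 1) + of_real (c^2) * (?r2^2 - 1)) * spectral c p q s
        = 2 * \<i> * of_real s * ((rho1 s + rho2 c s) * spectral c p q s)"
      by (simp only: mult.assoc)
    also have "(rho1 s + rho2 c s) * spectral c p q s = ?W s"
      using density_denominator_nonzero[OF c] s by (simp add: spectral_def)
    finally have "((?r1^2 - 1) + of_real (c^2) * (?r2^2 - 1)) * spectral c p q s = 2 * \<i> * of_real s * ?W s" .
    moreover have "spectral c (Suc p) q s = ?r1^2 * spectral c p q s"
      "spectral c p (Suc q) s = ?r2^2 * spectral c p q s"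
      using spectral_add[of c p 1 q 0 s] spectral_add[of c p 0 q 1 s] by simp_all
    moreover have "(a * Y - Y) + C * (b * Y - Y) = ((a - 1) + C * (b - 1)) * Y" for a b C Y :: complex
      by (simp add: algebra_simps)
    ultimately have "(spectral c (Suc p) q s - spectral c p q s) + of_real (c^2) * (spectral c p (Suc q) s - spectral c p q s)
        = 2 * \<i> * of_real s * ?W s"
      by (simp only:)
    from arg_cong[OF this, of Re]
    have "(?Y (Suc p) q s - ?Y p q s) + c^2 * (?Y p (Suc q) s - ?Y p q s) = - 2 * (s * Im (?W s))"
      unfolding plus_complex.sel minus_complex.sel Re_of_real_times by simp
    then have "4 / pi * ((?Y (Suc p) q s - ?Y p q s) + c^2 * (?Y p (Suc q) s - ?Y p q s)) = - (8 / pi * (s * Im (?W s)))"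
      by simp
    from arg_cong[OF this, of "\<lambda>r. ?C s * of_real r"] show ?thesis
      by (simp add: algebra_simps)
  qed
  ultimately have "((\<lambda>s. - (?C s * of_real (8 / pi * (s * Im (?W s))))) has_integral
      (transmission c (Suc p) q \<tau> - transmission c p q \<tau>) + of_real (c^2) * (transmission c p (Suc q) \<tau> - transmission c p q \<tau>)) {0..1}"
    by (rule has_integral_eq[rotated])
  moreover have "((\<lambda>s. - (?C s * of_real (8 / pi * (s * Im (?W s))))) has_integral - J) {0..1}"
    by (intro has_integral_neg J)
  ultimately show ?thesis by (rule has_integral_unique)
qed

text \<open>The right-hand side is minus the flux through the interface of the Dirichlet kernel E(j
  - k) - E(j + k), read off at j = 1 with E even. Adding that kernel on the right half line
  therefore makes the total flux vanish.\<close>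

lemma kirchhoff_right:
  assumes c: "0 < c" "c \<le> 1"
  shows "(transmission c (Suc 0) k \<tau> - transmission c 0 k \<tau>) + of_real (c^2) * (transmission c 0 (Suc k) \<tau> - transmission c 0 k \<tau>)
    = - (of_real (c^2) * (free_kernel (int k - 1) (c^2 * \<tau>) - free_kernel (int k + 1) (c^2 * \<tau>)))"
  by (rule transmission_flux[OF c]) (use flux_integral[OF c, of \<tau> k] in simp)

lemma kirchhoff_left:
  assumes c: "0 < c" "c \<le> 1"
  shows "(transmission c (Suc k) 0 \<tau> - transmission c k 0 \<tau>) + of_real (c^2) * (transmission c k (Suc 0) \<tau> - transmission c k 0 \<tau>)
    = - (free_kernel (int k - 1) \<tau> - free_kernel (int k + 1) \<tau>)"
proof (rule transmission_flux[OF c])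
  \<comment> \<open>At c = 1 the second root coincides with the first, so
    \<open>flux_integral\<close> also covers powers of r1.\<close>
  have "rho2 1 s = rho1 s" if "s \<in> {0..1}" for s using that by (simp add: rho1_def rho2_def)
  then have "((\<lambda>s. cis (- (\<tau> * (4 * s^2))) * of_real (8 / pi * (s * Im ((rho1 s) ^ (2 * k))))) has_integral
    of_real (1^2) * (free_kernel (int k - 1) (1^2 * \<tau>) - free_kernel (int k + 1) (1^2 * \<tau>))) {0..1}"
    using flux_integral[of 1 \<tau> k] by (intro has_integral_eq[OF _ flux_integral[of 1 \<tau> k]]) auto
  then show "((\<lambda>s. cis (- (\<tau> * (4 * s^2))) * of_real (8 / pi * (s * Im (rho1 s ^ (2 * k) * (rho2 c s / of_real c) ^ (2 * 0))))) has_integral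
      free_kernel (int k - 1) \<tau> - free_kernel (int k + 1) \<tau>) {0..1}"
    by simp
qed

section \<open>Initial values of the transmission integrals\<close>

text \<open>A square root of \<open>(1 - z)^2 + 4 c^2 z\<close>, whose zeros lie on the unit circle: both linear factors
  have nonnegative real part on the disc, so the principal roots do not jump.\<close>

definition branch :: "real \<Rightarrow> complex \<Rightarrow> complex" where
  "branch c z = csqrt (1 - z * cis (arccos (1 - 2 * c^2))) * csqrt (1 - z * cnj (cis (arccos (1 - 2 * c^2))))"

lemma branch_square:
  assumes "0 < c" "c \<le> 1"
  shows "(branch c z)^2 = (1 - z)^2 + of_real (4 * c^2) * z"
proof -
  let ?e = "cis (arccos (1 - 2 * c^2))"
  have "c^2 \<le> 1" using assms by (simp add: power_le_one)
  then have "Re ?e = 1 - 2 * c^2" by (simp add: cos_arccos)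
  then have sum: "?e + cnj ?e = of_real (2 - 4 * c^2)" by (simp add: complex_add_cnj)
  have prod: "?e * cnj ?e = 1" by (simp add: cis_cnj cis_mult)
  have expand: "(1 - z * a) * (1 - z * b) = 1 - z * (a + b) + z^2 * (a * b)" for a b
    by (simp add: algebra_simps power2_eq_square)
  have "(branch c z)^2 = (1 - z * ?e) * (1 - z * cnj ?e)"
    by (simp only: branch_def power_mult_distrib power2_csqrt)
  also have "\<dots> = 1 - z * (?e + cnj ?e) + z^2 * (?e * cnj ?e)"
    by (rule expand)
  also have "\<dots> = (1 - z)^2 + of_real (4 * c^2) * z"
    unfolding sum prod by (simp add: algebra_simps power2_eq_square)
  finally show ?thesis .
qed

lemma abs_Im_csqrt_le:
  assumes "0 \<le> Re u"
  shows "\<bar>Im (csqrt u)\<bar> \<le> Re (csqrt u)"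
proof -
  define w where "w = csqrt u"
  have "w^2 = u" "0 \<le> Re w" unfolding w_def by (rule power2_csqrt, rule Re_csqrt)
  then have "(Im w)^2 \<le> (Re w)^2" using assms by (auto simp: Re_power2)
  then have "\<bar>Im w\<bar> \<le> \<bar>Re w\<bar>" by (simp only: abs_le_square_iff)
  then show ?thesis using \<open>0 \<le> Re w\<close> by (simp only: w_def abs_of_nonneg)
qed

lemma branch_factor_Re_nonneg:
  assumes "cmod z \<le> 1" "cmod e = 1"
  shows "0 \<le> Re (1 - z * e)" and "cmod z < 1 \<Longrightarrow> 0 < Re (1 - z * e)"
  using complex_Re_le_cmod[of "z * e"] assms by (auto simp: norm_mult)

text \<open>Principal roots of numbers in the right half plane lie in the sector where the imaginary
  part is at most the real part in absolute value, and the product of two numbers from this sector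
  has nonnegative real part. This later fixes the sign of the square root.\<close>

lemma Re_branch_nonneg:
  assumes "cmod z \<le> 1"
  shows "0 \<le> Re (branch c z)"
proof -
  let ?e = "cis (arccos (1 - 2 * c^2))"
  let ?u = "csqrt (1 - z * ?e)" and ?v = "csqrt (1 - z * cnj ?e)"
  have e: "cmod ?e = 1" "cmod (cnj ?e) = 1" by simp_all
  have le: "\<bar>Im ?u\<bar> \<le> Re ?u" "\<bar>Im ?v\<bar> \<le> Re ?v"
    by (intro abs_Im_csqrt_le branch_factor_Re_nonneg(1) assms e)+
  have "\<bar>Im ?u\<bar> * \<bar>Im ?v\<bar> \<le> Re ?u * Re ?v"
    by (rule mult_mono[OF le(1) le(2) Re_csqrt abs_ge_zero])
  moreover have "Im ?u * Im ?v \<le> \<bar>Im ?u\<bar> * \<bar>Im ?v\<bar>"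
    unfolding abs_mult[symmetric] by (rule abs_ge_self)
  ultimately have "Im ?u * Im ?v \<le> Re ?u * Re ?v" by (rule order_trans[rotated])
  then show ?thesis by (simp only: branch_def times_complex.sel diff_ge_0_iff_ge)
qed

lemma Re_nonneg_imp:
  fixes u :: complex
  assumes "0 \<le> Re u"
  shows "u = 0 \<or> u \<notin> \<real>\<^sub>\<le>\<^sub>0"
proof (cases "u \<in> \<real>\<^sub>\<le>\<^sub>0")
  case True
  then have "Re u = 0" "Im u = 0" using assms by (auto simp: complex_nonpos_Reals_iff)
  then show ?thesis by (simp add: complex_eq_iff)
qed simp

text \<open>The half plane meets the cut only at 0, where continuity follows from the modulus sqrt
  \<bar>z\<bar>. The point 0 matters because the linear factors of \<open>branch\<close> vanish on
  the unit circle.\<close>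

lemma continuous_on_csqrt_right: "continuous_on {u. 0 \<le> Re u} csqrt"
  unfolding continuous_on_eq_continuous_within
proof
  fix u :: complex assume "u \<in> {u. 0 \<le> Re u}"
  then consider "u = 0" | "u \<notin> \<real>\<^sub>\<le>\<^sub>0" using Re_nonneg_imp by auto
  then show "continuous (at u within {u. 0 \<le> Re u}) csqrt"
  proof cases
    case 1
    have "((\<lambda>z. sqrt (cmod z)) \<longlongrightarrow> sqrt (cmod 0)) (at 0 within {u. 0 \<le> Re u})"
      by (intro tendsto_intros)
    then have "((\<lambda>z. norm (csqrt z)) \<longlongrightarrow> 0) (at 0 within {u. 0 \<le> Re u})" by simp
    then have "(csqrt \<longlongrightarrow> 0) (at 0 within {u. 0 \<le> Re u})" by (rule tendsto_norm_zero_cancel)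
    then show ?thesis using 1 by (simp add: continuous_within)
  next
    case 2
    then have "isCont csqrt u" using has_field_derivative_csqrt DERIV_isCont by blast
    then show ?thesis by (rule continuous_at_imp_continuous_at_within)
  qed
qed

lemma continuous_on_branch: "continuous_on (cball 0 1) (branch c)"
proof -
  have "continuous_on (cball 0 1) (\<lambda>z. csqrt (1 - z * e))" if e: "cmod e = 1" for e
  proof (rule continuous_on_compose2[OF continuous_on_csqrt_right])
    show "continuous_on (cball 0 1) (\<lambda>z. 1 - z * e)" by (intro continuous_intros)
    show "(\<lambda>z. 1 - z * e) ` cball 0 1 \<subseteq> {u. 0 \<le> Re u}"
    proof (rule image_subsetI)
      fix z :: complex assume "z \<in> cball 0 1"
      then have "cmod z \<le> 1" by simp
      from branch_factor_Re_nonneg(1)[OF this e] show "1 - z * e \<in> {u. 0 \<le> Re u}" by (rule CollectI)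
    qed
  qed
  then show ?thesis unfolding branch_def by (intro continuous_on_mult) auto
qed

lemma branch_field_differentiable:
  assumes "cmod z < 1"
  shows "branch c field_differentiable at z"
proof -
  have "1 - z * e \<notin> \<real>\<^sub>\<le>\<^sub>0" if "cmod e = 1" for e
    using branch_factor_Re_nonneg(2)[of z e] that assms by (auto simp: complex_nonpos_Reals_iff)
  then have "((\<lambda>z. csqrt (1 - z * e)) has_field_derivative (- e / (2 * csqrt (1 - z * e)))) (at z)" if "cmod e = 1" for e
    using that by (auto intro!: derivative_eq_intros)
  then have "(\<lambda>z. csqrt (1 - z * e)) field_differentiable at z" if "cmod e = 1" for e
    using that unfolding field_differentiable_def by blast
  then show ?thesis unfolding branch_def by (intro field_differentiable_mult) auto
qed

text \<open>On the diameter the two factors are conjugate, so their product is a squared modulus.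
  This makes the contour density real there.\<close>

lemma branch_real:
  assumes "\<bar>x\<bar> \<le> 1"
  shows "branch c (of_real x) \<in> \<real>"
proof -
  let ?e = "cis (arccos (1 - 2 * c^2))"
  let ?u = "1 - of_real x * ?e"
  have "0 \<le> Re ?u" by (intro branch_factor_Re_nonneg) (use assms in auto)
  from Re_nonneg_imp[OF this] consider "?u = 0" | "?u \<notin> \<real>\<^sub>\<le>\<^sub>0" by blast
  then have "csqrt (cnj ?u) = cnj (csqrt ?u)"
  proof cases
    case 1
    then show ?thesis by (simp only: complex_cnj_zero csqrt_0)
  qed (rule cnj_csqrt[symmetric])
  then have "branch c (of_real x) = csqrt ?u * cnj (csqrt ?u)"
    by (simp add: branch_def)
  also have "\<dots> = of_real ((cmod (csqrt ?u))^2)" by (rule complex_norm_square[symmetric])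
  finally show ?thesis by simp
qed

text \<open>At z = rho1^2 on the upper half circle, \<open>branch c z + 1 - z\<close> equals 2 c^2
  rho1 / rho2. The formula is (rho1 + 1 / rho1) \<open>spectral\<close> / z, with odd powers of rho1
  removed so that it extends to the disc; m stands for p + q - 2.\<close>

definition contour_density :: "real \<Rightarrow> nat \<Rightarrow> nat \<Rightarrow> complex \<Rightarrow> complex" where
  "contour_density c m q z = z ^ m * (1 + z) * (branch c z + 1 - z) / (branch c z + 1 - z + of_real (2 * c^2))
     * (of_real (4 * c^2) / (branch c z + 1 - z)^2) ^ q"

text \<open>Away from z = 1 the real part of 1 - z is already positive. At z = 1 the square of
  \<open>branch\<close> is 4 c^2, and the nonnegative real part selects the root 2 c.\<close>

lemma Re_branch_add_pos:
  assumes c: "0 < c" "c \<le> 1" and z: "cmod z \<le> 1"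
  shows "0 < Re (branch c z + 1 - z)"
proof (cases "z = 1")
  case True
  have "branch c 1 ^ 2 = of_real ((2 * c)^2)" using branch_square[OF c, of 1] by simp
  then have "(branch c 1 - of_real (2 * c)) * (branch c 1 + of_real (2 * c)) = 0"
    by (simp add: power2_eq_square algebra_simps)
  then have "branch c 1 = of_real (2 * c) \<or> branch c 1 = - of_real (2 * c)"
    by (auto simp: add_eq_0_iff2)
  then show ?thesis using Re_branch_nonneg[of 1 c] c True by auto
next
  case False
  have "Re z < 1"
  proof (rule ccontr)
    assume "\<not> Re z < 1"
    then have "Re z = 1" using complex_Re_le_cmod[of z] z by simp
    moreover have "(cmod z)^2 \<le> 1" using z by (simp add: power_le_one)
    ultimately have "Re z = 1" "Im z = 0" using cmod_power2[of z] by auto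
    then show False using False by (simp add: complex_eq_iff)
  qed
  then show ?thesis using Re_branch_nonneg[OF z, of c] by simp
qed

lemma contour_denominators_nonzero:
  assumes c: "0 < c" "c \<le> 1" and z: "cmod z \<le> 1"
  shows "branch c z + 1 - z \<noteq> 0" "branch c z + 1 - z + of_real (2 * c^2) \<noteq> 0"
proof -
  have *: "0 < Re (branch c z + 1 - z)" by (rule Re_branch_add_pos[OF assms])
  then show "branch c z + 1 - z \<noteq> 0" by (metis less_irrefl zero_complex.sel(1))
  have "0 < Re (branch c z + 1 - z) + 2 * c^2" using * c by (intro add_pos_pos) auto
  then have "0 < Re (branch c z + 1 - z + of_real (2 * c^2))" by (simp only: plus_complex.sel Re_complex_of_real)
  then show "branch c z + 1 - z + of_real (2 * c^2) \<noteq> 0" by (metis less_irrefl zero_complex.sel(1))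
qed

lemma continuous_on_contour_density:
  assumes c: "0 < c" "c \<le> 1"
  shows "continuous_on (cball 0 1) (contour_density c m q)"
  unfolding contour_density_def
  by (intro continuous_intros continuous_on_branch) (use contour_denominators_nonzero[OF c] in auto)

text \<open>By Cauchy's theorem on the upper half disc the integral over the arc is minus the one
  over the diameter, where the integrand is real. Analyticity is established in the open disc, and
  continuity up to the arc takes care of the zeros of \<open>branch\<close>.\<close>

lemma half_circle_integral_real:
  assumes c: "0 < c" "c \<le> 1"
  shows "Im (integral {0..pi} (\<lambda>t. contour_density c m q (cis t) * (\<i> * cis t))) = 0"
proof -
  let ?H = "contour_density c m q"
  let ?S = "cball 0 1 \<inter> {z. 0 \<le> Im z}"
  let ?arc = "part_circlepath 0 1 0 pi" and ?seg = "linepath (- 1) (1::complex)"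
  have "(?H has_contour_integral 0) (?arc +++ ?seg)"
  proof (rule Cauchy_theorem_convex[where S = ?S and K = "{}"])
    show "continuous_on ?S ?H"
      by (rule continuous_on_subset[OF continuous_on_contour_density[OF c]]) auto
    show "convex ?S" by (intro convex_Int convex_cball) (simp add: convex_halfspace_Im_ge)
    show "?H field_differentiable at z" if "z \<in> interior ?S - {}" for z
    proof -
      have "interior ?S \<subseteq> interior (cball 0 1)" by (intro interior_mono) auto
      then have z: "cmod z < 1" using that by auto
      show ?thesis
        unfolding contour_density_def
        using contour_denominators_nonzero[OF c, of z] z
        by (intro field_differentiable_mult field_differentiable_divide field_differentiable_power
          field_differentiable_add field_differentiable_diff branch_field_differentiable
          field_differentiable_const field_differentiable_ident) auto
    qed
    have "path_image ?arc \<subseteq> ?S"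
      by (auto simp: path_image_part_circlepath' closed_segment_eq_real_ivl sin_ge_zero)
    moreover have "path_image ?seg \<subseteq> ?S"
      using closed_segment_subset[of "-1" ?S 1] \<open>convex ?S\<close> by auto
    ultimately show "path_image (?arc +++ ?seg) \<subseteq> ?S" by (rule subset_path_image_join)
  qed auto
  then have "?H contour_integrable_on (?arc +++ ?seg)" and zero: "contour_integral (?arc +++ ?seg) ?H = 0"
    using has_contour_integral_integrable contour_integral_unique by blast+
  then have int: "?H contour_integrable_on ?arc" "?H contour_integrable_on ?seg"
    using contour_integrable_join[of ?arc ?seg ?H] by simp_all
  define I J where "I = contour_integral ?arc ?H" and "J = contour_integral ?seg ?H"
  have I: "(?H has_contour_integral I) ?arc" and J: "(?H has_contour_integral J) ?seg"
    unfolding I_def J_def using int by (simp_all add: has_contour_integral_integral)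
  have IJ: "I + J = 0"
    using contour_integral_join[OF int] zero by (simp add: I_def J_def)
  have "((\<lambda>x. ?H (of_real x)) has_integral J) {-1..1}"
    using J by (subst (asm) has_contour_integral_linepath_Reals_iff) auto
  then have "((\<lambda>x. Im (?H (of_real x))) has_integral Im J) {-1..1}" by (rule has_integral_Im)
  moreover have "Im (?H (of_real x)) = 0" if "x \<in> {-1..1}" for x
  proof -
    have "?H (of_real x) \<in> \<real>"
      unfolding contour_density_def using branch_real[of x c] that
      by (intro Reals_mult Reals_divide Reals_add Reals_diff Reals_power) auto
    then show ?thesis by (simp add: complex_is_Real_iff)
  qed
  then have "((\<lambda>x. Im (?H (of_real x))) has_integral 0) {-1..1}" by (rule has_integral_is_0)
  ultimately have "Im J = 0" by (rule has_integral_unique)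
  moreover have "((\<lambda>t. ?H (0 + of_real 1 * cis t) * of_real 1 * \<i> * cis t) has_integral I) {0..pi}"
    using I by (subst (asm) has_contour_integral_part_circlepath_iff) auto
  then have "integral {0..pi} (\<lambda>t. ?H (cis t) * (\<i> * cis t)) = I"
    by (simp add: integral_unique mult.assoc)
  ultimately show ?thesis using IJ by (simp add: complex_eq_iff)
qed

text \<open>The right-hand side is 2 rho1 Q with Q^2 = c^2 - s^2, so both sides have the same
  square. Unless Q = 0, the real part of rho1 Q is positive, and the nonnegative real part of
  \<open>branch\<close> rules out the minus sign.\<close>

lemma branch_on_circle:
  assumes c: "0 < c" "c \<le> 1" and s: "0 \<le> s" "s \<le> 1"
  shows "branch c ((rho1 s)^2) = 2 * rho1 s * rho2 c s + 1 - (rho1 s)^2"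
proof -
  let ?r = "rho1 s" and ?R = "branch c ((rho1 s)^2)"
  define Q where "Q = rho2 c s - \<i> * of_real s"
  have r1: "?r^2 - 1 = 2 * \<i> * of_real s * ?r" by (rule rho1_square[OF s])
  have "(rho2 c s / of_real c)^2 - 1 = 2 * \<i> * of_real (s / c) * (rho2 c s / of_real c)"
    by (rule rho2_square[OF c(1) s(1)])
  then have "(rho2 c s)^2 - of_real c ^ 2 = 2 * \<i> * of_real s * rho2 c s"
    using c by (simp add: power2_eq_square field_simps)
  then have Q2: "Q^2 = of_real c ^ 2 - of_real s ^ 2"
    by (simp add: Q_def power2_eq_square algebra_simps)
  have "?R^2 = (?r^2 - 1)^2 + 4 * of_real c ^ 2 * ?r^2"
    unfolding branch_square[OF c] by (simp add: power2_commute)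
  also have "\<dots> = (2 * ?r * Q)^2"
    unfolding r1 by (simp add: power_mult_distrib Q2 algebra_simps)
  finally have "(?R - 2 * ?r * Q) * (?R + 2 * ?r * Q) = 0"
    by (simp add: power2_eq_square algebra_simps)
  then consider "?R = 2 * ?r * Q" | "?R = - (2 * ?r * Q)" by (auto simp: add_eq_0_iff2)
  then have "?R = 2 * ?r * Q"
  proof cases
    case 2
    have R: "0 \<le> Re ?R" using cmod_rho1[OF s] by (intro Re_branch_nonneg) (simp add: norm_power)
    have "Q = 0 \<or> 0 < Re (?r * Q)"
    proof -
      consider "s < c" | "s = c" | "s > c" by linarith
      then show ?thesis
      proof cases
        case 1
        then have "Q = of_real (sqrt (c^2 - s^2))" by (simp add: Q_def rho2_def complex_eq_iff)
        moreover have "s^2 < c^2" using 1 s by (intro power_strict_mono) auto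
        moreover have "c^2 \<le> 1" using c by (simp add: power_le_one)
        ultimately show ?thesis by (simp add: rho1_def)
      next
        case 2
        then show ?thesis by (simp add: Q_def rho2_def complex_eq_iff)
      next
        case 3
        then have "Q = - \<i> * of_real (sqrt (s^2 - c^2))" by (simp add: Q_def rho2_def complex_eq_iff)
        moreover have "c^2 < s^2" using 3 c by (intro power_strict_mono) auto
        ultimately show ?thesis using 3 c by (simp add: rho1_def)
      qed
    qed
    moreover have "Re ?R = - 2 * Re (?r * Q)" using 2 by (simp add: mult.assoc)
    ultimately show ?thesis using R 2 by auto
  qed
  then show ?thesis using r1 by (simp add: Q_def algebra_simps)
qed

lemma spectral_on_circle:
  assumes c: "0 < c" "c \<le> 1" and s: "0 \<le> s" "s \<le> 1" and pq: "p + q = m + 2"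
  shows "(rho1 s + inverse (rho1 s)) * spectral c p q s = contour_density c m q ((rho1 s)^2) * (rho1 s)^2"
proof -
  define r z D where "r = rho1 s" and "z = r^2" and "D = branch c z + 1 - z"
  have r: "r \<noteq> 0" "cmod z \<le> 1" using cmod_rho1[OF s] by (auto simp: r_def z_def norm_power)
  have D: "D \<noteq> 0" "D + of_real (2 * c^2) \<noteq> 0"
    using contour_denominators_nonzero[OF c r(2)] by (auto simp: D_def)
  have b: "branch c z = 2 * r * rho2 c s + 1 - z"
    unfolding z_def r_def by (rule branch_on_circle[OF c s])
  \<comment> \<open>Rationalization: the difference and the sum of \<open>branch\<close> and 1 - z
    multiply to 4 c^2 z, which expresses rho2 through D.\<close>
  have "(branch c z - (1 - z)) * D = of_real (4 * c^2) * z"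
    using branch_square[OF c, of z] by (simp add: D_def power2_eq_square algebra_simps)
  moreover have "branch c z - (1 - z) = 2 * r * rho2 c s" using b by simp
  ultimately have "2 * r * rho2 c s * D = of_real (4 * c^2) * z" by (simp only:)
  then have "2 * (r * (rho2 c s * D)) = 2 * (r * (of_real (2 * c^2) * r))"
    by (simp add: z_def power2_eq_square mult_ac)
  then have "r * (rho2 c s * D) = r * (of_real (2 * c^2) * r)"
    by (simp only: mult_cancel_left) simp
  then have rho2: "rho2 c s = of_real (2 * c^2) * r / D" using r D by (simp add: field_simps)
  have sum: "r + rho2 c s = r * (D + of_real (2 * c^2)) / D" unfolding rho2 using D by (simp add: field_simps)
  have "(rho2 c s / of_real c)^2 = z * (of_real (4 * c^2) / D^2)"
    unfolding rho2 z_def using c D by (simp add: power2_eq_square)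
  then have pw: "(rho2 c s / of_real c) ^ (2 * q) = z ^ q * (of_real (4 * c^2) / D^2) ^ q"
    by (simp only: power_mult power_mult_distrib)
  have "spectral c p q s = z ^ p * (z ^ q * (of_real (4 * c^2) / D^2) ^ q) / (r * (D + of_real (2 * c^2)) / D)"
    unfolding spectral_def pw r_def[symmetric] sum by (simp add: power_mult z_def)
  also have "\<dots> = z ^ m * z * z * D / (r * (D + of_real (2 * c^2))) * (of_real (4 * c^2) / D^2) ^ q"
    using pq by (simp add: mult.assoc[symmetric] power_add[symmetric] del: power_divide)
  finally have "(r + inverse r) * spectral c p q s =
      ((r + inverse r) / r * z) * (z ^ m * D / (D + of_real (2 * c^2)) * (of_real (4 * c^2) / D^2) ^ q) * z"
    using r by simp
  also have "(r + inverse r) / r * z = 1 + z" using r by (simp add: z_def power2_eq_square field_simps)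
  finally show ?thesis
    unfolding contour_density_def r_def[symmetric] z_def[symmetric] D_def[symmetric] by simp
qed

text \<open>With s = sin (t / 2), rho1^2 = cis t runs through the upper half circle and the Jacobian
  cos (t / 2) / 2 is a quarter of rho1 + 1 / rho1. The integral of the density becomes - i / 4 times
  a real number, so its real part vanishes. The bound on p + q prevents a pole at 0; it holds in the
  kernels because source and site are both nonzero.\<close>

lemma transmission_initial:
  assumes c: "0 < c" "c \<le> 1" and pq: "2 \<le> p + q"
  shows "transmission c p q 0 = 0"
proof -
  let ?Y = "spectral c p q"
  define m where "m = p + q - 2"
  have m: "p + q = m + 2" using pq by (simp add: m_def)
  have Yi: "?Y integrable_on {0..1}"
    by (intro integrable_continuous_interval continuous_on_spectral c)
  have "((\<lambda>t. (cos (t / 2) / 2) *\<^sub>R ?Y (sin (t / 2))) has_integral integral {sin (0 / 2)..sin (pi / 2)} ?Y) {0..pi}"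
  proof (rule has_integral_substitution[OF _ _ _ continuous_on_spectral[OF c]])
    show "(\<lambda>t. sin (t / 2)) ` {0..pi} \<subseteq> {0..1}"
      by (auto intro!: sin_ge_zero)
    show "((\<lambda>t. sin (t / 2)) has_real_derivative cos (t / 2) / 2) (at t within {0..pi})" for t
      by (auto intro!: derivative_eq_intros)
  qed auto
  moreover have "(cos (t / 2) / 2) *\<^sub>R ?Y (sin (t / 2)) = of_real (1 / 4) * (- \<i>) * (contour_density c m q (cis t) * (\<i> * cis t))"
    if t: "t \<in> {0..pi}" for t
  proof -
    have s: "0 \<le> sin (t / 2)" "sin (t / 2) \<le> 1" using t by (auto intro: sin_ge_zero)
    have r: "rho1 (sin (t / 2)) = cis (t / 2)" using s t by (simp add: rho1_eq_cis arcsin_sin)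
    have "cis (t / 2) ^ 2 = cis t" by (simp add: Complex.DeMoivre)
    moreover have "cis (t / 2) + inverse (cis (t / 2)) = of_real (2 * cos (t / 2))"
      by (simp add: complex_eq_iff cis_inverse)
    ultimately have "of_real (2 * cos (t / 2)) * ?Y (sin (t / 2)) = contour_density c m q (cis t) * cis t"
      using spectral_on_circle[OF c s m] by (simp only: r)
    then show ?thesis by (simp add: scaleR_conv_of_real field_simps)
  qed
  ultimately have "((\<lambda>t. of_real (1 / 4) * (- \<i>) * (contour_density c m q (cis t) * (\<i> * cis t))) has_integral integral {0..1} ?Y) {0..pi}"
    by (subst (asm) has_integral_cong) auto
  from integral_unique[OF this]
  have "integral {0..1} ?Y = of_real (1 / 4) * (- \<i>) * integral {0..pi} (\<lambda>t. contour_density c m q (cis t) * (\<i> * cis t))"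
    by (simp only: integral_mult_right)
  then have "Re (integral {0..1} ?Y) = 0"
    using half_circle_integral_real[OF c, of m q] by simp
  then have "((\<lambda>s. Re (?Y s)) has_integral 0) {0..1}"
    using has_integral_Re[OF integrable_integral[OF Yi]] by simp
  then have "((\<lambda>s. complex_of_real (4 / pi * Re (?Y s))) has_integral of_real (4 / pi * 0)) {0..1}"
    by (intro has_integral_of_real has_integral_mult_right)
  moreover have "transmission c p q 0 = integral {0..1} (\<lambda>s. complex_of_real (4 / pi * Re (?Y s)))"
    unfolding transmission_def by (simp only: mult_zero_right mult_zero_left cis_zero mult_1_left)
  ultimately show ?thesis by (simp only: integral_unique) simp
qed

section \<open>Bounded solutions\<close>

text \<open>Both coupling conditions together say that the common value at \<open>0\<close> is the weighted mean of
  its neighbours; eliminating it leaves a bounded operator on sequences over the nonzero integers.\<close>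

definition glue :: "real \<Rightarrow> real \<Rightarrow> (int \<Rightarrow> complex) \<Rightarrow> int \<Rightarrow> complex" where
  "glue \<alpha> \<beta> w j = (if j = 0 then (of_real \<alpha> * w (-1) + of_real \<beta> * w 1) / of_real (\<alpha> + \<beta>) else w j)"

definition hop :: "real \<Rightarrow> real \<Rightarrow> (int \<Rightarrow> complex) \<Rightarrow> int \<Rightarrow> complex" where
  "hop \<alpha> \<beta> w j = of_real (if j < 0 then \<alpha> else \<beta>) * discrete_laplacian (glue \<alpha> \<beta> w) j"

text \<open>The class contains both the square-summable solutions and the kernels, and bounds
  uniform in the site and locally uniform in time still force uniqueness. The equation is imposed
  for t \<noteq> 0 as in the system; continuity carries a solution across t = 0.\<close>

definition bdd_solution :: "real \<Rightarrow> real \<Rightarrow> (real \<Rightarrow> int \<Rightarrow> complex) \<Rightarrow> bool" where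
  "bdd_solution \<alpha> \<beta> w \<longleftrightarrow>
     (\<forall>j. j \<noteq> 0 \<longrightarrow> continuous_on UNIV (\<lambda>t. w t j)) \<and>
     (\<forall>T. \<exists>M. \<forall>t j. \<bar>t\<bar> \<le> T \<and> j \<noteq> 0 \<longrightarrow> cmod (w t j) \<le> M) \<and>
     (\<forall>t j. t \<noteq> 0 \<and> j \<noteq> 0 \<longrightarrow> ((\<lambda>s. w s j) has_vector_derivative \<i> * hop \<alpha> \<beta> (w t) j) (at t))"

lemma bdd_solution_bound:
  assumes "bdd_solution \<alpha> \<beta> w"
  shows "\<exists>M. \<forall>t j. \<bar>t\<bar> \<le> T \<and> j \<noteq> 0 \<longrightarrow> cmod (w t j) \<le> M"
  using assms unfolding bdd_solution_def by (elim conjE) (erule spec)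

lemma cmod_glue_le:
  assumes ab: "0 < \<alpha>" "0 < \<beta>" and B: "\<And>j. j \<noteq> 0 \<Longrightarrow> cmod (w j) \<le> B"
  shows "cmod (glue \<alpha> \<beta> w j) \<le> B"
proof (cases "j = 0")
  case True
  have "cmod (of_real \<alpha> * w (-1) + of_real \<beta> * w 1) \<le> \<alpha> * B + \<beta> * B"
    using B[of "-1"] B[of 1] ab
    by (intro order_trans[OF norm_triangle_ineq add_mono]) (auto simp: norm_mult intro!: mult_left_mono)
  then show ?thesis
    using True ab by (simp add: glue_def norm_divide divide_le_eq algebra_simps flip: of_real_add)
qed (use B in \<open>simp add: glue_def\<close>)

lemma cmod_hop_le:
  assumes ab: "0 < \<alpha>" "0 < \<beta>" and B: "\<And>j. j \<noteq> 0 \<Longrightarrow> cmod (w j) \<le> B"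
  shows "cmod (hop \<alpha> \<beta> w j) \<le> 4 * (\<alpha> + \<beta>) * B"
proof -
  let ?g = "glue \<alpha> \<beta> w"
  have B0: "0 \<le> B" using B[of 1] norm_ge_zero[of "w 1"] by linarith
  have g: "cmod (?g k) \<le> B" for k by (rule cmod_glue_le[OF ab B])
  have "cmod (?g (j + 1) - 2 * ?g j + ?g (j - 1)) \<le> cmod (?g (j + 1)) + cmod (2 * ?g j) + cmod (?g (j - 1))"
    using norm_triangle_ineq[of "?g (j + 1) - 2 * ?g j" "?g (j - 1)"] norm_triangle_ineq4[of "?g (j + 1)" "2 * ?g j"]
    by linarith
  also have "\<dots> \<le> 4 * B" using g[of "j + 1"] g[of j] g[of "j - 1"] by (simp add: norm_mult)
  finally have "cmod (discrete_laplacian ?g j) \<le> 4 * B" by (simp add: discrete_laplacian_def)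
  then have "cmod (hop \<alpha> \<beta> w j) \<le> (\<alpha> + \<beta>) * (4 * B)"
    unfolding hop_def norm_mult using ab B0 by (intro mult_mono) auto
  then show ?thesis by (simp add: mult_ac)
qed

lemma glue_cmult: "glue \<alpha> \<beta> (\<lambda>j. c * x j) j = c * glue \<alpha> \<beta> x j"
  by (simp add: glue_def algebra_simps)

lemma glue_add: "glue \<alpha> \<beta> (\<lambda>j. x j + y j) j = glue \<alpha> \<beta> x j + glue \<alpha> \<beta> y j"
  by (simp add: glue_def algebra_simps flip: add_divide_distrib)

lemma hop_cmult: "hop \<alpha> \<beta> (\<lambda>j. c * x j) j = c * hop \<alpha> \<beta> x j"
  by (simp add: hop_def discrete_laplacian_def glue_cmult algebra_simps)

lemma hop_add: "hop \<alpha> \<beta> (\<lambda>j. x j + y j) j = hop \<alpha> \<beta> x j + hop \<alpha> \<beta> y j"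
  by (simp add: hop_def discrete_laplacian_def glue_add algebra_simps)

lemma hop_sums:
  assumes "\<And>k. k \<noteq> 0 \<Longrightarrow> (\<lambda>n. f n k) sums w k"
  shows "(\<lambda>n. hop \<alpha> \<beta> (f n) j) sums hop \<alpha> \<beta> w j"
proof -
  have "(\<lambda>n. glue \<alpha> \<beta> (f n) k) sums glue \<alpha> \<beta> w k" for k
    by (cases "k = 0") (auto simp: glue_def intro!: assms sums_divide sums_add sums_mult)
  then show ?thesis
    unfolding hop_def discrete_laplacian_def by (intro sums_mult sums_add sums_diff)
qed

section \<open>Linear combinations and stability of bounded solutions\<close>

lemma bdd_solution_add:
  assumes "bdd_solution \<alpha> \<beta> x" "bdd_solution \<alpha> \<beta> y"
  shows "bdd_solution \<alpha> \<beta> (\<lambda>t j. x t j + y t j)"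
  unfolding bdd_solution_def
proof (intro conjI allI impI)
  fix T
  obtain M where M: "\<And>t j. \<bar>t\<bar> \<le> T \<Longrightarrow> j \<noteq> 0 \<Longrightarrow> cmod (x t j) \<le> M"
    using bdd_solution_bound[OF assms(1), of T] by blast
  obtain N where N: "\<And>t j. \<bar>t\<bar> \<le> T \<Longrightarrow> j \<noteq> 0 \<Longrightarrow> cmod (y t j) \<le> N"
    using bdd_solution_bound[OF assms(2), of T] by blast
  have "cmod (x t j + y t j) \<le> M + N" if "\<bar>t\<bar> \<le> T \<and> j \<noteq> 0" for t j
    using that by (intro order_trans[OF norm_triangle_ineq add_mono] M N) auto
  then show "\<exists>M. \<forall>t j. \<bar>t\<bar> \<le> T \<and> j \<noteq> 0 \<longrightarrow> cmod (x t j + y t j) \<le> M" by blast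
next
  fix t :: real and j :: int assume "t \<noteq> 0 \<and> j \<noteq> 0"
  then show "((\<lambda>s. x s j + y s j) has_vector_derivative \<i> * hop \<alpha> \<beta> (\<lambda>j. x t j + y t j) j) (at t)"
    using assms unfolding bdd_solution_def
    by (auto simp: hop_add distrib_left intro!: has_vector_derivative_add)
qed (use assms in \<open>auto simp: bdd_solution_def intro!: continuous_on_add\<close>)

lemma bdd_solution_cmult:
  assumes "bdd_solution \<alpha> \<beta> x"
  shows "bdd_solution \<alpha> \<beta> (\<lambda>t j. c * x t j)"
  unfolding bdd_solution_def
proof (intro conjI allI impI)
  fix T
  obtain M where "\<And>t j. \<bar>t\<bar> \<le> T \<Longrightarrow> j \<noteq> 0 \<Longrightarrow> cmod (x t j) \<le> M"
    using bdd_solution_bound[OF assms, of T] by blast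
  then have "cmod (c * x t j) \<le> cmod c * M" if "\<bar>t\<bar> \<le> T \<and> j \<noteq> 0" for t j
    using that by (simp add: norm_mult mult_left_mono)
  then show "\<exists>M. \<forall>t j. \<bar>t\<bar> \<le> T \<and> j \<noteq> 0 \<longrightarrow> cmod (c * x t j) \<le> M" by blast
next
  fix t :: real and j :: int assume "t \<noteq> 0 \<and> j \<noteq> 0"
  then have "((\<lambda>s. c * x s j) has_vector_derivative c * (\<i> * hop \<alpha> \<beta> (x t) j)) (at t)"
    using assms unfolding bdd_solution_def by (intro has_vector_derivative_mult_right) auto
  then show "((\<lambda>s. c * x s j) has_vector_derivative \<i> * hop \<alpha> \<beta> (\<lambda>j. c * x t j) j) (at t)"
    by (simp add: hop_cmult mult_ac)
qed (use assms in \<open>auto simp: bdd_solution_def intro!: continuous_intros\<close>)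

lemma bdd_solution_diff:
  assumes "bdd_solution \<alpha> \<beta> x" "bdd_solution \<alpha> \<beta> y"
  shows "bdd_solution \<alpha> \<beta> (\<lambda>t j. x t j - y t j)"
  using bdd_solution_add[OF assms(1) bdd_solution_cmult[OF assms(2), of "- 1"]] by simp

lemma bdd_solution_sum:
  assumes "finite F" "\<And>k. k \<in> F \<Longrightarrow> bdd_solution \<alpha> \<beta> (G k)"
  shows "bdd_solution \<alpha> \<beta> (\<lambda>t j. \<Sum>k\<in>F. \<phi> k * G k t j)"
  using assms
proof (induction F rule: finite_induct)
  case empty
  show ?case
    by (auto simp: bdd_solution_def hop_def discrete_laplacian_def glue_def intro: exI[of _ 0])
next
  case (insert k F)
  then have "bdd_solution \<alpha> \<beta> (\<lambda>t j. \<phi> k * G k t j + (\<Sum>k\<in>F. \<phi> k * G k t j))"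
    by (intro bdd_solution_add bdd_solution_cmult) auto
  then show ?case using insert by simp
qed

text \<open>Gronwall's inequality in the supremum norm, by iterating the integrated equation; the
  a priori bound \<open>M\<close> only enters the remainder, which tends to \<open>0\<close>.\<close>

lemma bdd_solution_stability:
  assumes ab: "0 < \<alpha>" "0 < \<beta>" and w: "bdd_solution \<alpha> \<beta> w"
    and eps: "\<And>j. j \<noteq> 0 \<Longrightarrow> cmod (w 0 j) \<le> \<epsilon>" and j: "j \<noteq> 0"
  shows "cmod (w t j) \<le> \<epsilon> * exp (4 * (\<alpha> + \<beta>) * \<bar>t\<bar>)"
proof -
  define C where "C = 4 * (\<alpha> + \<beta>)"
  have C: "C \<ge> 0" using ab by (simp add: C_def)
  have eps0: "0 \<le> \<epsilon>" using eps[of 1] norm_ge_zero[of "w 0 1"] by linarith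
  obtain M where M: "\<And>s k. \<bar>s\<bar> \<le> \<bar>t\<bar> \<Longrightarrow> k \<noteq> 0 \<Longrightarrow> cmod (w s k) \<le> M"
    using bdd_solution_bound[OF w, of "\<bar>t\<bar>"] by blast
  \<comment> \<open>The bound after N iterations: a partial sum of \<epsilon> exp (C r) plus the a
    priori remainder. The derivative of stage N + 1 is C times stage N, which matches the operator
    bound for \<open>hop\<close>.\<close>
  define b where "b N r = \<epsilon> * (\<Sum>m<N. (C * r) ^ m / fact m) + M * ((C * r) ^ N / fact N)" for N :: nat and r :: real
  have pd: "((\<lambda>r. (C * r) ^ Suc m / fact (Suc m)) has_real_derivative C * ((C * r) ^ m / fact m)) (at r)" for m r
  proof -
    have "((\<lambda>r. (C * r) ^ Suc m / fact (Suc m)) has_real_derivative ((1 + real m) * (C * (C * r) ^ m)) / fact (Suc m)) (at r)"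
      by (intro DERIV_cdivide DERIV_power_Suc DERIV_cmult_Id)
    also have "((1 + real m) * (C * (C * r) ^ m)) / fact (Suc m) = C * ((C * r) ^ m / fact m)"
      by simp
    finally show ?thesis .
  qed
  have bd: "(b (Suc N) has_real_derivative C * b N r) (at r)" for N r
  proof -
    have "b (Suc N) = (\<lambda>r. \<epsilon> * (1 + (\<Sum>m<N. (C * r) ^ Suc m / fact (Suc m))) + M * ((C * r) ^ Suc N / fact (Suc N)))"
      unfolding b_def by (simp only: sum.lessThan_Suc_shift) simp
    moreover have "((\<lambda>r. \<epsilon> * (1 + (\<Sum>m<N. (C * r) ^ Suc m / fact (Suc m))) + M * ((C * r) ^ Suc N / fact (Suc N)))
      has_real_derivative \<epsilon> * (0 + (\<Sum>m<N. C * ((C * r) ^ m / fact m))) + M * (C * ((C * r) ^ N / fact N))) (at r)"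
      by (intro DERIV_add DERIV_cmult DERIV_const DERIV_sum pd)
    ultimately show ?thesis
      by (simp add: b_def sum_distrib_left algebra_simps)
  qed
  have b0: "b (Suc N) 0 = \<epsilon>" for N
    unfolding b_def by (simp only: sum.lessThan_Suc_shift) simp
  \<comment> \<open>\<sigma> is the direction of time: both half lines are treated by integrating
    outwards from 0, so that the equation is used only at nonzero times.\<close>
  have bound: "cmod (w (\<sigma> * r) k) \<le> b N r"
    if "\<sigma> = 1 \<or> \<sigma> = - 1" "0 \<le> r" "r \<le> \<bar>t\<bar>" "k \<noteq> 0" for \<sigma> r k N
    using that
  proof (induction N arbitrary: r k)
    case 0
    then show ?case using M[of "\<sigma> * r" k] by (auto simp: b_def)
  next
    case (Suc N)
    show ?case
    proof (cases "r = 0")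
      case True
      then show ?thesis using eps Suc.prems b0 by simp
    next
      case False
      have "cmod (w (\<sigma> * r) k - w (\<sigma> * 0) k) \<le> b (Suc N) r - b (Suc N) 0"
      proof (rule differentiable_bound_general)
        show "continuous_on {0..r} (\<lambda>r. w (\<sigma> * r) k)"
          using w Suc.prems(4) unfolding bdd_solution_def
          by (intro continuous_on_compose2[where f = "\<lambda>r. \<sigma> * r" and g = "\<lambda>t. w t k"]) (auto intro!: continuous_intros)
        show "continuous_on {0..r} (b (Suc N))"
          using bd by (intro continuous_at_imp_continuous_on ballI DERIV_isCont)
        fix x assume x: "0 < x" "x < r"
        show "(b (Suc N) has_vector_derivative C * b N x) (at x)"
          using bd by (simp add: has_real_derivative_iff_has_vector_derivative)
        have "((\<lambda>s. w s k) has_vector_derivative \<i> * hop \<alpha> \<beta> (w (\<sigma> * x)) k) (at (\<sigma> * x))"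
          using w Suc.prems x unfolding bdd_solution_def by auto
        moreover have "((\<lambda>r. \<sigma> * r) has_vector_derivative \<sigma>) (at x)"
          by (auto intro!: derivative_eq_intros simp: has_real_derivative_iff_has_vector_derivative[symmetric])
        ultimately show "((\<lambda>r. w (\<sigma> * r) k) has_vector_derivative \<sigma> *\<^sub>R (\<i> * hop \<alpha> \<beta> (w (\<sigma> * x)) k)) (at x)"
          using vector_diff_chain_at[of "\<lambda>r. \<sigma> * r" \<sigma> x "\<lambda>s. w s k"] by (simp add: o_def)
        have "cmod (hop \<alpha> \<beta> (w (\<sigma> * x)) k) \<le> C * b N x"
          unfolding C_def by (rule cmod_hop_le[OF ab Suc.IH]) (use Suc.prems x in auto)
        then show "norm (\<sigma> *\<^sub>R (\<i> * hop \<alpha> \<beta> (w (\<sigma> * x)) k)) \<le> C * b N x"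
          using Suc.prems by (auto simp: norm_mult)
      qed (use False Suc.prems in auto)
      moreover have "cmod (w (\<sigma> * 0) k) \<le> b (Suc N) 0" using eps[OF Suc.prems(4)] b0 by simp
      ultimately show ?thesis
        using norm_triangle_ineq2[of "w (\<sigma> * r) k" "w (\<sigma> * 0) k"] by linarith
    qed
  qed
  have "cmod (w t j) \<le> b N \<bar>t\<bar>" for N
    using bound[of 1 "\<bar>t\<bar>" j N] bound[of "-1" "\<bar>t\<bar>" j N] j by (cases "t \<ge> 0") auto
  moreover have "(\<lambda>N. b N \<bar>t\<bar>) \<longlonglongrightarrow> \<epsilon> * exp (C * \<bar>t\<bar>) + M * 0"
  proof -
    have s: "(\<lambda>m. (C * \<bar>t\<bar>) ^ m / fact m) sums exp (C * \<bar>t\<bar>)"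
      using exp_converges[of "C * \<bar>t\<bar>"] by (simp add: divide_inverse mult.commute)
    then have "(\<lambda>N. \<Sum>m<N. (C * \<bar>t\<bar>) ^ m / fact m) \<longlonglongrightarrow> exp (C * \<bar>t\<bar>)" by (simp add: sums_def)
    moreover have "(\<lambda>m. (C * \<bar>t\<bar>) ^ m / fact m) \<longlonglongrightarrow> 0"
      using s by (intro summable_LIMSEQ_zero) (auto simp: sums_iff)
    ultimately show ?thesis unfolding b_def by (intro tendsto_intros)
  qed
  ultimately have "cmod (w t j) \<le> \<epsilon> * exp (C * \<bar>t\<bar>) + M * 0"
    by (intro LIMSEQ_le_const) auto
  then show ?thesis by (simp add: C_def)
qed

section \<open>The propagator on square-summable sequences\<close>

text \<open>Membership together with a norm bound, phrased through finite partial sums, so that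
  triangle inequalities and pointwise limits pass through \<open>L2_set\<close> without summability
  obligations.\<close>

definition l2_bounded :: "(int \<Rightarrow> complex) \<Rightarrow> real \<Rightarrow> bool" where
  "l2_bounded w B \<longleftrightarrow> 0 \<le> B \<and> (\<forall>S. finite S \<and> S \<subseteq> nonzero_ints \<longrightarrow> L2_set (\<lambda>j. cmod (w j)) S \<le> B)"

lemma l2_boundedD: "l2_bounded w B \<Longrightarrow> finite S \<Longrightarrow> S \<subseteq> nonzero_ints \<Longrightarrow> L2_set (\<lambda>j. cmod (w j)) S \<le> B"
  by (simp add: l2_bounded_def)

lemma l2_bounded_mono: "l2_bounded w A \<Longrightarrow> A \<le> B \<Longrightarrow> l2_bounded w B"
  unfolding l2_bounded_def by fastforce

lemma l2_bounded_iff_sum: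
  "l2_bounded w B \<longleftrightarrow> 0 \<le> B \<and> (\<forall>S. finite S \<and> S \<subseteq> nonzero_ints \<longrightarrow> (\<Sum>j\<in>S. (cmod (w j))^2) \<le> B^2)"
proof -
  have "L2_set (\<lambda>j. cmod (w j)) S \<le> B \<longleftrightarrow> (\<Sum>j\<in>S. (cmod (w j))^2) \<le> B^2" if "0 \<le> B" for S
  proof -
    have "sqrt (\<Sum>j\<in>S. (cmod (w j))^2) \<le> sqrt (B^2) \<longleftrightarrow> (\<Sum>j\<in>S. (cmod (w j))^2) \<le> B^2"
      by (rule real_sqrt_le_iff)
    then show ?thesis using that by (simp add: L2_set_def)
  qed
  then show ?thesis by (auto simp: l2_bounded_def)
qed

lemma l2_bounded_imp_l2:
  assumes "l2_bounded w B"
  shows "w \<in> l2" "l2_norm w \<le> B"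
proof -
  have B: "0 \<le> B" "\<And>S. finite S \<Longrightarrow> S \<subseteq> nonzero_ints \<Longrightarrow> (\<Sum>j\<in>S. (cmod (w j))^2) \<le> B^2"
    using assms by (auto simp: l2_bounded_iff_sum)
  have s: "(\<lambda>j. (cmod (w j))^2) summable_on nonzero_ints"
    by (rule nonneg_bdd_above_summable_on) (auto intro!: bdd_aboveI2[of _ _ "B^2"] B)
  then show "w \<in> l2" by (simp add: l2_def)
  have "(\<Sum>\<^sub>\<infinity>j\<in>nonzero_ints. (cmod (w j))^2) \<le> B^2"
    by (rule infsum_le_finite_sums[OF s]) (rule B)
  then show "l2_norm w \<le> B" unfolding l2_norm_def using B(1) by (intro real_le_lsqrt infsum_nonneg) auto
qed

lemma l2_imp_bounded:
  assumes "w \<in> l2"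
  shows "l2_bounded w (l2_norm w)"
  unfolding l2_bounded_iff_sum
proof (intro conjI allI impI)
  have nn: "0 \<le> (\<Sum>\<^sub>\<infinity>j\<in>nonzero_ints. (cmod (w j))^2)" by (intro infsum_nonneg) auto
  then show "0 \<le> l2_norm w" by (simp add: l2_norm_def)
  fix S assume S: "finite S \<and> S \<subseteq> nonzero_ints"
  have "(\<Sum>j\<in>S. (cmod (w j))^2) \<le> (\<Sum>\<^sub>\<infinity>j\<in>nonzero_ints. (cmod (w j))^2)"
    using assms S by (intro finite_sum_le_infsum) (auto simp: l2_def)
  then show "(\<Sum>j\<in>S. (cmod (w j))^2) \<le> (l2_norm w)^2" using nn by (simp add: l2_norm_def)
qed

lemma l2_bounded_cmod_le:
  assumes "l2_bounded w B" "j \<noteq> 0"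
  shows "cmod (w j) \<le> B"
  using l2_boundedD[OF assms(1), of "{j}"] assms(2) by (simp add: L2_set_def)

lemma l2_bounded_cmult: "l2_bounded w B \<Longrightarrow> l2_bounded (\<lambda>j. c * w j) (cmod c * B)"
  by (auto simp: l2_bounded_def norm_mult mult_left_mono simp flip: L2_set_right_distrib)

lemma l2_bounded_diff:
  assumes "l2_bounded x A" "l2_bounded y B"
  shows "l2_bounded (\<lambda>j. x j - y j) (A + B)"
  unfolding l2_bounded_def
proof (intro conjI allI impI)
  show "0 \<le> A + B" using assms by (simp add: l2_bounded_def)
  fix S assume S: "finite S \<and> S \<subseteq> nonzero_ints"
  have "L2_set (\<lambda>j. cmod (x j - y j)) S \<le> L2_set (\<lambda>j. cmod (x j) + cmod (y j)) S"
    by (intro L2_set_mono norm_triangle_ineq4) auto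
  also have "\<dots> \<le> L2_set (\<lambda>j. cmod (x j)) S + L2_set (\<lambda>j. cmod (y j)) S" by (rule L2_set_triangle_ineq)
  also have "\<dots> \<le> A + B" using assms S by (intro add_mono l2_boundedD) auto
  finally show "L2_set (\<lambda>j. cmod (x j - y j)) S \<le> A + B" .
qed

text \<open>On a fixed finite set of sites \<open>L2_set\<close> is continuous under pointwise
  convergence, so the triangle inequality for partial sums survives the limit.\<close>

lemma l2_bounded_suminf:
  assumes x: "\<And>n. l2_bounded (x n) (c n)" and c: "c sums C"
    and y: "\<And>j. j \<noteq> 0 \<Longrightarrow> (\<lambda>n. x n j) sums y j"
  shows "l2_bounded y C"
  unfolding l2_bounded_def
proof (intro conjI allI impI)
  have c0: "0 \<le> c n" for n using x[of n] by (simp add: l2_bounded_def)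
  have partial: "sum c {..<N} \<le> C" for N
    using sum_le_suminf[of c "{..<N}"] c c0 by (simp add: sums_iff)
  from partial[of 0] show "0 \<le> C" by simp
  fix S assume S: "finite S \<and> S \<subseteq> nonzero_ints"
  have "L2_set (\<lambda>j. cmod (\<Sum>n<N. x n j)) S \<le> sum c {..<N}" for N
  proof (induction N)
    case (Suc N)
    have "L2_set (\<lambda>j. cmod (\<Sum>n<Suc N. x n j)) S \<le> L2_set (\<lambda>j. cmod (\<Sum>n<N. x n j) + cmod (x N j)) S"
      by (intro L2_set_mono) (auto intro: norm_triangle_ineq)
    also have "\<dots> \<le> L2_set (\<lambda>j. cmod (\<Sum>n<N. x n j)) S + L2_set (\<lambda>j. cmod (x N j)) S"
      by (rule L2_set_triangle_ineq)
    also have "\<dots> \<le> sum c {..<N} + c N" using x S by (intro add_mono[OF Suc] l2_boundedD) auto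
    finally show ?case by simp
  qed (simp add: L2_set_def)
  then have "L2_set (\<lambda>j. cmod (\<Sum>n<N. x n j)) S \<le> C" for N by (rule order_trans[OF _ partial])
  moreover have "(\<lambda>N. L2_set (\<lambda>j. cmod (\<Sum>n<N. x n j)) S) \<longlonglongrightarrow> L2_set (\<lambda>j. cmod (y j)) S"
    unfolding L2_set_def
  proof (intro tendsto_intros)
    fix j assume "j \<in> S"
    then show "(\<lambda>N. \<Sum>n<N. x n j) \<longlonglongrightarrow> y j" using y[of j] S by (auto simp: sums_def)
  qed
  ultimately show "L2_set (\<lambda>j. cmod (y j)) S \<le> C" by (intro LIMSEQ_le_const2) auto
qed

text \<open>At j = 1 and j = -1 the Laplacian sees the glued value, which is bounded by the values
  at j and - j: hence the third copy of \<open>e w j\<close> and the reflected term. With e set to 0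
  at the interface, every summand is e composed with an injective map of sites, uniformly in
  j.\<close>

lemma cmod_hop_le_neighbours:
  assumes ab: "0 < \<alpha>" "0 < \<beta>" and j: "j \<noteq> 0"
  defines "e \<equiv> \<lambda>w k. if k = (0::int) then 0 else cmod (w k)"
  shows "cmod (hop \<alpha> \<beta> w j) \<le> (\<alpha> + \<beta>) * (e w (j + 1) + 3 * e w j + e w (j - 1) + e w (- j))"
proof -
  let ?g = "glue \<alpha> \<beta> w"
  have g0: "cmod (?g 0) \<le> cmod (w (-1)) + cmod (w 1)"
  proof -
    have "cmod (of_real \<alpha> * w (-1) + of_real \<beta> * w 1) \<le> \<alpha> * cmod (w (-1)) + \<beta> * cmod (w 1)"
      using ab by (intro order_trans[OF norm_triangle_ineq]) (auto simp: norm_mult)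
    also have "\<dots> \<le> (\<alpha> + \<beta>) * cmod (w (-1)) + (\<alpha> + \<beta>) * cmod (w 1)"
      using ab by (intro add_mono mult_right_mono) auto
    finally have "cmod (of_real \<alpha> * w (-1) + of_real \<beta> * w 1) \<le> (cmod (w (-1)) + cmod (w 1)) * (\<alpha> + \<beta>)"
      by (simp only: distrib_left mult.commute)
    moreover have "cmod (of_real (\<alpha> + \<beta>)) = \<alpha> + \<beta>" using ab by (simp only: norm_of_real)
    ultimately show ?thesis
      unfolding glue_def norm_divide using ab by (simp only: simp_thms if_True norm_divide pos_divide_le_eq add_pos_pos)
  qed
  have tri: "cmod (discrete_laplacian ?g j) \<le> cmod (?g (j + 1)) + 2 * cmod (?g j) + cmod (?g (j - 1))"
  proof -
    have "cmod (2 * ?g j) = 2 * cmod (?g j)" by (simp add: norm_mult)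
    then show ?thesis
    unfolding discrete_laplacian_def
    using norm_triangle_ineq[of "?g (j + 1) - 2 * ?g j" "?g (j - 1)"] norm_triangle_ineq4[of "?g (j + 1)" "2 * ?g j"]
    by linarith
  qed
  have e0: "0 \<le> e w k" for k by (simp add: e_def)
  have gk: "cmod (?g k) = e w k" if "k \<noteq> 0" for k using that by (simp add: glue_def e_def)
  have "cmod (?g (j + 1)) + 2 * cmod (?g j) + cmod (?g (j - 1)) \<le> e w (j + 1) + 3 * e w j + e w (j - 1) + e w (- j)"
  proof -
    consider "j = 1" | "j = -1" | "j + 1 \<noteq> 0" "j - 1 \<noteq> 0" by linarith
    then show ?thesis
    proof cases
      case 1
      then show ?thesis using g0 gk[of 1] gk[of 2] by (simp add: e_def)
    next
      case 2
      then show ?thesis using g0 gk[of "-1"] gk[of "-2"] by (simp add: e_def)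
    next
      case 3
      then show ?thesis using gk[of "j + 1"] gk[OF j] gk[of "j - 1"] e0[of j] e0[of "- j"] by linarith
    qed
  qed
  with tri have h1: "cmod (discrete_laplacian ?g j) \<le> e w (j + 1) + 3 * e w j + e w (j - 1) + e w (- j)" by linarith
  have h2: "cmod (of_real (if j < 0 then \<alpha> else \<beta>)) \<le> \<alpha> + \<beta>" using ab by simp
  show ?thesis
    unfolding hop_def norm_mult by (rule mult_mono[OF h2 h1]) (use ab in auto)
qed

text \<open>Cauchy-Schwarz with the vector (1, 3, 1, 1) gives the factor 12, and each of the four
  injective maps keeps the sum of squares below B^2: 4 * 12 = 48 \<le> 7^2.\<close>

lemma l2_bounded_hop:
  assumes ab: "0 < \<alpha>" "0 < \<beta>" and w: "l2_bounded w B"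
  shows "l2_bounded (hop \<alpha> \<beta> w) (7 * (\<alpha> + \<beta>) * B)"
  unfolding l2_bounded_iff_sum
proof (intro conjI allI impI)
  show "0 \<le> 7 * (\<alpha> + \<beta>) * B" using ab w by (simp add: l2_bounded_def)
  define e where "e k = (if k = (0::int) then 0 else cmod (w k))" for k
  let ?\<gamma> = "\<alpha> + \<beta>"
  fix S assume S: "finite S \<and> S \<subseteq> nonzero_ints"
  have eB: "(\<Sum>j\<in>S. (e (\<pi> j))^2) \<le> B^2" if "inj \<pi>" for \<pi>
  proof -
    have "(\<Sum>j\<in>S. (e (\<pi> j))^2) = (\<Sum>k\<in>\<pi> ` S. (e k)^2)"
      using that by (subst sum.reindex) (auto intro: inj_on_subset)
    also have "\<dots> = (\<Sum>k\<in>\<pi> ` S - {0}. (cmod (w k))^2)"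
    proof (rule sum.mono_neutral_cong_right)
      show "finite (\<pi> ` S)" using S by simp
    qed (auto simp: e_def)
    also have "\<dots> \<le> B^2"
    proof -
      have "finite (\<pi> ` S - {0})" "\<pi> ` S - {0} \<subseteq> nonzero_ints" using S by auto
      then show ?thesis using w unfolding l2_bounded_iff_sum by blast
    qed
    finally show ?thesis .
  qed
  have pt: "(cmod (hop \<alpha> \<beta> w j))^2 \<le> 12 * ?\<gamma>^2 * ((e (j + 1))^2 + (e j)^2 + (e (j - 1))^2 + (e (- j))^2)" if "j \<in> S" for j
  proof -
    have "cmod (hop \<alpha> \<beta> w j) \<le> ?\<gamma> * (e (j + 1) + 3 * e j + e (j - 1) + e (- j))"
      using cmod_hop_le_neighbours[OF ab, of j w] that S by (auto simp: e_def)
    then have "(cmod (hop \<alpha> \<beta> w j))^2 \<le> (?\<gamma> * (e (j + 1) + 3 * e j + e (j - 1) + e (- j)))^2"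
      by (intro power_mono) auto
    also have "\<dots> = ?\<gamma>^2 * (e (j + 1) + 3 * e j + e (j - 1) + e (- j))^2" by (rule power_mult_distrib)
    also have "\<dots> \<le> ?\<gamma>^2 * (12 * ((e (j + 1))^2 + (e j)^2 + (e (j - 1))^2 + (e (- j))^2))"
    proof (rule mult_left_mono)
      \<comment> \<open>Lagrange's identity for the vectors (1, 3, 1, 1) and (a, b, c, d).\<close>
      have sos: "(a + 3 * b + c + d)^2 + ((3 * a - b)^2 + (a - c)^2 + (a - d)^2 + (b - 3 * c)^2 + (b - 3 * d)^2 + (c - d)^2)
         = 12 * (a^2 + b^2 + c^2 + d^2)" for a b c d :: real
        by (simp add: power2_eq_square algebra_simps)
      have "(a + 3 * b + c + d)^2 \<le> 12 * (a^2 + b^2 + c^2 + d^2)" for a b c d :: real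
        unfolding sos[symmetric] by simp
      then show "(e (j + 1) + 3 * e j + e (j - 1) + e (- j))^2 \<le> 12 * ((e (j + 1))^2 + (e j)^2 + (e (j - 1))^2 + (e (- j))^2)"
        .
    qed auto
    finally show ?thesis by (simp only: mult_ac)
  qed
  have "(\<Sum>j\<in>S. (cmod (hop \<alpha> \<beta> w j))^2) \<le> (\<Sum>j\<in>S. 12 * ?\<gamma>^2 * ((e (j + 1))^2 + (e j)^2 + (e (j - 1))^2 + (e (- j))^2))"
    by (intro sum_mono pt)
  also have "\<dots> = 12 * ?\<gamma>^2 * ((\<Sum>j\<in>S. (e (j + 1))^2) + (\<Sum>j\<in>S. (e j)^2) + (\<Sum>j\<in>S. (e (j - 1))^2) + (\<Sum>j\<in>S. (e (- j))^2))"
    by (simp add: sum.distrib flip: sum_distrib_left)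
  also have "\<dots> \<le> 12 * ?\<gamma>^2 * (B^2 + B^2 + B^2 + B^2)"
    using eB[of "\<lambda>j. j + 1"] eB[of "\<lambda>j. j"] eB[of "\<lambda>j. j - 1"] eB[of uminus]
    by (intro mult_left_mono add_mono) (auto intro!: injI)
  also have "\<dots> = 48 * (?\<gamma>^2 * B^2)" by simp
  also have "\<dots> \<le> 49 * (?\<gamma>^2 * B^2)" by (intro mult_right_mono) auto
  also have "\<dots> = (7 * ?\<gamma> * B)^2" by (simp add: power_mult_distrib del: distrib_left_numeral)
  finally show "(\<Sum>j\<in>S. (cmod (hop \<alpha> \<beta> w j))^2) \<le> (7 * ?\<gamma> * B)^2" .
qed

text \<open>The group exp (i t \<open>hop\<close>), summed site by site so that the theorems on
  scalar power series apply at each site.\<close>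

definition propagator :: "real \<Rightarrow> real \<Rightarrow> (int \<Rightarrow> complex) \<Rightarrow> real \<Rightarrow> int \<Rightarrow> complex" where
  "propagator \<alpha> \<beta> \<phi> t j = (\<Sum>n. of_real t ^ n * (\<i> ^ n / fact n * (hop \<alpha> \<beta> ^^ n) \<phi> j))"

lemma l2_bounded_iterate:
  assumes ab: "0 < \<alpha>" "0 < \<beta>" and \<phi>: "l2_bounded \<phi> B"
  shows "l2_bounded ((hop \<alpha> \<beta> ^^ n) \<phi>) ((7 * (\<alpha> + \<beta>)) ^ n * B)"
proof (induction n)
  case (Suc n)
  then show ?case using l2_bounded_hop[OF ab Suc] by (simp add: mult.assoc)
qed (use \<phi> in simp)

lemma exp_sums: "(\<lambda>n. (x::real) ^ n / fact n * B) sums (exp x * B)"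
  using exp_converges[of x] by (intro sums_mult2) (simp add: divide_inverse mult.commute)

lemma l2_bounded_propagator_term:
  assumes ab: "0 < \<alpha>" "0 < \<beta>" and \<phi>: "l2_bounded \<phi> B"
  shows "l2_bounded (\<lambda>j. z * (\<i> ^ n / fact n * (hop \<alpha> \<beta> ^^ n) \<phi> j)) (cmod z / fact n * ((7 * (\<alpha> + \<beta>)) ^ n * B))"
proof -
  have "l2_bounded (\<lambda>j. (z * (\<i> ^ n / fact n)) * (hop \<alpha> \<beta> ^^ n) \<phi> j) (cmod (z * (\<i> ^ n / fact n)) * ((7 * (\<alpha> + \<beta>)) ^ n * B))"
    by (intro l2_bounded_cmult l2_bounded_iterate assms)
  moreover have "cmod (z * (\<i> ^ n / fact n)) = cmod z / fact n" by (simp add: norm_mult norm_divide norm_power)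
  ultimately show ?thesis by (simp only: mult.assoc)
qed

lemma propagator_summable:
  assumes ab: "0 < \<alpha>" "0 < \<beta>" and \<phi>: "l2_bounded \<phi> B" and j: "j \<noteq> 0"
  shows "summable (\<lambda>n. \<i> ^ n / fact n * (hop \<alpha> \<beta> ^^ n) \<phi> j * z ^ n)"
proof (rule summable_comparison_test')
  show "summable (\<lambda>n. (cmod z * (7 * (\<alpha> + \<beta>))) ^ n / fact n * B)" using exp_sums by (rule sums_summable)
  fix n
  have "cmod (z ^ n * (\<i> ^ n / fact n * (hop \<alpha> \<beta> ^^ n) \<phi> j)) \<le> cmod (z ^ n) / fact n * ((7 * (\<alpha> + \<beta>)) ^ n * B)"
    by (rule l2_bounded_cmod_le[OF l2_bounded_propagator_term[OF ab \<phi>] j])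
  then show "norm (\<i> ^ n / fact n * (hop \<alpha> \<beta> ^^ n) \<phi> j * z ^ n) \<le> (cmod z * (7 * (\<alpha> + \<beta>))) ^ n / fact n * B"
    by (simp only: mult.commute[of _ "z ^ n"]) (simp add: norm_power power_mult_distrib)
qed

lemma propagator_sums:
  assumes "0 < \<alpha>" "0 < \<beta>" "l2_bounded \<phi> B" "j \<noteq> 0"
  shows "(\<lambda>n. of_real t ^ n * (\<i> ^ n / fact n * (hop \<alpha> \<beta> ^^ n) \<phi> j)) sums propagator \<alpha> \<beta> \<phi> t j"
  unfolding propagator_def using propagator_summable[OF assms, of "of_real t"]
  by (intro summable_sums) (simp only: mult.commute)

lemma propagator_l2_bounded:
  assumes ab: "0 < \<alpha>" "0 < \<beta>" and \<phi>: "l2_bounded \<phi> B"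
  shows "l2_bounded (propagator \<alpha> \<beta> \<phi> t) (exp (\<bar>t\<bar> * (7 * (\<alpha> + \<beta>))) * B)"
proof (rule l2_bounded_suminf[OF l2_bounded_propagator_term[OF ab \<phi>]])
  show "(\<lambda>n. cmod (of_real t ^ n) / fact n * ((7 * (\<alpha> + \<beta>)) ^ n * B)) sums (exp (\<bar>t\<bar> * (7 * (\<alpha> + \<beta>))) * B)"
  proof -
    have "cmod (of_real t ^ n) / fact n * (k ^ n * B) = (\<bar>t\<bar> * k) ^ n / fact n * B" for n and k :: real
      by (simp add: norm_power power_mult_distrib)
    then show ?thesis by (simp only: exp_sums)
  qed
qed (rule propagator_sums[OF assms])

lemma power_diff_bound:
  fixes s t T :: real
  assumes "\<bar>s\<bar> \<le> T" "\<bar>t\<bar> \<le> T"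
  shows "\<bar>s ^ Suc n - t ^ Suc n\<bar> \<le> Suc n * T ^ n * \<bar>s - t\<bar>"
proof (induction n)
  case (Suc n)
  have T: "0 \<le> T" using assms by linarith
  have "s ^ Suc (Suc n) - t ^ Suc (Suc n) = s * (s ^ Suc n - t ^ Suc n) + (s - t) * t ^ Suc n"
    by (simp add: algebra_simps)
  also have "\<bar>\<dots>\<bar> \<le> \<bar>s\<bar> * \<bar>s ^ Suc n - t ^ Suc n\<bar> + \<bar>s - t\<bar> * \<bar>t\<bar> ^ Suc n"
    by (intro order_trans[OF abs_triangle_ineq]) (simp add: abs_mult power_abs)
  also have "\<dots> \<le> T * (Suc n * T ^ n * \<bar>s - t\<bar>) + \<bar>s - t\<bar> * T ^ Suc n"
    using assms T Suc by (intro add_mono mult_mono power_mono) auto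
  finally show ?case by (simp add: algebra_simps)
qed simp

lemma propagator_lipschitz:
  assumes ab: "0 < \<alpha>" "0 < \<beta>" and \<phi>: "l2_bounded \<phi> B" and T: "\<bar>s\<bar> \<le> T" "\<bar>t\<bar> \<le> T"
  defines "K \<equiv> 7 * (\<alpha> + \<beta>)"
  shows "l2_bounded (\<lambda>j. propagator \<alpha> \<beta> \<phi> s j - propagator \<alpha> \<beta> \<phi> t j) (exp (T * K) * (\<bar>s - t\<bar> * K * B))"
proof -
  have K: "0 \<le> K" using ab by (simp add: K_def)
  have B: "0 \<le> B" using \<phi> by (simp add: l2_bounded_def)
  have T0: "0 \<le> T" using T by linarith
  \<comment> \<open>The constant term cancels in the difference. For n = m + 1 the factor n from
    \<open>power_diff_bound\<close> reduces n! to m!, so the majorant is again an exponential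
    series.\<close>
  define c where "c n = (case n of 0 \<Rightarrow> 0 | Suc m \<Rightarrow> (T * K) ^ m / fact m * (\<bar>s - t\<bar> * K * B))" for n
  show ?thesis
  proof (rule l2_bounded_suminf)
    have "(\<lambda>n. c (Suc n)) sums (exp (T * K) * (\<bar>s - t\<bar> * K * B))"
      unfolding c_def using exp_sums by simp
    from sums_Suc[OF this] have "c sums (exp (T * K) * (\<bar>s - t\<bar> * K * B) + c 0)" .
    moreover have "c 0 = 0" by (simp add: c_def)
    ultimately show "c sums (exp (T * K) * (\<bar>s - t\<bar> * K * B))" by (simp only: add_0_right)
    show "(\<lambda>n. (of_real s ^ n - of_real t ^ n) * (\<i> ^ n / fact n * (hop \<alpha> \<beta> ^^ n) \<phi> j)) sums
      (propagator \<alpha> \<beta> \<phi> s j - propagator \<alpha> \<beta> \<phi> t j)" if "j \<noteq> 0" for j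
      unfolding left_diff_distrib by (intro sums_diff propagator_sums[OF ab \<phi> that])
    show "l2_bounded (\<lambda>j. (of_real s ^ n - of_real t ^ n) * (\<i> ^ n / fact n * (hop \<alpha> \<beta> ^^ n) \<phi> j)) (c n)" for n
    proof -
      have "cmod (of_real s ^ n - of_real t ^ n) = \<bar>s ^ n - t ^ n\<bar>"
        by (simp flip: of_real_power of_real_diff)
      then have 1: "l2_bounded (\<lambda>j. (of_real s ^ n - of_real t ^ n) * (\<i> ^ n / fact n * (hop \<alpha> \<beta> ^^ n) \<phi> j)) (\<bar>s ^ n - t ^ n\<bar> / fact n * (K ^ n * B))"
        using l2_bounded_propagator_term[OF ab \<phi>, of "of_real s ^ n - of_real t ^ n" n] by (simp only: K_def)
      have 2: "\<bar>s ^ n - t ^ n\<bar> / fact n * (K ^ n * B) \<le> c n"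
      proof (cases n)
        case (Suc m)
        have "\<bar>s ^ Suc m - t ^ Suc m\<bar> / fact (Suc m) * (K ^ Suc m * B)
          \<le> (Suc m * T ^ m * \<bar>s - t\<bar>) / fact (Suc m) * (K ^ Suc m * B)"
          using power_diff_bound[OF T, of m] K B by (intro mult_right_mono divide_right_mono) auto
        also have "\<dots> = c (Suc m)"
          by (simp add: c_def power_mult_distrib del: of_nat_Suc)
        finally show ?thesis using Suc by simp
      qed (simp add: c_def)
      show ?thesis by (rule l2_bounded_mono[OF 1 2])
    qed
  qed
qed

lemma propagator_C_l2:
  assumes ab: "0 < \<alpha>" "0 < \<beta>" and \<phi>: "l2_bounded \<phi> B"
  shows "propagator \<alpha> \<beta> \<phi> \<in> C_l2"
  unfolding C_l2_def
proof (intro CollectI conjI allI)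
  show "propagator \<alpha> \<beta> \<phi> t \<in> l2" for t
    using propagator_l2_bounded[OF assms] by (rule l2_bounded_imp_l2)
  fix t
  let ?n = "\<lambda>s. l2_norm (\<lambda>j. propagator \<alpha> \<beta> \<phi> s j - propagator \<alpha> \<beta> \<phi> t j)"
  define K where "K = 7 * (\<alpha> + \<beta>)"
  have "\<forall>\<^sub>F s in at t. \<bar>s - t\<bar> < 1"
    using eventually_at_ball[of 1 t UNIV] by (auto simp: dist_real_def abs_minus_commute elim: eventually_mono)
  then have "\<forall>\<^sub>F s in at t. ?n s \<le> exp ((\<bar>t\<bar> + 1) * K) * (\<bar>s - t\<bar> * K * B)"
  proof (rule eventually_mono)
    fix s assume "\<bar>s - t\<bar> < 1"
    then have "\<bar>s\<bar> \<le> \<bar>t\<bar> + 1" "\<bar>t\<bar> \<le> \<bar>t\<bar> + 1" by auto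
    from l2_bounded_imp_l2(2)[OF propagator_lipschitz[OF assms this]]
    show "?n s \<le> exp ((\<bar>t\<bar> + 1) * K) * (\<bar>s - t\<bar> * K * B)" by (simp only: K_def)
  qed
  moreover have "\<forall>\<^sub>F s in at t. 0 \<le> ?n s" by (simp add: l2_norm_def infsum_nonneg)
  moreover have "((\<lambda>s. exp ((\<bar>t\<bar> + 1) * K) * (\<bar>s - t\<bar> * K * B)) \<longlongrightarrow> exp ((\<bar>t\<bar> + 1) * K) * (\<bar>t - t\<bar> * K * B)) (at t)"
    by (intro tendsto_intros)
  ultimately show "(?n \<longlongrightarrow> 0) (at t)"
    by (intro tendsto_sandwich[of "\<lambda>_. 0" ?n "at t"]) auto
qed

lemma propagator_initial: "propagator \<alpha> \<beta> \<phi> 0 j = \<phi> j"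
  unfolding propagator_def using powser_zero[of "\<lambda>n. \<i> ^ n / fact n * (hop \<alpha> \<beta> ^^ n) \<phi> j"]
  by (simp add: mult.commute)

lemma propagator_derivative:
  assumes ab: "0 < \<alpha>" "0 < \<beta>" and \<phi>: "l2_bounded \<phi> B" and j: "j \<noteq> 0"
  shows "((\<lambda>t. propagator \<alpha> \<beta> \<phi> t j) has_vector_derivative \<i> * hop \<alpha> \<beta> (propagator \<alpha> \<beta> \<phi> t) j) (at t)"
proof -
  define a where "a n = \<i> ^ n / fact n * (hop \<alpha> \<beta> ^^ n) \<phi> j" for n
  have "((\<lambda>z. \<Sum>n. a n * z ^ n) has_field_derivative (\<Sum>n. diffs a n * of_real t ^ n)) (at (of_real t))"
    unfolding a_def by (rule termdiffs_strong_converges_everywhere) (rule propagator_summable[OF assms])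
  then have "((\<lambda>t. \<Sum>n. a n * of_real t ^ n) has_vector_derivative (\<Sum>n. diffs a n * of_real t ^ n)) (at t)"
    by (rule has_vector_derivative_real_field)
  moreover have "(\<lambda>t. propagator \<alpha> \<beta> \<phi> t j) = (\<lambda>t. \<Sum>n. a n * of_real t ^ n)"
    by (simp add: propagator_def a_def mult_ac)
  moreover have "(\<lambda>n. diffs a n * of_real t ^ n) sums (\<i> * hop \<alpha> \<beta> (propagator \<alpha> \<beta> \<phi> t) j)"
  proof -
    have "(\<lambda>n. \<i> * hop \<alpha> \<beta> (\<lambda>k. (of_real t ^ n * (\<i> ^ n / fact n)) * (hop \<alpha> \<beta> ^^ n) \<phi> k) j) sums (\<i> * hop \<alpha> \<beta> (propagator \<alpha> \<beta> \<phi> t) j)"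
      using propagator_sums[OF ab \<phi>] by (intro sums_mult hop_sums) (simp only: mult.assoc)
    moreover have "\<i> * hop \<alpha> \<beta> (\<lambda>k. (of_real t ^ n * (\<i> ^ n / fact n)) * (hop \<alpha> \<beta> ^^ n) \<phi> k) j = diffs a n * of_real t ^ n" for n
      unfolding hop_cmult by (simp add: diffs_def a_def del: of_nat_Suc)
    ultimately show ?thesis by simp
  qed
  ultimately show ?thesis by (simp add: sums_iff)
qed

section \<open>The kernel of the coupled system\<close>

abbreviation decay :: "real \<Rightarrow> real" where
  "decay t \<equiv> (\<bar>t\<bar> + 1) powr (-1/3)"

text \<open>The kernels are given by formulas that also have a value at 0. Assumption
  \<open>zero\<close> says that this value is the weighted mean, so \<open>glue\<close> leaves it
  unchanged and the equation can be checked with the plain Laplacian.\<close>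

lemma bdd_solutionI:
  assumes ab: "0 < \<alpha>" "0 < \<beta>"
    and D: "\<And>t j. cmod (w t j) \<le> D * decay t"
    and zero: "\<And>t. of_real \<alpha> * w t (-1) + of_real \<beta> * w t 1 = of_real (\<alpha> + \<beta>) * w t 0"
    and d: "\<And>t j. j \<noteq> 0 \<Longrightarrow> ((\<lambda>s. w s j) has_vector_derivative
      of_real (if j < 0 then \<alpha> else \<beta>) * (\<i> * discrete_laplacian (w t) j)) (at t)"
  shows "bdd_solution \<alpha> \<beta> w"
proof -
  have "glue \<alpha> \<beta> (w t) = w t" for t
  proof
    fix j
    have "of_real (\<alpha> + \<beta>) \<noteq> (0::complex)" using ab by (simp only: of_real_eq_0_iff)
    then show "glue \<alpha> \<beta> (w t) j = w t j" by (simp only: glue_def zero) simp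
  qed
  then have h: "\<i> * hop \<alpha> \<beta> (w t) j = of_real (if j < 0 then \<alpha> else \<beta>) * (\<i> * discrete_laplacian (w t) j)" for t j
    by (simp add: hop_def)
  show ?thesis
    unfolding bdd_solution_def
  proof (intro conjI allI impI)
    fix j :: int assume "j \<noteq> 0"
    from has_vector_derivative_continuous[OF d[OF this]] show "continuous_on UNIV (\<lambda>t. w t j)"
      by (intro continuous_at_imp_continuous_on ballI)
  next
    fix T
    have "0 \<le> D" using order_trans[OF norm_ge_zero D[of 0 0]] by simp
    then have "D * decay t \<le> D * 1" for t :: real
      using powr_mono2'[of "-1/3" 1 "\<bar>t\<bar> + 1"] by (intro mult_left_mono) auto
    from order_trans[OF D this]
    show "\<exists>M. \<forall>t j. \<bar>t\<bar> \<le> T \<and> j \<noteq> 0 \<longrightarrow> cmod (w t j) \<le> M"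
      by (intro exI[of _ "D * 1"]) blast
  next
    fix t :: real and j :: int assume "t \<noteq> 0 \<and> j \<noteq> 0"
    then show "((\<lambda>s. w s j) has_vector_derivative \<i> * hop \<alpha> \<beta> (w t) j) (at t)"
      unfolding h by (intro d) blast
  qed
qed

lemma has_vector_derivative_scale:
  fixes f :: "real \<Rightarrow> complex"
  assumes "(f has_vector_derivative D) (at (\<gamma> * t))"
  shows "((\<lambda>t. f (\<gamma> * t)) has_vector_derivative of_real \<gamma> * D) (at t)"
proof -
  have "((\<lambda>t. \<gamma> * t) has_vector_derivative \<gamma>) (at t)"
    by (auto intro!: derivative_eq_intros simp: has_real_derivative_iff_has_vector_derivative[symmetric])
  from vector_diff_chain_at[OF this assms] show ?thesis by (simp add: o_def scaleR_conv_of_real)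
qed

text \<open>For \<bar>t\<bar> \<le> 1 the decay factor is at least 2^(-1/3) \<ge> 1/2, so the
  constant bound A is enough; for larger times \<bar>t\<bar> \<ge> (\<bar>t\<bar> + 1) / 2 converts
  the power that is singular at 0.\<close>

lemma decay_combine:
  fixes x t A B \<gamma> :: real
  assumes A: "x \<le> A" "0 \<le> A" and B: "t \<noteq> 0 \<Longrightarrow> x \<le> B * \<bar>\<gamma> * t\<bar> powr (-1/3)" "0 \<le> B" and \<gamma>: "0 < \<gamma>"
  shows "x \<le> (2 * A + 2 * B * \<gamma> powr (-1/3)) * decay t"
proof -
  let ?d = "decay t"
  have half: "1 \<le> 2 * (2::real) powr (-1/3)"
  proof -
    have "(2::real) powr (-1) \<le> 2 powr (-1/3)" by (intro powr_mono) auto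
    then show ?thesis by (simp add: powr_minus)
  qed
  have nn: "0 \<le> 2 * A * ?d" "0 \<le> 2 * B * \<gamma> powr (-1/3) * ?d" using A B by auto
  show ?thesis
  proof (cases "\<bar>t\<bar> \<le> 1")
    case True
    have "2 powr (-1/3) \<le> ?d" using True by (intro powr_mono2') auto
    then have "1 \<le> 2 * ?d" using half by linarith
    then have "A * 1 \<le> A * (2 * ?d)" using A by (intro mult_left_mono)
    then show ?thesis using A(1) nn by (simp add: algebra_simps)
  next
    case False
    have "\<bar>t\<bar> powr (-1/3) \<le> ((\<bar>t\<bar> + 1) / 2) powr (-1/3)" using False by (intro powr_mono2') auto
    also have "\<dots> = ?d / 2 powr (-1/3)" by (simp add: powr_divide)
    also have "\<dots> \<le> 2 * ?d"
    proof -
      have "?d * 1 \<le> ?d * (2 * 2 powr (-1/3))" using half by (intro mult_left_mono) auto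
      then show ?thesis by (simp add: pos_divide_le_eq mult_ac)
    qed
    finally have "B * (\<gamma> powr (-1/3) * \<bar>t\<bar> powr (-1/3)) \<le> B * (\<gamma> powr (-1/3) * (2 * ?d))"
      using B by (intro mult_left_mono) auto
    moreover have "\<bar>\<gamma> * t\<bar> powr (-1/3) = \<gamma> powr (-1/3) * \<bar>t\<bar> powr (-1/3)"
      using \<gamma> by (simp add: abs_mult powr_mult)
    moreover have "t \<noteq> 0" using False by auto
    ultimately have "x \<le> B * (\<gamma> powr (-1/3) * (2 * ?d))" using B(1) by simp
    then show ?thesis using nn by (simp add: algebra_simps)
  qed
qed

text \<open>Column k of the fundamental matrix. What matters later is that one D serves all
  k.\<close>

definition decaying_kernel :: "real \<Rightarrow> real \<Rightarrow> real \<Rightarrow> int \<Rightarrow> (real \<Rightarrow> int \<Rightarrow> complex) \<Rightarrow> bool" where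
  "decaying_kernel \<alpha> \<beta> D k G \<longleftrightarrow> bdd_solution \<alpha> \<beta> G \<and>
     (\<forall>j. j \<noteq> 0 \<longrightarrow> G 0 j = (if j = k then 1 else 0)) \<and>
     (\<forall>t j. j \<noteq> 0 \<longrightarrow> cmod (G t j) \<le> D * decay t)"

text \<open>The sum of the constants from \<open>decay_combine\<close>: 4 and 16000 for one
  transmission integral (bounds 2 and 8000), 2 and 76 for each of two free kernels (bounds 1 and
  38).\<close>

definition decay_constant :: "real \<Rightarrow> real \<Rightarrow> real" where
  "decay_constant \<alpha> \<gamma> = 8 + 16000 * \<alpha> powr (-1/3) + 152 * \<gamma> powr (-1/3)"

lemma kernel_decay:
  assumes c: "0 < c" "c \<le> 1" and a: "0 < \<alpha>" and g: "0 < \<gamma>"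
  shows "cmod (transmission c p q (\<alpha> * t)) \<le> decay_constant \<alpha> \<gamma> * decay t"
    and "cmod (free_kernel m (\<gamma> * t) - free_kernel n (\<gamma> * t) + transmission c p q (\<alpha> * t))
      \<le> decay_constant \<alpha> \<gamma> * decay t"
proof -
  let ?d = "decay t"
  have T: "cmod (transmission c p q (\<alpha> * t)) \<le> (4 + 16000 * \<alpha> powr (-1/3)) * ?d"
    using decay_combine[of "cmod (transmission c p q (\<alpha> * t))" 2 t 8000 \<alpha>]
      cmod_transmission_le[OF c, where p = p and q = q and \<tau> = "\<alpha> * t"] a by simp
  have E: "cmod (free_kernel n (\<gamma> * t)) \<le> (2 + 76 * \<gamma> powr (-1/3)) * ?d" for n
    using decay_combine[of "cmod (free_kernel n (\<gamma> * t))" 1 t 38 \<gamma>]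
      cmod_free_kernel_le[where n = n and \<tau> = "\<gamma> * t"] g by simp
  have "(4 + 16000 * \<alpha> powr (-1/3)) * ?d \<le> decay_constant \<alpha> \<gamma> * ?d"
    by (intro mult_right_mono) (auto simp: decay_constant_def)
  from order_trans[OF T this]
  show "cmod (transmission c p q (\<alpha> * t)) \<le> decay_constant \<alpha> \<gamma> * ?d" .
  have "cmod (x - y + z) \<le> cmod x + cmod y + cmod z" for x y z :: complex
    using norm_triangle_ineq[of "x - y" z] norm_triangle_ineq4[of x y] by linarith
  from order_trans[OF this add_mono[OF add_mono[OF E E] T]]
  show "cmod (free_kernel m (\<gamma> * t) - free_kernel n (\<gamma> * t) + transmission c p q (\<alpha> * t)) \<le> decay_constant \<alpha> \<gamma> * ?d"
    by (simp add: decay_constant_def algebra_simps)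
qed

text \<open>On the source side the method of images for the Dirichlet condition is corrected by a
  transmission integral with exponent j + k; on the other side there is transmission alone. At 0 the
  images cancel and the two formulas agree, so second differences may reach across the interface.
  Time is scaled by \<alpha> because the integrals are normalized to speed 1 on the left and c^2 on
  the right.\<close>

lemma decaying_kernel_right:
  assumes c: "0 < c" "c \<le> 1" and a: "0 < \<alpha>" and b: "\<beta> = \<alpha> * c^2" and k: "0 < k"
  shows "decaying_kernel \<alpha> \<beta> (decay_constant \<alpha> \<beta>) k
    (\<lambda>t j. if j < 0 then transmission c (nat (- j)) (nat k) (\<alpha> * t)
      else free_kernel (j - k) (\<beta> * t) - free_kernel (j + k) (\<beta> * t) + transmission c 0 (nat (j + k)) (\<alpha> * t))"
    (is "decaying_kernel \<alpha> \<beta> ?D k ?G")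
proof -
  have b0: "0 < \<beta>" using a b c by simp
  have beta_tau: "c^2 * (\<alpha> * t) = \<beta> * t" for t using b by simp
  have E0: "free_kernel (- k) = free_kernel k" by (rule free_kernel_uminus)
  have G0: "?G t 0 = transmission c 0 (nat k) (\<alpha> * t)" for t using E0 by simp
  have D: "cmod (?G t j) \<le> ?D * decay t" for t j
    using kernel_decay[OF c a b0] by simp
  have "bdd_solution \<alpha> \<beta> ?G"
  proof (rule bdd_solutionI[OF a b0 D])
    fix t :: real
    let ?F = "\<lambda>p q. transmission c p q (\<alpha> * t)" and ?E = "\<lambda>n. free_kernel n (\<beta> * t)"
    have "(?F 1 (nat k) - ?F 0 (nat k)) + of_real (c^2) * (?F 0 (Suc (nat k)) - ?F 0 (nat k)) = - (of_real (c^2) * (?E (k - 1) - ?E (k + 1)))"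
      using kirchhoff_right[OF c, of "nat k" "\<alpha> * t"] k unfolding beta_tau by simp
    from arg_cong[OF this, of "\<lambda>z. of_real \<alpha> * z"]
    have "of_real \<alpha> * (?F 1 (nat k) - ?F 0 (nat k)) + of_real \<beta> * (?F 0 (Suc (nat k)) - ?F 0 (nat k)) = - (of_real \<beta> * (?E (k - 1) - ?E (k + 1)))"
      unfolding b by (simp only: of_real_mult distrib_left mult_minus_right mult.assoc)
    moreover have "?E (1 - k) = ?E (k - 1)" using free_kernel_uminus[of "k - 1"] by simp
    moreover have "nat (1 + k) = Suc (nat k)" using k by simp
    ultimately have "of_real \<alpha> * ?F 1 (nat k) + of_real \<beta> * (?E (1 - k) - ?E (1 + k) + ?F 0 (nat (1 + k))) = of_real (\<alpha> + \<beta>) * ?F 0 (nat k)"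
      by (simp add: algebra_simps)
    then show "of_real \<alpha> * ?G t (-1) + of_real \<beta> * ?G t 1 = of_real (\<alpha> + \<beta>) * ?G t 0"
      unfolding G0 by simp
  next
    fix t :: real and j :: int assume j: "j \<noteq> 0"
    show "((\<lambda>s. ?G s j) has_vector_derivative of_real (if j < 0 then \<alpha> else \<beta>) * (\<i> * discrete_laplacian (?G t) j)) (at t)"
    proof (cases "j < 0")
      case True
      define p where "p = nat (- j - 1)"
      have p: "nat (- j) = Suc p" "nat (- (j - 1)) = Suc (Suc p)" "nat (- (j + 1)) = p" using True by (auto simp: p_def)
      \<comment> \<open>At j = -1 the neighbour is 0, where the formula of the source side
        applies.\<close>
      have nxt: "?G t (j + 1) = transmission c p (nat k) (\<alpha> * t)"
      proof (cases "j = -1")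
        case True
        then show ?thesis using G0[of t] by (simp add: p_def)
      next
        case False
        then show ?thesis using True p by simp
      qed
      have "discrete_laplacian (?G t) j = transmission c (Suc (Suc p)) (nat k) (\<alpha> * t) - 2 * transmission c (Suc p) (nat k) (\<alpha> * t) + transmission c p (nat k) (\<alpha> * t)"
        unfolding discrete_laplacian_def nxt using True p by simp
      then show ?thesis
        using has_vector_derivative_scale[OF transmission_ode1[OF c, of p "nat k" "\<alpha> * t"]] True p by simp
    next
      case False
      then have j1: "1 \<le> j" using j by simp
      define q where "q = nat (j + k - 1)"
      have q: "nat (j + k) = Suc q" "nat (j + 1 + k) = Suc (Suc q)" "nat (j - 1 + k) = q" using j1 k by (auto simp: q_def)
      let ?E = "\<lambda>n. free_kernel n (\<beta> * t)" and ?F = "\<lambda>q. transmission c 0 q (\<alpha> * t)"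
      have L: "discrete_laplacian (?G t) j = (?E (j - k + 1) - 2 * ?E (j - k) + ?E (j - k - 1)) - (?E (j + k + 1) - 2 * ?E (j + k) + ?E (j + k - 1))
         + (?F (Suc (Suc q)) - 2 * ?F (Suc q) + ?F q)"
        using j1 q by (simp add: discrete_laplacian_def algebra_simps)
      have "((\<lambda>s. free_kernel (j - k) (\<beta> * s) - free_kernel (j + k) (\<beta> * s) + transmission c 0 (Suc q) (\<alpha> * s)) has_vector_derivative
        of_real \<beta> * (\<i> * (?E (j - k + 1) - 2 * ?E (j - k) + ?E (j - k - 1))) - of_real \<beta> * (\<i> * (?E (j + k + 1) - 2 * ?E (j + k) + ?E (j + k - 1)))
         + of_real \<alpha> * (\<i> * (of_real (c^2) * (?F (Suc (Suc q)) - 2 * ?F (Suc q) + ?F q)))) (at t)"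
        by (intro has_vector_derivative_add has_vector_derivative_diff has_vector_derivative_scale free_kernel_ode transmission_ode2 c)
      moreover have "of_real \<beta> * (\<i> * X) - of_real \<beta> * (\<i> * Y) + of_real \<alpha> * (\<i> * (of_real (c^2) * Z)) = of_real \<beta> * (\<i> * (X - Y + Z))" for X Y Z
        unfolding b by (simp add: algebra_simps)
      ultimately show ?thesis unfolding L using j1 q by simp
    qed
  qed
  moreover have "?G 0 j = (if j = k then 1 else 0)" if "j \<noteq> 0" for j
  proof (cases "j < 0")
    case True
    have "2 \<le> nat (- j) + nat k" using True k by simp
    then show ?thesis using True k transmission_initial[OF c] by simp
  next
    case False
    then have "2 \<le> 0 + nat (j + k)" using that k by simp
    then show ?thesis using False that k transmission_initial[OF c] by (simp add: free_kernel_initial)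
  qed
  ultimately show ?thesis unfolding decaying_kernel_def using D by blast
qed

text \<open>The counterpart with the source on the faster side: the images run at speed \<alpha>,
  and the reflected exponent k - j belongs to r1. The value at 0 is again assigned to the branch of
  the source.\<close>

lemma decaying_kernel_left:
  assumes c: "0 < c" "c \<le> 1" and a: "0 < \<alpha>" and b: "\<beta> = \<alpha> * c^2" and k: "0 < k"
  shows "decaying_kernel \<alpha> \<beta> (decay_constant \<alpha> \<alpha>) (- k)
    (\<lambda>t j. if 0 < j then transmission c (nat k) (nat j) (\<alpha> * t)
      else free_kernel (j + k) (\<alpha> * t) - free_kernel (j - k) (\<alpha> * t) + transmission c (nat (k - j)) 0 (\<alpha> * t))"
    (is "decaying_kernel \<alpha> \<beta> ?D (- k) ?G")
proof -
  have b0: "0 < \<beta>" using a b c by simp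
  have E0: "free_kernel (- k) = free_kernel k" by (rule free_kernel_uminus)
  have G0: "?G t 0 = transmission c (nat k) 0 (\<alpha> * t)" for t using E0 by simp
  have D: "cmod (?G t j) \<le> ?D * decay t" for t j
    using kernel_decay[OF c a a] by simp
  have "bdd_solution \<alpha> \<beta> ?G"
  proof (rule bdd_solutionI[OF a b0 D])
    fix t :: real
    let ?F = "\<lambda>p q. transmission c p q (\<alpha> * t)" and ?E = "\<lambda>n. free_kernel n (\<alpha> * t)"
    have "(?F (Suc (nat k)) 0 - ?F (nat k) 0) + of_real (c^2) * (?F (nat k) 1 - ?F (nat k) 0) = - (?E (k - 1) - ?E (k + 1))"
      using kirchhoff_left[OF c, of "nat k" "\<alpha> * t"] k by simp
    from arg_cong[OF this, of "\<lambda>z. of_real \<alpha> * z"]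
    have "of_real \<alpha> * (?F (Suc (nat k)) 0 - ?F (nat k) 0) + of_real \<beta> * (?F (nat k) 1 - ?F (nat k) 0) = - (of_real \<alpha> * (?E (k - 1) - ?E (k + 1)))"
      unfolding b by (simp only: of_real_mult distrib_left mult_minus_right mult.assoc)
    moreover have "?E (- 1 - k) = ?E (k + 1)"
    proof -
      have "- 1 - k = - (k + 1)" by simp
      then show ?thesis by (simp only: free_kernel_uminus)
    qed
    moreover have "nat (k - - 1) = Suc (nat k)" using k by simp
    ultimately have "of_real \<alpha> * (?E (- 1 + k) - ?E (- 1 - k) + ?F (nat (k - - 1)) 0) + of_real \<beta> * ?F (nat k) 1 = of_real (\<alpha> + \<beta>) * ?F (nat k) 0"
      by (simp add: algebra_simps)
    then show "of_real \<alpha> * ?G t (-1) + of_real \<beta> * ?G t 1 = of_real (\<alpha> + \<beta>) * ?G t 0"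
      unfolding G0 by simp
  next
    fix t :: real and j :: int assume j: "j \<noteq> 0"
    show "((\<lambda>s. ?G s j) has_vector_derivative of_real (if j < 0 then \<alpha> else \<beta>) * (\<i> * discrete_laplacian (?G t) j)) (at t)"
    proof (cases "0 < j")
      case True
      define q where "q = nat (j - 1)"
      have q: "nat j = Suc q" "nat (j + 1) = Suc (Suc q)" "nat (j - 1) = q" using True by (auto simp: q_def)
      let ?F = "\<lambda>q. transmission c (nat k) q (\<alpha> * t)"
      have prev: "?G t (j - 1) = ?F q"
      proof (cases "j = 1")
        case True
        then show ?thesis using G0[of t] by (simp add: q_def)
      next
        case False
        then show ?thesis using True q by simp
      qed
      have L: "discrete_laplacian (?G t) j = ?F (Suc (Suc q)) - 2 * ?F (Suc q) + ?F q"
        unfolding discrete_laplacian_def prev using True q by simp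
      have Z: "of_real \<alpha> * (\<i> * (of_real (c^2) * Z)) = of_real \<beta> * (\<i> * Z)" for Z
        unfolding b by simp
      have d: "((\<lambda>s. transmission c (nat k) (Suc q) (\<alpha> * s)) has_vector_derivative
          of_real \<alpha> * (\<i> * (of_real (c^2) * (?F (Suc (Suc q)) - 2 * ?F (Suc q) + ?F q)))) (at t)"
        by (intro has_vector_derivative_scale transmission_ode2 c)
      from d[unfolded Z] show ?thesis unfolding L using True q by simp
    next
      case False
      then have j1: "j \<le> -1" using j by simp
      define p where "p = nat (k - j - 1)"
      have p: "nat (k - j) = Suc p" "nat (k - (j - 1)) = Suc (Suc p)" "nat (k - (j + 1)) = p" using j1 k by (auto simp: p_def)
      let ?E = "\<lambda>n. free_kernel n (\<alpha> * t)" and ?F = "\<lambda>p. transmission c p 0 (\<alpha> * t)"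
      have L: "discrete_laplacian (?G t) j = (?E (j + k + 1) - 2 * ?E (j + k) + ?E (j + k - 1)) - (?E (j - k + 1) - 2 * ?E (j - k) + ?E (j - k - 1))
         + (?F (Suc (Suc p)) - 2 * ?F (Suc p) + ?F p)"
        using j1 p by (simp add: discrete_laplacian_def algebra_simps)
      have "((\<lambda>s. free_kernel (j + k) (\<alpha> * s) - free_kernel (j - k) (\<alpha> * s) + transmission c (Suc p) 0 (\<alpha> * s)) has_vector_derivative
        of_real \<alpha> * (\<i> * (?E (j + k + 1) - 2 * ?E (j + k) + ?E (j + k - 1))) - of_real \<alpha> * (\<i> * (?E (j - k + 1) - 2 * ?E (j - k) + ?E (j - k - 1)))
         + of_real \<alpha> * (\<i> * (?F (Suc (Suc p)) - 2 * ?F (Suc p) + ?F p))) (at t)"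
        by (intro has_vector_derivative_add has_vector_derivative_diff has_vector_derivative_scale free_kernel_ode transmission_ode1 c)
      moreover have "of_real \<alpha> * (\<i> * X) - of_real \<alpha> * (\<i> * Y) + of_real \<alpha> * (\<i> * Z) = of_real \<alpha> * (\<i> * (X - Y + Z))" for X Y Z
        by (simp add: algebra_simps)
      ultimately show ?thesis unfolding L using j1 p by simp
    qed
  qed
  moreover have "?G 0 j = (if j = - k then 1 else 0)" if "j \<noteq> 0" for j
  proof (cases "0 < j")
    case True
    have "2 \<le> nat k + nat j" using True k by simp
    then show ?thesis using True k transmission_initial[OF c] by simp
  next
    case False
    then have "2 \<le> nat (k - j) + 0" using that k by simp
    then have "transmission c (nat (k - j)) 0 0 = 0" using transmission_initial[OF c] by blast
    then show ?thesis using False that k by (auto simp: free_kernel_initial)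
  qed
  ultimately show ?thesis unfolding decaying_kernel_def using D by blast
qed

section \<open>Reflection and kernels for every source\<close>

lemma bdd_solution_reflect:
  assumes "bdd_solution \<beta> \<alpha> w"
  shows "bdd_solution \<alpha> \<beta> (\<lambda>t j. w t (- j))"
proof -
  have g: "glue \<alpha> \<beta> (\<lambda>j. x (- j)) j = glue \<beta> \<alpha> x (- j)" for x j
    by (simp add: glue_def add.commute)
  have h: "hop \<alpha> \<beta> (\<lambda>j. x (- j)) j = hop \<beta> \<alpha> x (- j)" if "j \<noteq> 0" for x j
  proof -
    have "- (j + 1) = - j - 1" "- (j - 1) = - j + 1" "(if - j < 0 then \<beta> else \<alpha>) = (if j < 0 then \<alpha> else \<beta>)"
      using that by auto
    moreover have "A - 2 * B + C = C - 2 * B + A" for A B C :: complex by simp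
    ultimately show ?thesis unfolding hop_def discrete_laplacian_def g by (simp only:)
  qed
  show ?thesis
    unfolding bdd_solution_def
  proof (intro conjI allI impI)
    fix T
    show "\<exists>M. \<forall>t j. \<bar>t\<bar> \<le> T \<and> j \<noteq> 0 \<longrightarrow> cmod (w t (- j)) \<le> M"
      using bdd_solution_bound[OF assms, of T] by (metis neg_equal_0_iff_equal)
  qed (use assms in \<open>auto simp: bdd_solution_def h\<close>)
qed

lemma decaying_kernel_mono:
  assumes "decaying_kernel \<alpha> \<beta> D k G" "D \<le> D'"
  shows "decaying_kernel \<alpha> \<beta> D' k G"
proof -
  have "D * decay t \<le> D' * decay t" for t
    using assms(2) by (intro mult_right_mono) auto
  then show ?thesis using assms(1) unfolding decaying_kernel_def by (meson order_trans)
qed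

lemma decaying_kernel_reflect:
  assumes "decaying_kernel \<beta> \<alpha> D k G"
  shows "decaying_kernel \<alpha> \<beta> D (- k) (\<lambda>t j. G t (- j))"
  using assms bdd_solution_reflect unfolding decaying_kernel_def by (auto simp: minus_equation_iff)

lemma decaying_kernel_exists_le:
  assumes "0 < \<beta>" "\<beta> \<le> \<alpha>"
  shows "\<exists>D>0. \<forall>k. k \<noteq> 0 \<longrightarrow> (\<exists>G. decaying_kernel \<alpha> \<beta> D k G)"
proof -
  define c where "c = sqrt (\<beta> / \<alpha>)"
  have a: "0 < \<alpha>" using assms by simp
  have c: "0 < c" "c \<le> 1" using assms a by (auto simp: c_def)
  have b: "\<beta> = \<alpha> * c^2" using assms a by (simp add: c_def)
  define D where "D = decay_constant \<alpha> \<beta> + decay_constant \<alpha> \<alpha>"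
  have pos: "0 < decay_constant \<alpha> \<gamma>" for \<gamma>
    unfolding decay_constant_def by (intro add_pos_nonneg) auto
  then have le: "decay_constant \<alpha> \<beta> \<le> D" "decay_constant \<alpha> \<alpha> \<le> D"
    by (auto simp: D_def less_imp_le)
  have "\<exists>G. decaying_kernel \<alpha> \<beta> D k G" if "k \<noteq> 0" for k
  proof (cases "0 < k")
    case True
    from decaying_kernel_mono[OF decaying_kernel_right[OF c a b this] le(1)]
    show ?thesis by blast
  next
    case False
    then have "0 < - k" using that by simp
    from decaying_kernel_mono[OF decaying_kernel_left[OF c a b this] le(2)]
    show ?thesis by auto
  qed
  moreover have "0 < D" using pos by (simp add: D_def add_pos_pos)
  ultimately show ?thesis by blast
qed

lemma decaying_kernel_exists:
  assumes "0 < \<alpha>" "0 < \<beta>"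
  shows "\<exists>D>0. \<forall>k. k \<noteq> 0 \<longrightarrow> (\<exists>G. decaying_kernel \<alpha> \<beta> D k G)"
proof (cases "\<beta> \<le> \<alpha>")
  case True
  then show ?thesis using decaying_kernel_exists_le assms by blast
next
  case False
  then obtain D where D: "D > 0" "\<And>k. k \<noteq> 0 \<Longrightarrow> \<exists>G. decaying_kernel \<beta> \<alpha> D k G"
    using decaying_kernel_exists_le[of \<alpha> \<beta>] assms by auto
  have "\<exists>G. decaying_kernel \<alpha> \<beta> D k G" if "k \<noteq> 0" for k
  proof -
    have "- k \<noteq> 0" using that by simp
    from D(2)[OF this] obtain G where "decaying_kernel \<beta> \<alpha> D (- k) G" by blast
    from decaying_kernel_reflect[OF this] show ?thesis by auto
  qed
  then show ?thesis using D(1) by blast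
qed

section \<open>Solutions of the coupled system\<close>

text \<open>Norm continuity gives continuity at each site and, by compactness of [-T, T], a bound
  uniform in the site. The two coupling lines determine the value at 0 as the glued one, which
  merges the half-line equations into a single equation for \<open>hop\<close>.\<close>

lemma is_solution_imp_bdd_solution:
  assumes b: "0 < b1" "0 < b2" and sol: "is_solution b1 b2 \<phi> u v"
  shows "bdd_solution (1 / b1^2) (1 / b2^2) (\<lambda>t. pair_seq (u t) (v t))"
proof -
  let ?w = "\<lambda>t. pair_seq (u t) (v t)"
  define \<alpha> \<beta> where "\<alpha> = 1 / b1^2" and "\<beta> = 1 / b2^2"
  have ab: "0 < \<alpha>" "0 < \<beta>" using b by (auto simp: \<alpha>_def \<beta>_def)
  have wC: "?w \<in> C_l2" using sol by (simp add: is_solution_def)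
  have diff: "cmod (?w s j - ?w t j) \<le> l2_norm (\<lambda>j. ?w s j - ?w t j)" if "j \<noteq> 0" for s t j
  proof -
    have "l2_bounded (?w s) (l2_norm (?w s))" "l2_bounded (?w t) (l2_norm (?w t))"
      using wC by (auto simp: C_l2_def intro: l2_imp_bounded)
    from l2_bounded_imp_l2(1)[OF l2_bounded_diff[OF this]] show ?thesis
      using l2_bounded_cmod_le[OF l2_imp_bounded that] by blast
  qed
  have lim: "((\<lambda>s. l2_norm (\<lambda>j. ?w s j - ?w t j)) \<longlongrightarrow> 0) (at t)" for t
    using wC by (simp add: C_l2_def)
  have cont: "continuous_on UNIV (\<lambda>t. ?w t j)" if j: "j \<noteq> 0" for j
  proof (rule continuous_at_imp_continuous_on, rule ballI)
    fix t
    have "((\<lambda>s. ?w s j - ?w t j) \<longlongrightarrow> 0) (at t)"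
      by (rule Lim_null_comparison[OF _ lim]) (use diff[OF j] in auto)
    then show "isCont (\<lambda>t. ?w t j) t" by (simp add: isCont_def LIM_zero_iff)
  qed
  have bound: "\<exists>M. \<forall>t j. \<bar>t\<bar> \<le> T \<and> j \<noteq> 0 \<longrightarrow> cmod (?w t j) \<le> M" for T
  proof -
    have "\<exists>d>0. \<forall>s j. \<bar>s - t\<bar> < d \<longrightarrow> j \<noteq> 0 \<longrightarrow> cmod (?w s j) \<le> 1 + l2_norm (?w t)" for t
    proof -
      have "\<forall>\<^sub>F s in at t. l2_norm (\<lambda>j. ?w s j - ?w t j) < 1" using lim by (rule order_tendstoD) simp
      then obtain d where d: "d > 0" "\<And>s. s \<noteq> t \<Longrightarrow> dist s t < d \<Longrightarrow> l2_norm (\<lambda>j. ?w s j - ?w t j) < 1"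
        by (auto simp: eventually_at)
      have "cmod (?w s j) \<le> 1 + l2_norm (?w t)" if "\<bar>s - t\<bar> < d" "j \<noteq> 0" for s j
      proof -
        have t: "cmod (?w t j) \<le> l2_norm (?w t)"
          using wC that by (intro l2_bounded_cmod_le l2_imp_bounded) (auto simp: C_l2_def)
        have "cmod (?w s j - ?w t j) \<le> 1"
        proof (cases "s = t")
          case False
          have "l2_norm (\<lambda>j. ?w s j - ?w t j) < 1" by (rule d(2)[OF False]) (use that in \<open>simp add: dist_real_def\<close>)
          then show ?thesis using diff[OF that(2), of s t] by linarith
        qed simp
        then show ?thesis using t norm_triangle_ineq2[of "?w s j" "?w t j"] by linarith
      qed
      then show ?thesis using d(1) by blast
    qed
    then obtain d where d: "\<And>t. d t > 0" "\<And>t s j. \<bar>s - t\<bar> < d t \<Longrightarrow> j \<noteq> 0 \<Longrightarrow> cmod (?w s j) \<le> 1 + l2_norm (?w t)"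
      by metis
    obtain K where K: "finite K" "{-T..T} \<subseteq> (\<Union>t\<in>K. ball t (d t))"
    proof -
      have "{-T..T} \<subseteq> (\<Union>t\<in>{-T..T}. ball t (d t))" using d(1) by force
      then show ?thesis
        using compactE_image[of "{-T..T}" "{-T..T}" "\<lambda>t. ball t (d t)"] that by (metis compact_Icc open_ball)
    qed
    \<comment> \<open>The sum over the finite subcover dominates the maximum of its terms.\<close>
    have "cmod (?w s j) \<le> (\<Sum>t\<in>K. 1 + l2_norm (?w t))" if "\<bar>s\<bar> \<le> T \<and> j \<noteq> 0" for s j
    proof -
      have "s \<in> {-T..T}" using that by auto
      then obtain t where t: "t \<in> K" "s \<in> ball t (d t)" using K(2) by blast
      then have "\<bar>s - t\<bar> < d t" by (simp add: dist_real_def abs_minus_commute)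
      then have "cmod (?w s j) \<le> 1 + l2_norm (?w t)" using d(2) that by blast
      also have "\<dots> \<le> (\<Sum>t\<in>K. 1 + l2_norm (?w t))"
        by (rule member_le_sum[OF t(1) _ K(1)]) (simp add: l2_norm_def infsum_nonneg)
      finally show ?thesis .
    qed
    then show ?thesis by blast
  qed
  have deriv: "((\<lambda>s. ?w s j) has_vector_derivative \<i> * hop \<alpha> \<beta> (?w t) j) (at t)" if t: "t \<noteq> 0" and j: "j \<noteq> 0" for t j
  proof -
    have uv: "u t 0 = v t 0" "of_real \<alpha> * (u t (-1) - u t 0) = of_real \<beta> * (v t 0 - v t 1)"
      using sol t unfolding is_solution_def \<alpha>_def \<beta>_def by blast+
    have nz: "of_real (\<alpha> + \<beta>) \<noteq> (0::complex)" using ab by (simp only: of_real_eq_0_iff)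
    have "of_real \<alpha> * u t (-1) + of_real \<beta> * v t 1 = of_real (\<alpha> + \<beta>) * u t 0"
      using uv by (simp add: algebra_simps)
    then have "(of_real \<alpha> * u t (-1) + of_real \<beta> * v t 1) / of_real (\<alpha> + \<beta>) = u t 0"
      by (simp only: nonzero_mult_div_cancel_left[OF nz])
    then have g0: "glue \<alpha> \<beta> (?w t) 0 = u t 0" by (simp add: glue_def pair_seq_def)
    have gl: "glue \<alpha> \<beta> (?w t) k = u t k" if "k \<le> 0" for k
      using that g0 by (cases "k = 0") (auto simp: glue_def pair_seq_def)
    have gr: "glue \<alpha> \<beta> (?w t) k = v t k" if "0 \<le> k" for k
      using that g0 uv(1) by (cases "k = 0") (auto simp: glue_def pair_seq_def)
    have rot: "d = \<i> * (of_real r * L)" if "\<i> * d + of_real r * L = 0" for d L :: complex and r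
    proof -
      have "\<i> * d = - (of_real r * L)" using that by (simp add: eq_neg_iff_add_eq_0)
      then have "\<i> * (\<i> * d) = \<i> * - (of_real r * L)" by simp
      then show ?thesis by simp
    qed
    show ?thesis
    proof (cases "j < 0")
      case True
      then have "t \<noteq> 0 \<and> j \<le> -1" using t by simp
      moreover have "\<forall>t j. t \<noteq> 0 \<and> j \<le> -1 \<longrightarrow> (\<exists>u'. ((\<lambda>s. u s j) has_vector_derivative u') (at t) \<and>
          \<i> * u' + of_real \<alpha> * discrete_laplacian (u t) j = 0)"
        using sol unfolding is_solution_def \<alpha>_def by (elim conjE) assumption
      ultimately obtain u' where u': "((\<lambda>s. u s j) has_vector_derivative u') (at t)" "\<i> * u' + of_real \<alpha> * discrete_laplacian (u t) j = 0"
        by blast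
      have "hop \<alpha> \<beta> (?w t) j = of_real \<alpha> * discrete_laplacian (u t) j"
        using True by (simp add: hop_def discrete_laplacian_def gl)
      then have "u' = \<i> * hop \<alpha> \<beta> (?w t) j" using rot[OF u'(2)] by simp
      moreover have "(\<lambda>s. ?w s j) = (\<lambda>s. u s j)" using True by (simp add: pair_seq_def)
      ultimately show ?thesis using u'(1) by simp
    next
      case False
      then have j1: "j \<ge> 1" using j by simp
      then have "t \<noteq> 0 \<and> j \<ge> 1" using t by simp
      moreover have "\<forall>t j. t \<noteq> 0 \<and> j \<ge> 1 \<longrightarrow> (\<exists>v'. ((\<lambda>s. v s j) has_vector_derivative v') (at t) \<and>
          \<i> * v' + of_real \<beta> * discrete_laplacian (v t) j = 0)"
        using sol unfolding is_solution_def \<beta>_def by (elim conjE) assumption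
      ultimately obtain v' where v': "((\<lambda>s. v s j) has_vector_derivative v') (at t)" "\<i> * v' + of_real \<beta> * discrete_laplacian (v t) j = 0"
        by blast
      have "hop \<alpha> \<beta> (?w t) j = of_real \<beta> * discrete_laplacian (v t) j"
        using j1 by (simp add: hop_def discrete_laplacian_def gr)
      then have "v' = \<i> * hop \<alpha> \<beta> (?w t) j" using rot[OF v'(2)] by simp
      moreover have "(\<lambda>s. ?w s j) = (\<lambda>s. v s j)" using j1 by (simp add: pair_seq_def)
      ultimately show ?thesis using v'(1) by simp
    qed
  qed
  show ?thesis
    unfolding bdd_solution_def \<alpha>_def[symmetric] \<beta>_def[symmetric]
    using cont bound deriv by blast
qed

lemma is_solution_initial:
  assumes "is_solution b1 b2 \<phi> u v" "j \<noteq> 0"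
  shows "pair_seq (u 0) (v 0) j = \<phi> j"
  using assms unfolding is_solution_def pair_seq_def by auto

text \<open>The difference is a bounded solution starting from 0, so stability applies with
  \<epsilon> = 0.\<close>

lemma is_solution_unique:
  assumes b: "0 < b1" "0 < b2" and sol: "is_solution b1 b2 \<phi> u v" "is_solution b1 b2 \<phi> u' v'" and j: "j \<noteq> 0"
  shows "pair_seq (u' t) (v' t) j = pair_seq (u t) (v t) j"
proof -
  have "bdd_solution (1 / b1^2) (1 / b2^2) (\<lambda>t j. pair_seq (u' t) (v' t) j - pair_seq (u t) (v t) j)"
    by (intro bdd_solution_diff is_solution_imp_bdd_solution[OF b sol(1)] is_solution_imp_bdd_solution[OF b sol(2)])
  then have "cmod (pair_seq (u' t) (v' t) j - pair_seq (u t) (v t) j) \<le> 0 * exp (4 * (1 / b1^2 + 1 / b2^2) * \<bar>t\<bar>)"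
    by (rule bdd_solution_stability[rotated 2])
      (use b j is_solution_initial[OF sol(1)] is_solution_initial[OF sol(2)] in auto)
  then show ?thesis by simp
qed

lemma is_solution_exists:
  assumes b: "0 < b1" "0 < b2" and \<phi>: "\<phi> \<in> l2"
  shows "\<exists>u v. is_solution b1 b2 \<phi> u v"
proof -
  define \<alpha> \<beta> where "\<alpha> = 1 / b1^2" and "\<beta> = 1 / b2^2"
  have ab: "0 < \<alpha>" "0 < \<beta>" using b by (auto simp: \<alpha>_def \<beta>_def)
  have nz: "of_real \<alpha> + of_real \<beta> \<noteq> (0::complex)" using ab by (simp flip: of_real_add)
  have \<phi>': "l2_bounded \<phi> (l2_norm \<phi>)" by (rule l2_imp_bounded[OF \<phi>])
  let ?w = "propagator \<alpha> \<beta> \<phi>"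
  \<comment> \<open>One function serves as both unknowns: \<open>glue\<close> supplies the common
    value at 0.\<close>
  define u where "u t = glue \<alpha> \<beta> (?w t)" for t
  have pw: "pair_seq (u t) (u t) j = ?w t j" if "j \<noteq> 0" for t j
    using that by (auto simp: pair_seq_def u_def glue_def)
  have C: "(\<lambda>t. pair_seq (u t) (u t)) \<in> C_l2"
  proof -
    have "(\<lambda>j. (cmod (pair_seq (u t) (u t) j))^2) summable_on nonzero_ints \<longleftrightarrow> (\<lambda>j. (cmod (?w t j))^2) summable_on nonzero_ints" for t
      by (rule summable_on_cong) (simp add: pw)
    moreover have "l2_norm (\<lambda>j. pair_seq (u s) (u s) j - pair_seq (u t) (u t) j) = l2_norm (\<lambda>j. ?w s j - ?w t j)" for s t
      unfolding l2_norm_def by (intro arg_cong[of _ _ sqrt] infsum_cong) (simp add: pw)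
    ultimately show ?thesis
      using propagator_C_l2[OF ab \<phi>'] by (simp add: C_l2_def l2_def)
  qed
  have deriv: "\<exists>d. ((\<lambda>s. u s j) has_vector_derivative d) (at t) \<and> \<i> * d + of_real (if j < 0 then \<alpha> else \<beta>) * discrete_laplacian (u t) j = 0"
    if "j \<noteq> 0" for t j
  proof (intro exI conjI)
    have "(\<lambda>s. u s j) = (\<lambda>s. ?w s j)" using that by (simp add: u_def glue_def)
    then show "((\<lambda>s. u s j) has_vector_derivative \<i> * hop \<alpha> \<beta> (?w t) j) (at t)"
      using propagator_derivative[OF ab \<phi>' that] by simp
    show "\<i> * (\<i> * hop \<alpha> \<beta> (?w t) j) + of_real (if j < 0 then \<alpha> else \<beta>) * discrete_laplacian (u t) j = 0"
      by (simp add: hop_def u_def)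
  qed
  have flux: "of_real \<alpha> * (u t (-1) - u t 0) = of_real \<beta> * (u t 0 - u t 1)" for t
    using nz by (simp add: u_def glue_def field_simps)
  have init: "u 0 j = \<phi> j" if "j \<noteq> 0" for j
    using that by (simp add: u_def glue_def propagator_initial)
  have "is_solution b1 b2 \<phi> u u"
    unfolding is_solution_def \<alpha>_def[symmetric] \<beta>_def[symmetric]
  proof (intro conjI allI impI C flux refl)
    fix t :: real and j :: int assume "t \<noteq> 0 \<and> j \<le> -1"
    then show "\<exists>d. ((\<lambda>s. u s j) has_vector_derivative d) (at t) \<and> \<i> * d + of_real \<alpha> * discrete_laplacian (u t) j = 0"
      using deriv[of j t] by simp
  next
    fix t :: real and j :: int assume "t \<noteq> 0 \<and> j \<ge> 1"
    then show "\<exists>d. ((\<lambda>s. u s j) has_vector_derivative d) (at t) \<and> \<i> * d + of_real \<beta> * discrete_laplacian (u t) j = 0"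
      using deriv[of j t] by simp
  qed (use init in auto)
  then show ?thesis by blast
qed

text \<open>The solution is compared with a finite superposition of kernels, which obeys the decay
  bound with the full norm of the data. Outside F the data are uniformly small; the stability factor
  is large but fixed for the given t, so it is divided out when the tail is chosen, leaving an
  arbitrary error e.\<close>

lemma l1_decay:
  assumes ab: "0 < \<alpha>" "0 < \<beta>"
    and D: "0 < D" "\<And>k. k \<noteq> 0 \<Longrightarrow> \<exists>G. decaying_kernel \<alpha> \<beta> D k G"
    and w: "bdd_solution \<alpha> \<beta> w" and \<phi>: "\<phi> \<in> l1" and init: "\<And>j. j \<noteq> 0 \<Longrightarrow> w 0 j = \<phi> j" and j: "j \<noteq> 0"
  shows "cmod (w t j) \<le> D * decay t * l1_norm \<phi>"
proof (rule field_le_epsilon)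
  fix e :: real assume e: "0 < e"
  let ?d = "D * decay t"
  define \<epsilon> where "\<epsilon> = e / exp (4 * (\<alpha> + \<beta>) * \<bar>t\<bar>)"
  have eps: "0 < \<epsilon>" "\<epsilon> * exp (4 * (\<alpha> + \<beta>) * \<bar>t\<bar>) = e" using e by (auto simp: \<epsilon>_def)
  have sm: "(\<lambda>j. cmod (\<phi> j)) summable_on nonzero_ints" using \<phi> by (simp add: l1_def)
  obtain G where G: "\<And>k. k \<noteq> 0 \<Longrightarrow> decaying_kernel \<alpha> \<beta> D k (G k)" using D(2) by metis
  obtain F where F: "finite F" "F \<subseteq> nonzero_ints" "dist (\<Sum>k\<in>F. cmod (\<phi> k)) (l1_norm \<phi>) \<le> \<epsilon>"
    unfolding l1_norm_def using infsum_finite_approximation[OF sm eps(1)] by blast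
  have le: "(\<Sum>k\<in>S. cmod (\<phi> k)) \<le> l1_norm \<phi>" if "finite S" "S \<subseteq> nonzero_ints" for S
    unfolding l1_norm_def using sm that by (intro finite_sum_le_infsum) auto
  \<comment> \<open>Enlarging F by one site keeps the sum below the total, so the missing mass
    bounds each single value outside F.\<close>
  have tail: "cmod (\<phi> k) \<le> \<epsilon>" if "k \<noteq> 0" "k \<notin> F" for k
    using le[of "insert k F"] F that by (simp add: dist_real_def)
  let ?s = "\<lambda>t j. \<Sum>k\<in>F. \<phi> k * G k t j"
  have s: "bdd_solution \<alpha> \<beta> ?s"
  proof (rule bdd_solution_sum[OF F(1)])
    fix k assume "k \<in> F"
    then have "k \<noteq> 0" using F(2) by blast
    then show "bdd_solution \<alpha> \<beta> (G k)" using G[of k] unfolding decaying_kernel_def by blast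
  qed
  have "cmod (w t j - ?s t j) \<le> \<epsilon> * exp (4 * (\<alpha> + \<beta>) * \<bar>t\<bar>)"
  proof (rule bdd_solution_stability[OF ab bdd_solution_diff[OF w s] _ j])
    fix i :: int assume i: "i \<noteq> 0"
    have "?s 0 i = (\<Sum>k\<in>F. if k = i then \<phi> k else 0)"
    proof (rule sum.cong)
      fix k assume "k \<in> F"
      then have "k \<noteq> 0" using F(2) by blast
      then have "G k 0 i = (if i = k then 1 else 0)" using G[of k] i unfolding decaying_kernel_def by blast
      then show "\<phi> k * G k 0 i = (if k = i then \<phi> k else 0)" by auto
    qed simp
    also have "\<dots> = (if i \<in> F then \<phi> i else 0)" using F(1) by (simp add: sum.delta')
    finally show "cmod (w 0 i - ?s 0 i) \<le> \<epsilon>" using init[OF i] tail[OF i] eps(1) by auto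
  qed
  moreover have "cmod (?s t j) \<le> ?d * l1_norm \<phi>"
  proof -
    have "cmod (?s t j) \<le> (\<Sum>k\<in>F. cmod (\<phi> k) * ?d)"
    proof (rule sum_norm_le)
      fix k assume "k \<in> F"
      then have "k \<noteq> 0" using F(2) by blast
      then have "cmod (G k t j) \<le> ?d" using G[of k] j unfolding decaying_kernel_def by blast
      then show "cmod (\<phi> k * G k t j) \<le> cmod (\<phi> k) * ?d" by (simp add: norm_mult mult_left_mono)
    qed
    also have "\<dots> = ?d * (\<Sum>k\<in>F. cmod (\<phi> k))" unfolding sum_distrib_left by (simp only: mult.commute)
    also have "\<dots> \<le> ?d * l1_norm \<phi>" using le[OF F(1,2)] D(1) by (intro mult_left_mono) auto
    finally show ?thesis .
  qed
  ultimately show "cmod (w t j) \<le> ?d * l1_norm \<phi> + e"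
    using norm_triangle_ineq2[of "w t j" "?s t j"] eps(2) by linarith
qed

theorem theorem1p1:
  fixes b1 b2 :: real
  assumes "b1 > 0" and "b2 > 0"
  shows "(\<forall>\<phi>\<in>l2. \<exists>u v. is_solution b1 b2 \<phi> u v \<and>
            (\<forall>u' v'. is_solution b1 b2 \<phi> u' v' \<longrightarrow>
               (\<forall>t. (\<forall>j\<le>-1. u' t j = u t j) \<and> (\<forall>j\<ge>1. v' t j = v t j)))) \<and>
         (\<exists>C>0. \<forall>\<phi>\<in>l1. \<forall>u v. is_solution b1 b2 \<phi> u v \<longrightarrow>
            (\<forall>t. linf_norm (pair_seq (u t) (v t)) \<le> C * (\<bar>t\<bar> + 1) powr (-1/3) * l1_norm \<phi>))"
proof (intro conjI ballI)
  fix \<phi> assume "\<phi> \<in> l2"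
  then obtain u v where uv: "is_solution b1 b2 \<phi> u v" using is_solution_exists[OF assms] by blast
  have "(\<forall>j\<le>-1. u' t j = u t j) \<and> (\<forall>j\<ge>1. v' t j = v t j)" if "is_solution b1 b2 \<phi> u' v'" for u' v' t
  proof (intro conjI allI impI)
    fix j :: int assume "j \<le> -1"
    then show "u' t j = u t j" using is_solution_unique[OF assms uv that, of j t] by (simp add: pair_seq_def)
  next
    fix j :: int assume "j \<ge> 1"
    then show "v' t j = v t j" using is_solution_unique[OF assms uv that, of j t] by (simp add: pair_seq_def)
  qed
  then show "\<exists>u v. is_solution b1 b2 \<phi> u v \<and> (\<forall>u' v'. is_solution b1 b2 \<phi> u' v' \<longrightarrow>
      (\<forall>t. (\<forall>j\<le>-1. u' t j = u t j) \<and> (\<forall>j\<ge>1. v' t j = v t j)))"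
    using uv by blast
next
  have ab: "0 < 1 / b1\<^sup>2" "0 < 1 / b2\<^sup>2" using assms by auto
  obtain C where C: "C > 0" "\<And>k. k \<noteq> 0 \<Longrightarrow> \<exists>G. decaying_kernel (1 / b1\<^sup>2) (1 / b2\<^sup>2) C k G"
    using decaying_kernel_exists[OF ab] by blast
  have "linf_norm (pair_seq (u t) (v t)) \<le> C * (\<bar>t\<bar> + 1) powr (-1/3) * l1_norm \<phi>"
    if "\<phi> \<in> l1" "is_solution b1 b2 \<phi> u v" for \<phi> u v t
    unfolding linf_norm_def
  proof (rule cSUP_least)
    have "(1::int) \<in> nonzero_ints" by simp
    then show "nonzero_ints \<noteq> {}" by blast
    fix j assume "j \<in> nonzero_ints"
    then show "cmod (pair_seq (u t) (v t) j) \<le> C * (\<bar>t\<bar> + 1) powr (-1/3) * l1_norm \<phi>"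
      using l1_decay[OF ab C is_solution_imp_bdd_solution[OF assms that(2)] that(1) is_solution_initial[OF that(2)]] by blast
  qed
  then show "\<exists>C>0. \<forall>\<phi>\<in>l1. \<forall>u v. is_solution b1 b2 \<phi> u v \<longrightarrow>
      (\<forall>t. linf_norm (pair_seq (u t) (v t)) \<le> C * (\<bar>t\<bar> + 1) powr (-1/3) * l1_norm \<phi>)"
    using C(1) by blast
qed

end
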